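(* Let $n \ge 1$ be an integer, let $\lambda > 0$ be a real number, and let $u:\mathbb{R}^n \to \mathbb{R}$ be a nonzero (i.e. not identically zero) $\lambda$-homogeneous solution to the thin obstacle problem in $\mathbb{R}^n$. Then $$\lambda \notin \bigcup_{k \in \mathbb{N}} (2k, 2k+1),$$ where $\mathbb{N} = \{0,1,2,\dots\}$.
   Context: Write points of $\mathbb{R}^n$ as $x=(x_1,\dots,x_n)$; the hyperplane $\{x_n=0\}$ is called the thin space. A solution to the thin obstacle problem in $\mathbb{R}^n$ (with zero obstacle) is a continuous function $u:\mathbb{R}^n\to\mathbb{R}$, even with respect to the thin space (that is, even in the variable $x_n$), such that $$\triangle u = 0 \ \text{ in } \ \mathbb{R}^n \setminus Z(u), \qquad Z(u) := \{x_n = 0\} \cap \{u = 0\},$$ and $$u \ge 0 \ \text{ and } \ u_n \le 0 \ \text{ on } \{x_n = 0\},$$ where $u_n$ denotes the one-sided directional derivative of $u$ in the positive $x_n$ direction. (By the known regularity theory, solutions are of class $C^{1,1/2}$ locally up to the thin space on the closed half-space $\{x_n \ge 0\}$, so $u_n$ is well defined and continuous on $\{x_n=0\}$.) The function $u$ is $\lambda$-homogeneous if $u(tx) = t^\lambda u(x)$ for all $t>0$ and $x \in \mathbb{R}^n$. *)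

theory Defs
  imports "HOL-Analysis.Analysis"
begin

definition partial :: "'n::finite \<Rightarrow> (real ^ 'n \<Rightarrow> real) \<Rightarrow> real ^ 'n \<Rightarrow> real" where
  "partial i f x = frechet_derivative f (at x) (axis i 1)"

(* Class C^2; meant for open S. *)
definition C2_on :: "(real ^ 'n::finite) set \<Rightarrow> (real ^ 'n \<Rightarrow> real) \<Rightarrow> bool" where
  "C2_on S f \<longleftrightarrow>
     (\<forall>x\<in>S. f differentiable (at x)) \<and>
     (\<forall>i. \<forall>x\<in>S. partial i f differentiable (at x)) \<and>
     (\<forall>i j. continuous_on S (partial i (partial j f)))"

definition laplacian :: "(real ^ 'n::finite \<Rightarrow> real) \<Rightarrow> real ^ 'n \<Rightarrow> real" where
  "laplacian f x = (\<Sum>i\<in>UNIV. partial i (partial i f) x)"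

definition harmonic_on :: "(real ^ 'n::finite) set \<Rightarrow> (real ^ 'n \<Rightarrow> real) \<Rightarrow> bool" where
  "harmonic_on S f \<longleftrightarrow> C2_on S f \<and> (\<forall>x\<in>S. laplacian f x = 0)"

(* In everything below, the index m :: 'n singles out the coordinate written x_n in the
   usual notation, i.e. the one normal to the thin space. *)

definition thin_space :: "'n::finite \<Rightarrow> (real ^ 'n) set" where
  "thin_space m = {x. x $ m = 0}"

definition thin_reflection :: "'n::finite \<Rightarrow> real ^ 'n \<Rightarrow> real ^ 'n" where
  "thin_reflection m x = (\<chi> i. if i = m then - (x $ i) else x $ i)"

definition contact_set :: "'n::finite \<Rightarrow> (real ^ 'n \<Rightarrow> real) \<Rightarrow> (real ^ 'n) set" where
  "contact_set m u = thin_space m \<inter> {x. u x = 0}"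

(* d is the one-sided derivative of u at x in the positive direction of the coordinate m. *)
definition has_normal_derivative ::
    "'n::finite \<Rightarrow> (real ^ 'n \<Rightarrow> real) \<Rightarrow> real \<Rightarrow> real ^ 'n \<Rightarrow> bool" where
  "has_normal_derivative m u d x \<longleftrightarrow>
     ((\<lambda>t. u (x + t *\<^sub>R axis m 1)) has_real_derivative d) (at_right 0)"

(* The contact set is closed for continuous u, so harmonicity is imposed on an open set.
   Of the regularity of solutions up to the thin space, only the existence of the one-sided
   normal derivative, needed for its sign condition to make sense, is part of the definition. *)
definition thin_obstacle_solution :: "'n::finite \<Rightarrow> (real ^ 'n \<Rightarrow> real) \<Rightarrow> bool" where
  "thin_obstacle_solution m u \<longleftrightarrow>
     continuous_on UNIV u \<and>
     (\<forall>x. u (thin_reflection m x) = u x) \<and>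
     harmonic_on (- contact_set m u) u \<and>
     (\<forall>x\<in>thin_space m. u x \<ge> 0 \<and> (\<exists>d. has_normal_derivative m u d x \<and> d \<le> 0))"

definition homogeneous :: "real \<Rightarrow> (real ^ 'n::finite \<Rightarrow> real) \<Rightarrow> bool" where
  "homogeneous l u \<longleftrightarrow> (\<forall>t>0. \<forall>x. u (t *\<^sub>R x) = t powr l * u x)"

end

theory Submission
  imports Defs "HOL-Probability.Distributions" "HOL-Real_Asymp.Real_Asymp"
begin

text \<open>
  Write \<open>n\<close> for the coordinate normal to the thin space and \<open>G x = exp (- |x|^2 / 2)\<close>. Off the contact set
  a homogeneous solution satisfies \<open>\<Delta> u - x \<cdot> \<nabla> u = - l u\<close>, and \<open>\<Delta> - x \<cdot> \<nabla>\<close> is symmetric with respect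
  to \<open>G\<close>. Let \<open>h\<close> be the polynomially bounded solution on \<open>s \<ge> 0\<close> of Hermite's equation
  \<open>h'' - s h' + l h = 0\<close>. Green's formula for \<open>u\<close> against \<open>h x\<^sub>n\<close> on the half-space \<open>x\<^sub>n > 0\<close>
  formally reads \<open>h 0 * \<integral> u\<^sub>n G = h' 0 * \<integral> u G\<close>, both integrals over the thin space. The values \<open>h 0\<close> and
  \<open>h' 0\<close> have the same sign exactly when \<open>l\<close> lies in some \<open>(2k, 2k+1)\<close>, so then \<open>u \<ge> 0\<close> and
  \<open>u\<^sub>n \<le> 0\<close> force both integrals to vanish.

  As \<open>u\<^sub>n\<close> is only a pointwise one-sided derivative, \<open>\<integral> u\<^sub>n G\<close> is replaced by the equivalent
  \<open>l * \<integral> u G\<close> over the half-space, and its sign is obtained from the inequality \<open>v \<le> c u\<close>, where \<open>v\<close> is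
  the convolution of \<open>G\<close> and \<open>u\<close> and \<open>c = \<integral> G\<close>. It is a consequence of the maximum principle: both
  sides solve \<open>\<Delta> w + x \<cdot> \<nabla> w = l w\<close> off the thin space.
  If \<open>\<integral> u G = 0\<close>, this inequality is an equality; then \<open>u\<close> is real analytic, hence zero, since its
  degree of homogeneity is not an integer.
\<close>

section \<open>Integrals with Gaussian weights\<close>

text \<open>The contradiction comes from bounding one number, the Gaussian mean of \<open>u\<close>
  over the half-space, from both sides. Green's formula with \<open>h\<close> makes it nonnegative
  because \<open>u \<ge> 0\<close>; the comparison, evaluated at the origin where homogeneity forces
  \<open>u 0 = 0\<close>, makes it nonpositive because \<open>u\<^sub>n \<le> 0\<close>. That
  \<open>l\<close> times this mean stands for the integral of \<open>u\<^sub>n G\<close> is Green's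
  formula with the test function 1. The obstacle is the contact set: beyond the one-sided normal
  derivative nothing is assumed there about derivatives of \<open>u\<close>. So no boundary term is
  ever formed. Test functions are corrected until they vanish to second order on the thin space, and
  after integration by parts \<open>u\<close> enters only through its values. The convolution is a
  good competitor for three reasons: homogeneity gives it the equation of \<open>u\<close>, evenness
  makes its normal derivative vanish on the thin space, and its normalised form differs from
  \<open>u\<close> by \<open>o(|x| powr l)\<close> at infinity. The sign of \<open>l\<close> then
  yields the maximum principle.\<close>

lemma integral_has_real_derivative_dominated:
  fixes f f' :: "real \<Rightarrow> 'a \<Rightarrow> real"
  assumes d: "d > 0"
    and int: "\<And>t. \<bar>t - t0\<bar> < d \<Longrightarrow> integrable M (f t)"
    and deriv: "\<And>t x. \<bar>t - t0\<bar> < d \<Longrightarrow> x \<in> space M \<Longrightarrow> ((\<lambda>t. f t x) has_real_derivative f' t x) (at t)"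
    and meas: "f' t0 \<in> borel_measurable M"
    and w: "integrable M w"
    and bound: "\<And>t x. \<bar>t - t0\<bar> < d \<Longrightarrow> x \<in> space M \<Longrightarrow> \<bar>f' t x\<bar> \<le> w x"
  shows "((\<lambda>t. \<integral>x. f t x \<partial>M) has_real_derivative (\<integral>x. f' t0 x \<partial>M)) (at t0)"
proof -
  let ?q = "\<lambda>h x. (f (t0 + h) x - f t0 x) / h"
  have near: "eventually (\<lambda>h. h \<noteq> 0 \<and> \<bar>h\<bar> < d) (at (0::real))"
    using d by (auto simp: eventually_at dist_real_def)
  have qb: "\<bar>?q h x\<bar> \<le> w x" if h: "h \<noteq> 0" "\<bar>h\<bar> < d" and x: "x \<in> space M" for h x
  proof -
    have "norm (f (t0 + h) x - f t0 x) \<le> w x * norm (t0 + h - t0)"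
    proof (rule field_differentiable_bound)
      show "convex (ball t0 d)" by simp
      show "t0 + h \<in> ball t0 d" "t0 \<in> ball t0 d" using h d by (auto simp: dist_real_def)
      fix z assume z: "z \<in> ball t0 d"
      then have *: "\<bar>z - t0\<bar> < d" by (simp add: dist_real_def abs_minus_commute)
      show "((\<lambda>t. f t x) has_field_derivative f' z x) (at z within ball t0 d)"
        using deriv[OF * x] has_field_derivative_at_within by blast
      show "norm (f' z x) \<le> w x" using bound[OF * x] by simp
    qed
    then show ?thesis using h by (simp add: field_simps abs_divide)
  qed
  \<comment> \<open>Setting the quotient to 0 for \<open>\<bar>h\<bar> \<ge> d\<close> makes the
    bound by \<open>w\<close> hold for every term of a sequence tending to 0, as dominated
    convergence requires; near 0 nothing changes.\<close>
  have "((\<lambda>h. \<integral>x. (if h \<noteq> 0 \<and> \<bar>h\<bar> < d then ?q h x else 0) \<partial>M) \<longlongrightarrow> (\<integral>x. f' t0 x \<partial>M)) (at (0::real))"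
    unfolding filterlim_def[symmetric] tendsto_at_iff_sequentially comp_def
  proof (intro allI impI)
    fix X :: "nat \<Rightarrow> real"
    assume X0: "\<forall>i. X i \<in> UNIV - {0}" and X: "X \<longlonglongrightarrow> 0"
    let ?g = "\<lambda>h x. (if h \<noteq> 0 \<and> \<bar>h\<bar> < d then ?q h x else 0)"
    show "(\<lambda>i. \<integral>x. ?g (X i) x \<partial>M) \<longlonglongrightarrow> (\<integral>x. f' t0 x \<partial>M)"
    proof (rule integral_dominated_convergence[where w = w])
      show "f' t0 \<in> borel_measurable M" "integrable M w" by fact+
      show "?g (X i) \<in> borel_measurable M" for i
      proof (cases "\<bar>X i\<bar> < d")
        case True
        then have "integrable M (f (t0 + X i))" "integrable M (f t0)" using int d by auto
        then have "(\<lambda>x. ?q (X i) x) \<in> borel_measurable M" by simp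
        then show ?thesis using True X0 by simp
      qed simp
      show "AE x in M. norm (?g (X i) x) \<le> w x" for i
      proof (rule AE_I2)
        fix x assume x: "x \<in> space M"
        have "\<bar>f' t0 x\<bar> \<le> w x" using bound[of t0 x] x d by simp
        then have "0 \<le> w x" by linarith
        then show "norm (?g (X i) x) \<le> w x" using qb[of "X i" x] x by auto
      qed
      show "AE x in M. (\<lambda>i. ?g (X i) x) \<longlonglongrightarrow> f' t0 x"
      proof (rule AE_I2)
        fix x assume x: "x \<in> space M"
        have "((\<lambda>h. ?q h x) \<longlongrightarrow> f' t0 x) (at 0)"
          using deriv[of t0 x] x d by (simp add: DERIV_def)
        then have "(\<lambda>i. ?q (X i) x) \<longlonglongrightarrow> f' t0 x"
          using X0 X unfolding tendsto_at_iff_sequentially comp_def by blast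
        moreover have "eventually (\<lambda>i. \<bar>X i\<bar> < d) sequentially"
          using X d by (metis (no_types, lifting) LIMSEQ_iff eventually_sequentially real_norm_def diff_zero)
        then have "eventually (\<lambda>i. ?q (X i) x = ?g (X i) x) sequentially"
          by (rule eventually_mono) (use X0 in auto)
        ultimately show "(\<lambda>i. ?g (X i) x) \<longlonglongrightarrow> f' t0 x"
          by (rule Lim_transform_eventually)
      qed
    qed
  qed
  moreover have "eventually (\<lambda>h. (\<integral>x. (if h \<noteq> 0 \<and> \<bar>h\<bar> < d then ?q h x else 0) \<partial>M)
      = ((\<integral>x. f (t0 + h) x \<partial>M) - (\<integral>x. f t0 x \<partial>M)) / h) (at 0)"
    using near
  proof (rule eventually_mono)
    fix h assume h: "h \<noteq> 0 \<and> \<bar>h\<bar> < d"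
    then have "integrable M (f (t0 + h))" "integrable M (f t0)" using int d by auto
    then show "(\<integral>x. (if h \<noteq> 0 \<and> \<bar>h\<bar> < d then ?q h x else 0) \<partial>M)
      = ((\<integral>x. f (t0 + h) x \<partial>M) - (\<integral>x. f t0 x \<partial>M)) / h"
      using h by simp
  qed
  ultimately show ?thesis
    unfolding DERIV_def by (rule Lim_transform_eventually)
qed

lemma poly_exp_bound:
  fixes c :: real assumes "c > 0"
  obtains B where "B > 0" "\<And>r. r \<ge> 0 \<Longrightarrow> (1 + r) ^ N * exp (- c * r\<^sup>2) \<le> B"
proof -
  have "((\<lambda>r. (1 + r) ^ N * exp (- c * r\<^sup>2)) \<longlongrightarrow> 0) at_top"
    using assms by real_asymp
  then have "eventually (\<lambda>r. (1 + r) ^ N * exp (- c * r\<^sup>2) < 1) at_top"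
    by (rule order_tendstoD) simp
  then obtain R where R: "\<And>r. r \<ge> R \<Longrightarrow> (1 + r) ^ N * exp (- c * r\<^sup>2) < 1"
    by (auto simp: eventually_at_top_linorder)
  have "compact ((\<lambda>r. (1 + r) ^ N * exp (- c * r\<^sup>2)) ` {0..max R 0})"
    by (intro compact_continuous_image continuous_intros) auto
  then obtain B where B: "\<forall>y\<in>(\<lambda>r. (1 + r) ^ N * exp (- c * r\<^sup>2)) ` {0..max R 0}. norm y \<le> B"
    using compact_imp_bounded bounded_iff by metis
  have "(1 + r) ^ N * exp (- c * r\<^sup>2) \<le> max B 1" if "r \<ge> 0" for r
  proof (cases "r \<le> max R 0")
    case True
    then have "norm ((1 + r) ^ N * exp (- c * r\<^sup>2)) \<le> B" using B that by auto
    then have "(1 + r) ^ N * exp (- c * r\<^sup>2) \<le> B"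
      unfolding real_norm_def by linarith
    then show ?thesis by simp
  next
    case False
    then have "r \<ge> R" by simp
    from R[OF this] show ?thesis by simp
  qed
  then show ?thesis using that[of "max B 1"] by auto
qed

lemma gaussian_integrable_real:
  fixes c :: real assumes "c > 0"
  shows "integrable lborel (\<lambda>x::real. exp (- c * x\<^sup>2))"
proof -
  have "integrable lborel (\<lambda>x::real. indicator {0..} x *\<^sub>R exp (- x\<^sup>2))"
    using gaussian_moment_0 by (simp add: has_bochner_integral_iff)
  then have "has_bochner_integral lborel (\<lambda>x::real. exp (- x\<^sup>2)) (2 * (sqrt pi / 2))"
    using has_bochner_integral_even_function[OF gaussian_moment_0] by simp
  then have "integrable lborel (\<lambda>x::real. exp (- x\<^sup>2))" by (simp add: has_bochner_integral_iff)
  then have "integrable lborel (\<lambda>x::real. exp (- (0 + sqrt c * x)\<^sup>2))"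
    by (rule lborel_integrable_real_affine) (use assms in simp)
  then show ?thesis using assms by (simp add: power_mult_distrib)
qed

lemma gaussian_integrable:
  fixes c :: real assumes c: "c > 0"
  shows "integrable lborel (\<lambda>x::'a::euclidean_space. exp (- c * (norm x)\<^sup>2))"
proof -
  have "(\<integral>\<^sup>+x. ennreal (exp (- c * (norm (x::'a))\<^sup>2)) \<partial>lborel)
      = (\<integral>\<^sup>+x. (\<Prod>b\<in>(Basis::'a set). ennreal (exp (- c * (x \<bullet> b)\<^sup>2))) \<partial>lborel)"
  proof (rule nn_integral_cong)
    fix x :: 'a
    have "(norm x)\<^sup>2 = (\<Sum>b\<in>Basis. (x \<bullet> b)\<^sup>2)"
      by (simp add: norm_eq_sqrt_inner euclidean_inner[of x x] power2_eq_square sum_nonneg)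
    then have "exp (- c * (norm x)\<^sup>2) = (\<Prod>b\<in>Basis. exp (- c * (x \<bullet> b)\<^sup>2))"
      by (simp add: sum_distrib_left exp_sum[symmetric] sum_negf)
    then show "ennreal (exp (- c * (norm x)\<^sup>2)) = (\<Prod>b\<in>Basis. ennreal (exp (- c * (x \<bullet> b)\<^sup>2)))"
      by (simp add: prod_ennreal)
  qed
  also have "\<dots> = (\<Prod>b\<in>(Basis::'a set). (\<integral>\<^sup>+x. ennreal (exp (- c * x\<^sup>2)) \<partial>lborel))"
    by (rule nn_integral_lborel_prod) auto
  also have "\<dots> < \<infinity>"
    using gaussian_integrable_real[OF c] by (simp add: integrable_iff_bounded power_less_top_ennreal)
  finally show ?thesis by (simp add: integrable_iff_bounded)
qed

text \<open>Half of the Gaussian exponent absorbs the polynomial, the other half remains integrable.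
  Homogeneous functions grow polynomially, so the dominations below are brought to this
  shape.\<close>

lemma integrable_gaussian_bound:
  fixes f :: "'a::euclidean_space \<Rightarrow> real"
  assumes c: "c > 0" and f: "f \<in> borel_measurable lborel"
    and b: "\<And>x. \<bar>f x\<bar> \<le> C * ((1 + norm x) ^ N * exp (- c * (norm x)\<^sup>2))"
  shows "integrable lborel f"
proof -
  obtain B where B: "B > 0" "\<And>r. r \<ge> 0 \<Longrightarrow> (1 + r) ^ N * exp (- (c/2) * r\<^sup>2) \<le> B"
    using poly_exp_bound[of "c/2" N] c by auto
  have "integrable lborel (\<lambda>x::'a. \<bar>C\<bar> * B * exp (- (c/2) * (norm x)\<^sup>2))"
    using gaussian_integrable[of "c/2", where 'a='a] c by simp
  then show ?thesis
  proof (rule Bochner_Integration.integrable_bound[OF _ f], intro AE_I2)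
    fix x :: 'a
    have "(1 + norm x) ^ N * exp (- c * (norm x)\<^sup>2)
        = ((1 + norm x) ^ N * exp (- (c/2) * (norm x)\<^sup>2)) * exp (- (c/2) * (norm x)\<^sup>2)"
      by (simp add: mult.assoc flip: exp_add)
    also have "\<dots> \<le> B * exp (- (c/2) * (norm x)\<^sup>2)"
      by (intro mult_right_mono B(2)) auto
    finally have *: "(1 + norm x) ^ N * exp (- c * (norm x)\<^sup>2) \<le> B * exp (- (c/2) * (norm x)\<^sup>2)" .
    have "\<bar>f x\<bar> \<le> \<bar>C\<bar> * ((1 + norm x) ^ N * exp (- c * (norm x)\<^sup>2))"
    proof (rule order_trans[OF b])
      show "C * ((1 + norm x) ^ N * exp (- c * (norm x)\<^sup>2)) \<le> \<bar>C\<bar> * ((1 + norm x) ^ N * exp (- c * (norm x)\<^sup>2))"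
        by (intro mult_right_mono) auto
    qed
    also have "\<dots> \<le> \<bar>C\<bar> * (B * exp (- (c/2) * (norm x)\<^sup>2))"
      by (intro mult_left_mono *) auto
    finally show "norm (f x) \<le> norm (\<bar>C\<bar> * B * exp (- (c/2) * (norm x)\<^sup>2))"
      using B by (simp add: abs_mult mult.assoc)
  qed
qed

section \<open>Changes of variables and integration by parts\<close>

lemma integral_scaleR_lborel:
  fixes f :: "'a::euclidean_space \<Rightarrow> real"
  assumes "c > 0" "f \<in> borel_measurable borel"
  shows "(\<integral>x. f x \<partial>lborel) = c ^ DIM('a) * (\<integral>x. f (c *\<^sub>R x) \<partial>lborel)"
proof -
  have "(\<integral>x. f x \<partial>lborel) = (\<integral>x. f x \<partial>density (distr lborel borel (\<lambda>x. 0 + c *\<^sub>R x)) (\<lambda>_. \<bar>c\<bar>^DIM('a)))"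
    using lborel_affine[of c "0::'a"] assms by simp
  also have "\<dots> = c ^ DIM('a) * (\<integral>x. f (c *\<^sub>R x) \<partial>lborel)"
    using assms by (subst integral_density) (auto simp: integral_distr)
  finally show ?thesis .
qed

lemma integral_translate_lborel:
  fixes f :: "'a::euclidean_space \<Rightarrow> real"
  assumes "f \<in> borel_measurable borel"
  shows "(\<integral>x. f (a + x) \<partial>lborel) = (\<integral>x. f x \<partial>lborel)"
  using assms by (subst lborel_distr_plus[of a, symmetric]) (simp add: integral_distr)

text \<open>By translation invariance the integral of \<open>f (r *\<^sub>R e + x)\<close> does not
  depend on \<open>r\<close>, and its derivative at 0 is the integral of \<open>f'\<close>. Summed
  over the coordinate directions this is the divergence theorem for compactly supported
  fields.\<close>

lemma integral_directional_derivative_zero: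
  fixes f f' :: "'a::euclidean_space \<Rightarrow> real"
  assumes c: "continuous_on UNIV f" "continuous_on UNIV f'"
    and d: "\<And>x. ((\<lambda>r. f (x + r *\<^sub>R e)) has_real_derivative f' x) (at 0)"
    and K: "bounded K" "\<And>x. x \<notin> K \<Longrightarrow> f x = 0" "\<And>x. x \<notin> K \<Longrightarrow> f' x = 0"
  shows "(\<integral>x. f' x \<partial>lborel) = 0"
proof -
  obtain R where R: "R > 0" "\<And>x. x \<in> K \<Longrightarrow> norm x \<le> R" using K(1) bounded_pos by blast
  have "bounded (f' ` cball 0 R)"
    by (intro compact_imp_bounded compact_continuous_image continuous_on_subset[OF c(2)]) auto
  then obtain B where B: "B > 0" "\<And>x. x \<in> cball 0 R \<Longrightarrow> \<bar>f' x\<bar> \<le> B"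
    by (auto simp: bounded_pos)
  have d': "((\<lambda>r. f (r *\<^sub>R e + x)) has_real_derivative f' (t *\<^sub>R e + x)) (at t)" for t x
  proof -
    have "((\<lambda>r. f ((t *\<^sub>R e + x) + r *\<^sub>R e)) has_real_derivative f' (t *\<^sub>R e + x)) (at 0)" by (rule d)
    then have "((\<lambda>r. f (r *\<^sub>R e + x)) has_real_derivative f' (t *\<^sub>R e + x)) (at (0 + t))"
      by (subst DERIV_shift) (simp add: algebra_simps)
    then show ?thesis by simp
  qed
  have [measurable]: "f \<in> borel_measurable borel" "f' \<in> borel_measurable borel"
    using c by (auto intro: borel_measurable_continuous_onI)
  have intf: "integrable lborel f"
  proof -
    have "integrable lborel (\<lambda>x. indicator (cball 0 R) x *\<^sub>R f x)"
      by (rule borel_integrable_compact) (auto intro: continuous_on_subset[OF c(1)])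
    moreover have "(\<lambda>x. indicator (cball 0 R) x *\<^sub>R f x) = f"
      using K(2) R by (fastforce simp: indicator_def)
    ultimately show ?thesis by simp
  qed
  have "((\<lambda>r. \<integral>x. f (r *\<^sub>R e + x) \<partial>lborel) has_real_derivative (\<integral>x. f' (0 *\<^sub>R e + x) \<partial>lborel)) (at 0)"
  \<comment> \<open>Translations by \<open>t *\<^sub>R e\<close> with
    \<open>\<bar>t\<bar> < 1\<close> move the support by at most \<open>norm e\<close>, hence the
    ball of radius \<open>R + norm e\<close>.\<close>
  proof (rule integral_has_real_derivative_dominated[where d = 1
        and w = "\<lambda>x. indicator (cball 0 (R + norm e)) x *\<^sub>R B"])
    show "integrable lborel (\<lambda>x. f (t *\<^sub>R e + x))" for t
      using intf lborel_distr_plus[of "t *\<^sub>R e"] integrable_distr_eq[of "(+) (t *\<^sub>R e)" lborel borel f]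
      by simp
    show "integrable lborel (\<lambda>x. indicator (cball 0 (R + norm e)) x *\<^sub>R B)"
      by (rule borel_integrable_compact) auto
    fix t :: real and x assume t: "\<bar>t - 0\<bar> < 1"
    show "((\<lambda>t. f (t *\<^sub>R e + x)) has_real_derivative f' (t *\<^sub>R e + x)) (at t)" by (rule d')
    show "\<bar>f' (t *\<^sub>R e + x)\<bar> \<le> indicator (cball 0 (R + norm e)) x *\<^sub>R B"
    proof (cases "t *\<^sub>R e + x \<in> K")
      case True
      then have "norm (t *\<^sub>R e + x) \<le> R" by (rule R)
      moreover have "norm x \<le> norm (t *\<^sub>R e + x) + norm (t *\<^sub>R e)"
        by (metis add.commute norm_triangle_ineq4 add_diff_cancel_left')
      moreover have "norm (t *\<^sub>R e) \<le> norm e" using t by (simp add: mult_left_le_one_le)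
      ultimately show ?thesis using B(2)[of "t *\<^sub>R e + x"] by (simp add: indicator_def)
    next
      case False
      then show ?thesis using K(3) B by (simp add: indicator_def)
    qed
  qed auto
  moreover have "(\<lambda>r. \<integral>x. f (r *\<^sub>R e + x) \<partial>lborel) = (\<lambda>r. \<integral>x. f x \<partial>lborel)"
    by (intro ext integral_translate_lborel) simp
  ultimately show ?thesis using DERIV_unique[OF _ DERIV_const] by fastforce
qed

section \<open>Hermite's equation\<close>

text \<open>Up to normalisation, the Hermite function of negative order \<open>- (p + 1)\<close>.\<close>

definition hermite_neg :: "real \<Rightarrow> real \<Rightarrow> real" where
  "hermite_neg p s = (\<integral>t. max 0 t powr p * exp (- s * t - t\<^sup>2 / 2) \<partial>lborel)"

text \<open>Uniformity in \<open>\<bar>s\<bar> \<le> S\<close> lets the bound serve for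
  integrability and for differentiation in \<open>s\<close>. The inequality
  \<open>S \<bar>t\<bar> \<le> S^2 + t^2 / 4\<close> spends half of the exponent
  \<open>t^2 / 2\<close>.\<close>

lemma hermite_neg_integrand_bound:
  fixes p s t S :: real
  assumes p: "p > 0" and S: "\<bar>s\<bar> \<le> S"
  shows "\<bar>max 0 t powr p * exp (- s * t - t\<^sup>2 / 2)\<bar>
    \<le> exp (S\<^sup>2) * ((1 + norm t) ^ nat \<lceil>p\<rceil> * exp (- (1/4) * (norm t)\<^sup>2))"
proof -
  have "max 0 t powr p \<le> (1 + \<bar>t\<bar>) powr p" using p by (intro powr_mono2) auto
  also have "\<dots> \<le> (1 + \<bar>t\<bar>) powr real (nat \<lceil>p\<rceil>)" using p by (intro powr_mono real_nat_ceiling_ge) auto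
  also have "\<dots> = (1 + \<bar>t\<bar>) ^ nat \<lceil>p\<rceil>" by (rule powr_realpow) simp
  finally have 1: "max 0 t powr p \<le> (1 + \<bar>t\<bar>) ^ nat \<lceil>p\<rceil>" .
  have "- s * t \<le> \<bar>s\<bar> * \<bar>t\<bar>"
    using abs_ge_self[of "- s * t"] by (simp add: abs_mult)
  also have "\<dots> \<le> S * \<bar>t\<bar>" using S by (rule mult_right_mono) simp
  also have "\<dots> \<le> S\<^sup>2 + t\<^sup>2 / 4"
    using sum_squares_ge_zero[of "S - \<bar>t\<bar> / 2" 0] by (simp add: power2_eq_square algebra_simps)
  finally have "exp (- s * t - t\<^sup>2 / 2) \<le> exp (S\<^sup>2 + - (1/4) * t\<^sup>2)" by simp
  then have 2: "exp (- s * t - t\<^sup>2 / 2) \<le> exp (S\<^sup>2) * exp (- (1/4) * t\<^sup>2)" by (simp only: exp_add)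
  have "\<bar>max 0 t powr p * exp (- s * t - t\<^sup>2 / 2)\<bar>
      \<le> (1 + \<bar>t\<bar>) ^ nat \<lceil>p\<rceil> * (exp (S\<^sup>2) * exp (- (1/4) * t\<^sup>2))"
    using mult_mono[OF 1 2] by (simp add: abs_mult)
  then show ?thesis by (simp add: mult_ac)
qed

lemma hermite_neg_integrable:
  fixes p s :: real
  assumes "p > 0"
  shows "integrable lborel (\<lambda>t. max 0 t powr p * exp (- s * t - t\<^sup>2 / 2))"
proof (rule integrable_gaussian_bound)
  show "\<bar>max 0 t powr p * exp (- s * t - t\<^sup>2 / 2)\<bar>
    \<le> exp (\<bar>s\<bar>\<^sup>2) * ((1 + norm t) ^ nat \<lceil>p\<rceil> * exp (- (1/4) * (norm t)\<^sup>2))" for t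
    by (rule hermite_neg_integrand_bound) (use assms in auto)
qed auto

lemma max_0_powr_Suc: "t * max 0 t powr p = max 0 t powr (p + 1)" for t :: real
  by (cases "t > 0") (auto simp: powr_add max_def)

lemma hermite_neg_deriv:
  assumes p: "p > 0"
  shows "(hermite_neg p has_real_derivative - hermite_neg (p + 1) s) (at s)"
proof -
  let ?f' = "\<lambda>s t::real. - (max 0 t powr (p + 1) * exp (- s * t - t\<^sup>2 / 2))"
  have "((\<lambda>s. \<integral>t. max 0 t powr p * exp (- s * t - t\<^sup>2 / 2) \<partial>lborel) has_real_derivative
      (\<integral>t. ?f' s t \<partial>lborel)) (at s)"
  proof (rule integral_has_real_derivative_dominated[where d = 1
        and w = "\<lambda>t. exp ((\<bar>s\<bar> + 1)\<^sup>2) * ((1 + norm t) ^ nat \<lceil>p + 1\<rceil> * exp (- (1/4) * (norm t)\<^sup>2))"])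
    show "integrable lborel (\<lambda>t::real. exp ((\<bar>s\<bar> + 1)\<^sup>2) * ((1 + norm t) ^ nat \<lceil>p + 1\<rceil> * exp (- (1/4) * (norm t)\<^sup>2)))"
      by (rule integrable_gaussian_bound[where c = "1/4" and C = "exp ((\<bar>s\<bar> + 1)\<^sup>2)" and N = "nat \<lceil>p + 1\<rceil>"])
        (simp_all add: abs_mult)
    fix r t :: real assume r: "\<bar>r - s\<bar> < 1"
    show "((\<lambda>s. max 0 t powr p * exp (- s * t - t\<^sup>2 / 2)) has_real_derivative ?f' r t) (at r)"
      by (rule derivative_eq_intros refl | simp add: max_0_powr_Suc[of t p, symmetric])+
    show "\<bar>?f' r t\<bar> \<le> exp ((\<bar>s\<bar> + 1)\<^sup>2) * ((1 + norm t) ^ nat \<lceil>p + 1\<rceil> * exp (- (1/4) * (norm t)\<^sup>2))"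
      unfolding abs_minus by (rule hermite_neg_integrand_bound) (use p r in auto)
  qed (use hermite_neg_integrable p in auto)
  then show ?thesis unfolding hermite_neg_def[abs_def] by simp
qed

text \<open>The integral over \<open>t > 0\<close> of the derivative of
  \<open>t powr (p + 1) * exp (- s * t - t^2 / 2)\<close> is 0, since this function vanishes at both
  ends.\<close>

lemma hermite_neg_recurrence:
  assumes p: "p > 0"
  shows "hermite_neg (p + 2) s + s * hermite_neg (p + 1) s = (p + 1) * hermite_neg p s"
proof -
  let ?I = "\<lambda>p t. max 0 t powr p * exp (- s * t - t\<^sup>2 / 2)"
  let ?f = "\<lambda>t. (p + 1) * ?I p t - s * ?I (p + 1) t - ?I (p + 2) t"
  let ?F = "\<lambda>t. t powr (p + 1) * exp (- s * t - t\<^sup>2 / 2)"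
  have int: "integrable lborel ?f"
    using hermite_neg_integrable p by simp
  have "(LBINT t=0..\<infinity>. ?f t) = 0 - 0"
  proof (rule interval_integral_FTC_integrable[where F = ?F])
    fix t :: real assume t: "0 < ereal t"
    then have t: "t > 0" by simp
    show "isCont ?f t" using t p by (intro continuous_intros) auto
    have "(?F has_real_derivative ((p + 1) * t powr p * exp (- s * t - t\<^sup>2 / 2)
        + t powr (p + 1) * ((- s - t) * exp (- s * t - t\<^sup>2 / 2)))) (at t)"
      using t p by (auto intro!: derivative_eq_intros)
    moreover have "t * max 0 t powr (p + 1) = max 0 t powr (p + 2)"
      using max_0_powr_Suc[of t "p + 1"] by (simp add: add.assoc)
    then have "((p + 1) * t powr p * exp (- s * t - t\<^sup>2 / 2)
        + t powr (p + 1) * ((- s - t) * exp (- s * t - t\<^sup>2 / 2))) = ?f t"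
      using t by (simp add: max_def ring_distribs) (simp add: algebra_simps)
    ultimately show "(?F has_vector_derivative ?f t) (at t)"
      by (simp add: has_real_derivative_iff_has_vector_derivative)
  next
    show "set_integrable lborel (einterval 0 \<infinity>) ?f"
      unfolding set_integrable_def by (rule integrable_mult_indicator[OF _ int]) simp
    have "(?F \<longlongrightarrow> 0) (at_right 0)"
    proof -
      have "((\<lambda>t::real. t powr (p + 1)) \<longlongrightarrow> 0) (at_right 0)" using p by real_asymp
      moreover have "((\<lambda>t. exp (- s * t - t\<^sup>2 / 2)) \<longlongrightarrow> exp (- s * 0 - 0\<^sup>2 / 2)) (at_right 0)"
        by (intro tendsto_intros) simp
      ultimately show ?thesis using tendsto_mult by fastforce
    qed
    then show "((?F \<circ> real_of_ereal) \<longlongrightarrow> 0) (at_right 0)"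
      by (simp add: zero_ereal_def ereal_tendsto_simps)
    have "(?F \<longlongrightarrow> 0) at_top"
      using p by real_asymp
    then show "((?F \<circ> real_of_ereal) \<longlongrightarrow> 0) (at_left \<infinity>)"
      by (simp add: ereal_tendsto_simps)
  qed simp
  moreover have "(LBINT t=0..\<infinity>. ?f t) = (\<integral>t. ?f t \<partial>lborel)"
  proof -
    have "(LBINT t=0..\<infinity>. ?f t) = (\<integral>t. indicator {0<..} t *\<^sub>R ?f t \<partial>lborel)"
      by (simp add: interval_lebesgue_integral_def set_lebesgue_integral_def einterval_def
          zero_ereal_def greaterThan_def)
    also have "\<dots> = (\<integral>t. ?f t \<partial>lborel)"
      by (intro Bochner_Integration.integral_cong) (auto simp: indicator_def max_def)
    finally show ?thesis .
  qed
  moreover have "(\<integral>t. ?f t \<partial>lborel)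
      = (p + 1) * hermite_neg p s - s * hermite_neg (p + 1) s - hermite_neg (p + 2) s"
    using hermite_neg_integrable p by (simp add: hermite_neg_def)
  ultimately show ?thesis by simp
qed

lemma hermite_neg_pos:
  assumes p: "p > 0"
  shows "hermite_neg p s > 0"
proof -
  let ?I = "\<lambda>t. max 0 t powr p * exp (- s * t - t\<^sup>2 / 2)"
  have "hermite_neg p s \<ge> 0" unfolding hermite_neg_def by (intro Bochner_Integration.integral_nonneg) auto
  moreover have "hermite_neg p s \<noteq> 0"
  proof
    assume "hermite_neg p s = 0"
    then have "AE t in lborel. ?I t = 0"
      using integral_nonneg_eq_0_iff_AE[OF hermite_neg_integrable[OF p, of s]] by (simp add: hermite_neg_def)
    then have "AE t in lborel. t \<notin> {0<..<1::real}" by (rule AE_mp) (auto simp: max_def)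
    then have "emeasure lborel {0<..<1::real} = 0" 
      by (subst (asm) AE_iff_measurable[where N = "{0<..<1}"]) auto
    then show False by simp
  qed
  ultimately show ?thesis by simp
qed

text \<open>The derivative is carried along as a function of its own, so that raising the order
  becomes algebra. The growth bound excludes solutions of size about \<open>exp (s^2 / 2)\<close>,
  which would cancel the Gaussian weight in the normal direction.\<close>

definition hermite_sol :: "real \<Rightarrow> (real \<Rightarrow> real) \<Rightarrow> (real \<Rightarrow> real) \<Rightarrow> bool" where
  "hermite_sol m h h' \<longleftrightarrow> (\<forall>s. (h has_real_derivative h' s) (at s)) \<and>
     (\<forall>s. (h' has_real_derivative (s * h' s - m * h s)) (at s)) \<and>
     (\<exists>C N. \<forall>s\<ge>0. \<bar>h s\<bar> \<le> C * (1 + s) ^ N \<and> \<bar>h' s\<bar> \<le> C * (1 + s) ^ N)"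

text \<open>Each derivative of \<open>hermite_neg\<close> raises the index by one and changes the
  sign, so the three-term recurrence is Hermite's equation of order \<open>- (p + 1)\<close>. For
  \<open>s \<ge> 0\<close> the factor \<open>exp (- s * t)\<close> is at most 1 where the integrand
  is nonzero, so the values at 0 serve as bounds.\<close>

lemma hermite_sol_base:
  assumes p: "p > 0"
  shows "hermite_sol (- (p + 1)) (hermite_neg p) (\<lambda>s. - hermite_neg (p + 1) s)"
proof -
  have le: "\<bar>hermite_neg q s\<bar> \<le> hermite_neg q 0" if "q > 0" "s \<ge> 0" for q s
  proof -
    have "\<bar>hermite_neg q s\<bar> = hermite_neg q s" using hermite_neg_pos[OF that(1)] by (simp add: less_imp_le)
    also have "\<dots> \<le> hermite_neg q 0"
      unfolding hermite_neg_def
    proof (rule integral_mono)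
      show "integrable lborel (\<lambda>t. max 0 t powr q * exp (- s * t - t\<^sup>2 / 2))"
        "integrable lborel (\<lambda>t. max 0 t powr q * exp (- 0 * t - t\<^sup>2 / 2))"
        by (rule hermite_neg_integrable[OF that(1)])+
      fix t :: real
      show "max 0 t powr q * exp (- s * t - t\<^sup>2 / 2) \<le> max 0 t powr q * exp (- 0 * t - t\<^sup>2 / 2)"
        using that by (cases "t > 0") (auto intro!: mult_left_mono)
    qed
    finally show ?thesis .
  qed
  have "((\<lambda>s. - hermite_neg (p + 1) s) has_real_derivative
      (s * (- hermite_neg (p + 1) s) - (- (p + 1)) * hermite_neg p s)) (at s)" for s
  proof -
    have "s * (- hermite_neg (p + 1) s) - (- (p + 1)) * hermite_neg p s = hermite_neg (p + 2) s"
      using hermite_neg_recurrence[OF p, of s] by (simp add: algebra_simps)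
    then show ?thesis
      using DERIV_minus[OF hermite_neg_deriv[of "p + 1" s]] p by (simp add: add.assoc)
  qed
  moreover have "\<exists>C N. \<forall>s\<ge>0. \<bar>hermite_neg p s\<bar> \<le> C * (1 + s) ^ N \<and> \<bar>- hermite_neg (p + 1) s\<bar> \<le> C * (1 + s) ^ N"
    using le[of p] le[of "p + 1"] p
    by (intro exI[of _ "max (hermite_neg p 0) (hermite_neg (p + 1) 0)"] exI[of _ 0]) (auto simp: le_max_iff_disj)
  ultimately show ?thesis
    using hermite_neg_deriv[OF p] by (simp add: hermite_sol_def)
qed

text \<open>This is the creation operator \<open>s - d/ds\<close>. The rules He_{m+1} = s He_m -
  He_m' and He_{m+1}' = (m+1) He_m of the probabilists' Hermite polynomials follow from the equation
  alone and hold for every real order.\<close>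

lemma hermite_sol_raise:
  assumes "hermite_sol m h h'"
  shows "hermite_sol (m + 1) (\<lambda>s. s * h s - h' s) (\<lambda>s. (m + 1) * h s)"
proof -
  have h: "\<And>s. (h has_real_derivative h' s) (at s)"
    and h': "\<And>s. (h' has_real_derivative (s * h' s - m * h s)) (at s)"
    using assms by (auto simp: hermite_sol_def)
  obtain C N where b: "\<And>s. s \<ge> 0 \<Longrightarrow> \<bar>h s\<bar> \<le> C * (1 + s) ^ N" "\<And>s. s \<ge> 0 \<Longrightarrow> \<bar>h' s\<bar> \<le> C * (1 + s) ^ N"
    using assms unfolding hermite_sol_def by metis
  have "((\<lambda>s. s * h s - h' s) has_real_derivative (m + 1) * h s) (at s)" for s
    by (rule derivative_eq_intros h h' refl)+ (simp add: algebra_simps)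
  moreover have "((\<lambda>s. (m + 1) * h s) has_real_derivative
      (s * ((m + 1) * h s) - (m + 1) * (s * h s - h' s))) (at s)" for s
    by (rule derivative_eq_intros h h' refl)+ (simp add: algebra_simps)
  moreover have "\<bar>s * h s - h' s\<bar> \<le> (\<bar>C\<bar> * (1 + \<bar>m + 1\<bar>)) * (1 + s) ^ Suc N
      \<and> \<bar>(m + 1) * h s\<bar> \<le> (\<bar>C\<bar> * (1 + \<bar>m + 1\<bar>)) * (1 + s) ^ Suc N" if s: "s \<ge> 0" for s
  proof
    let ?P = "\<bar>C\<bar> * (1 + s) ^ N"
    have P: "\<bar>h s\<bar> \<le> ?P" "\<bar>h' s\<bar> \<le> ?P" "?P \<ge> 0"
    proof -
      have "C * (1 + s) ^ N \<le> ?P" using s by (intro mult_right_mono) auto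
      then show "\<bar>h s\<bar> \<le> ?P" "\<bar>h' s\<bar> \<le> ?P" "?P \<ge> 0" using b[OF s] s by (auto intro: order_trans)
    qed
    have "\<bar>s * h s - h' s\<bar> \<le> \<bar>s * h s\<bar> + \<bar>h' s\<bar>" by (rule abs_triangle_ineq4)
    also have "\<dots> \<le> s * ?P + ?P"
      using s P by (intro add_mono) (auto simp: abs_mult intro!: mult_left_mono)
    also have "\<dots> = ?P * (1 + s)" by (simp add: algebra_simps)
    also have "\<dots> \<le> (1 + \<bar>m + 1\<bar>) * (?P * (1 + s))"
      using P(3) s mult_right_mono[of 1 "1 + \<bar>m + 1\<bar>" "?P * (1 + s)"] by simp
    finally show "\<bar>s * h s - h' s\<bar> \<le> (\<bar>C\<bar> * (1 + \<bar>m + 1\<bar>)) * (1 + s) ^ Suc N" by (simp add: mult_ac)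
    have "\<bar>(m + 1) * h s\<bar> \<le> \<bar>m + 1\<bar> * ?P" using P by (simp add: abs_mult mult_left_mono)
    also have "\<dots> \<le> (1 + \<bar>m + 1\<bar>) * (?P * (1 + s))"
    proof (rule mult_mono)
      show "?P \<le> ?P * (1 + s)" using mult_left_mono[of 1 "1 + s" ?P] P(3) s by simp
    qed (use P(3) in auto)
    finally show "\<bar>(m + 1) * h s\<bar> \<le> (\<bar>C\<bar> * (1 + \<bar>m + 1\<bar>)) * (1 + s) ^ Suc N" by (simp add: mult_ac)
  qed
  ultimately show ?thesis unfolding hermite_sol_def by blast
qed

text \<open>Two raisings take the values \<open>(h 0, h' 0)\<close> of order \<open>m\<close> to
  \<open>(- (m + 1) * h 0, - (m + 2) * h' 0)\<close>, so their product is multiplied by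
  \<open>(m + 1) * (m + 2)\<close>. The starting order lies in \<open>(-2, -1)\<close>, where the
  product is negative and this factor is negative too; at all later orders the factor is
  positive.\<close>

lemma hermite_sol_exists:
  assumes "2 * real k < l" "l < 2 * real k + 1"
  obtains h h' where "hermite_sol l h h'" "h 0 * h' 0 > 0"
proof -
  have "\<exists>h h'. hermite_sol (l - 2 * real k + 2 * real j) h h' \<and> h 0 * h' 0 > 0" for j
  proof (induction j)
    case 0
    let ?m = "l - 2 * real k"
    \<comment> \<open>The index \<open>p = 1 - ?m\<close> is the one with
      \<open>- (p + 1) = ?m - 2\<close>, two raisings below the order of the base case.\<close>
    have p: "1 - ?m > 0" using assms by simp
    have "hermite_sol (?m - 2) (hermite_neg (1 - ?m)) (\<lambda>s. - hermite_neg (1 - ?m + 1) s)"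
      using hermite_sol_base[OF p] by (simp add: algebra_simps)
    then obtain f f' where f: "hermite_sol (?m - 2) f f'" "f 0 > 0" "f' 0 < 0"
      using hermite_neg_pos[of "1 - ?m" 0] hermite_neg_pos[of "1 - ?m + 1" 0] p by fastforce
    define g where "g = (\<lambda>s. s * f s - f' s)"
    have g: "hermite_sol (?m - 2 + 1) g (\<lambda>s. (?m - 2 + 1) * f s)"
      unfolding g_def by (rule hermite_sol_raise[OF f(1)])
    have "hermite_sol (?m - 2 + 1 + 1) (\<lambda>s. s * g s - (?m - 2 + 1) * f s) (\<lambda>s. (?m - 2 + 1 + 1) * g s)"
      by (rule hermite_sol_raise[OF g])
    then have "hermite_sol (?m + 2 * real 0) (\<lambda>s. s * g s - (?m - 2 + 1) * f s) (\<lambda>s. ?m * g s)" by simp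
    moreover have "0 < (0 * g 0 - (?m - 2 + 1) * f 0) * (?m * g 0)"
      using f(2,3) assms by (auto simp: g_def mult_less_0_iff zero_less_mult_iff)
    ultimately show ?case by (intro exI conjI) assumption+
  next
    case (Suc j)
    let ?m = "l - 2 * real k + 2 * real j"
    obtain f f' where f: "hermite_sol ?m f f'" "f 0 * f' 0 > 0" using Suc by auto
    define g where "g = (\<lambda>s. s * f s - f' s)"
    have g: "hermite_sol (?m + 1) g (\<lambda>s. (?m + 1) * f s)"
      unfolding g_def by (rule hermite_sol_raise[OF f(1)])
    have "hermite_sol (?m + 1 + 1) (\<lambda>s. s * g s - (?m + 1) * f s) (\<lambda>s. (?m + 1 + 1) * g s)"
      by (rule hermite_sol_raise[OF g])
    then have "hermite_sol (l - 2 * real k + 2 * real (Suc j)) (\<lambda>s. s * g s - (?m + 1) * f s) (\<lambda>s. (?m + 1 + 1) * g s)"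
      by (simp add: algebra_simps)
    moreover have "0 < (0 * g 0 - (?m + 1) * f 0) * ((?m + 1 + 1) * g 0)"
    proof -
      have "0 < (?m + 1) * (?m + 1 + 1) * (f 0 * f' 0)"
        using f(2) assms by (intro mult_pos_pos[OF mult_pos_pos]) auto
      then show ?thesis by (simp add: g_def algebra_simps)
    qed
    ultimately show ?case by (intro exI conjI) assumption+
  qed
  from this[of k] show ?thesis using that by auto
qed

section \<open>Homogeneous solutions and Green's formula\<close>

text \<open>From here on derivatives are taken along coordinate lines at parameter 0, where the
  one-variable product and chain rules apply.\<close>

lemma directional_derivative:
  fixes f :: "real ^ 'n::finite \<Rightarrow> real"
  assumes "f differentiable (at x)"
  shows "((\<lambda>r. f (x + r *\<^sub>R axis i 1)) has_real_derivative partial i f x) (at 0)"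
proof -
  interpret L: linear "frechet_derivative f (at x)"
    using assms by (rule linear_frechet_derivative)
  have f: "(f has_derivative frechet_derivative f (at x)) (at (x + 0 *\<^sub>R axis i 1))"
    using assms by (simp add: frechet_derivative_works)
  have g: "((\<lambda>r. x + r *\<^sub>R axis i 1) has_derivative (\<lambda>r. r *\<^sub>R axis i 1)) (at 0)"
    by (auto intro!: derivative_eq_intros)
  have "((\<lambda>r. f (x + r *\<^sub>R axis i 1)) has_derivative
      (\<lambda>r. frechet_derivative f (at x) (r *\<^sub>R axis i 1))) (at 0)"
    using has_derivative_compose[OF g f] by simp
  moreover have "(\<lambda>r. frechet_derivative f (at x) (r *\<^sub>R axis i 1)) = (*) (partial i f x)"
    by (auto simp: L.scaleR partial_def)
  ultimately show ?thesis by (simp add: has_field_derivative_def)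
qed

lemma norm_axis_line:
  fixes x :: "real ^ 'n::finite"
  shows "(norm (x + r *\<^sub>R axis i 1))\<^sup>2 = (norm x)\<^sup>2 + 2 * r * x $ i + r\<^sup>2"
  unfolding power2_norm_eq_inner
  by (simp add: inner_add_left inner_add_right inner_axis inner_axis'
      inner_axis_axis power2_eq_square algebra_simps)

lemma gauss_line_deriv:
  fixes x :: "real ^ 'n::finite"
  shows "((\<lambda>r. exp (- (norm (x + r *\<^sub>R axis i 1))\<^sup>2 / 2)) has_real_derivative
    - x $ i * exp (- (norm x)\<^sup>2 / 2)) (at 0)"
  unfolding norm_axis_line by (auto intro!: derivative_eq_intros simp: field_simps)

lemma coord_axis_line:
  fixes x :: "real ^ 'n::finite"
  shows "(x + r *\<^sub>R axis i 1) $ j = x $ j + r * of_bool (i = j)"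
  by (simp add: axis_def)

text \<open>An exponent of at least 2 removes the kink at 0. Exponents 3 and 2 are the ones used,
  for the two derivatives of the cutoff.\<close>

lemma max_0_power_deriv:
  fixes x :: real
  shows "((\<lambda>x. max 0 x ^ Suc (Suc n)) has_real_derivative real (Suc (Suc n)) * max 0 x ^ Suc n) (at x)"
proof -
  consider "x > 0" | "x < 0" | "x = 0" by linarith
  then show ?thesis
  proof cases
    case 1
    have "((\<lambda>x. x ^ Suc (Suc n)) has_real_derivative real (Suc (Suc n)) * max 0 x ^ Suc n) (at x)"
      using 1 DERIV_pow[of "Suc (Suc n)" x] by simp
    then show ?thesis
      by (rule has_field_derivative_transform_within_open[where S = "{0<..}"]) (use 1 in auto)
  next
    case 2
    have "((\<lambda>x::real. 0) has_real_derivative real (Suc (Suc n)) * max 0 x ^ Suc n) (at x)"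
      using 2 by simp
    then show ?thesis
      by (rule has_field_derivative_transform_within_open[where S = "{..<0}"]) (use 2 in auto)
  next
    case 3
    have "((\<lambda>h::real. max 0 h ^ Suc n) \<longlongrightarrow> max 0 0 ^ Suc n) (at 0)" by (intro tendsto_intros)
    then have "((\<lambda>h::real. max 0 h ^ Suc n) \<longlongrightarrow> 0) (at 0)" by simp
    moreover have "\<And>h::real. h \<noteq> 0 \<Longrightarrow> max 0 h ^ Suc n = max 0 h ^ Suc (Suc n) / h"
      by (auto simp: max_def)
    then have "eventually (\<lambda>h::real. max 0 h ^ Suc n = max 0 h ^ Suc (Suc n) / h) (at 0)"
      by (simp add: eventually_at_filter)
    ultimately have "((\<lambda>h::real. max 0 h ^ Suc (Suc n) / h) \<longlongrightarrow> 0) (at 0)"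
      by (rule Lim_transform_eventually)
    then show ?thesis using 3 by (simp add: DERIV_def)
  qed
qed

context
  fixes m :: "'n::finite"
begin

text \<open>For \<open>e > 0\<close> the set where \<open>e * cutk x \<le> 1\<close> is compact in the open half-space, so \<open>max 0 (1 - e * cutk x) ^ 3\<close>
  is a \<open>C\<^sup>2\<close> cutoff near the thin space and at infinity at the same time.\<close>

definition cutk :: "real ^ 'n \<Rightarrow> real" where "cutk x = (1 + (norm x)\<^sup>2) / x $ m"
definition cutk1 :: "'n \<Rightarrow> real ^ 'n \<Rightarrow> real" where
  "cutk1 i x = 2 * x $ i / x $ m - of_bool (i = m) * ((1 + (norm x)\<^sup>2) / (x $ m)\<^sup>2)"
definition cutk2 :: "'n \<Rightarrow> real ^ 'n \<Rightarrow> real" where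
  "cutk2 i x = 2 / x $ m - of_bool (i = m) * (4 * x $ i / (x $ m)\<^sup>2)
     + of_bool (i = m) * (2 * (1 + (norm x)\<^sup>2) / (x $ m) ^ 3)"

lemma cutk_deriv:
  assumes "x $ m > 0"
  shows "((\<lambda>r. cutk (x + r *\<^sub>R axis i 1)) has_real_derivative cutk1 i x) (at 0)"
  unfolding cutk_def cutk1_def norm_axis_line coord_axis_line using assms
  by (auto intro!: derivative_eq_intros simp: field_simps power2_eq_square)

lemma cutk1_deriv:
  assumes "x $ m > 0"
  shows "((\<lambda>r. cutk1 i (x + r *\<^sub>R axis i 1)) has_real_derivative cutk2 i x) (at 0)"
  unfolding cutk1_def cutk2_def norm_axis_line coord_axis_line using assms
  by (cases "i = m") (auto intro!: derivative_eq_intros simp: field_simps power2_eq_square power3_eq_cube)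

text \<open>Each derivative of \<open>cutk\<close> costs at most a factor of order \<open>D\<close>,
  relative to \<open>cutk\<close> itself. Where the cutoff is nonzero,
  \<open>e * cutk x < 1\<close>; thus \<open>e\<close> times a derivative of \<open>cutk\<close> is
  bounded by powers of \<open>D\<close> independently of \<open>e\<close>.\<close>

lemma cutk_bounds:
  assumes x: "x $ m > 0"
  defines "D \<equiv> 1 + 1 / x $ m"
  shows "cutk x > 0" "\<bar>cutk1 i x\<bar> \<le> cutk x * D" "\<bar>cutk2 i x\<bar> \<le> 6 * cutk x * D\<^sup>2"
proof -
  let ?s = "x $ m"
  have sq: "(x $ i)\<^sup>2 \<le> (norm x)\<^sup>2" for i
    using component_le_norm_cart[of x i] by (metis abs_ge_zero power2_abs power_mono)
  show k: "cutk x > 0" using x by (simp add: cutk_def add_pos_nonneg)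
  have "2 * \<bar>x $ i\<bar> \<le> 1 + (norm x)\<^sup>2"
    using sq[of i] sum_squares_ge_zero[of "1 - \<bar>x $ i\<bar>" 0] by (simp add: power2_eq_square algebra_simps)
  then have a: "\<bar>2 * x $ i / ?s\<bar> \<le> cutk x"
    using x by (simp add: cutk_def divide_right_mono abs_mult)
  have b: "(1 + (norm x)\<^sup>2) / ?s\<^sup>2 = cutk x * (1 / ?s)" using x by (simp add: cutk_def power2_eq_square)
  show "\<bar>cutk1 i x\<bar> \<le> cutk x * D"
  proof -
    have "\<bar>cutk1 i x\<bar> \<le> \<bar>2 * x $ i / ?s\<bar> + \<bar>of_bool (i = m) * (cutk x * (1 / ?s))\<bar>"
      unfolding cutk1_def b by (rule abs_triangle_ineq4)
    also have "\<dots> \<le> cutk x + cutk x * (1 / ?s)"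
      using a x k by (intro add_mono) auto
    finally show ?thesis by (simp add: D_def distrib_left)
  qed
  have c: "1 / ?s \<le> cutk x" using x by (simp add: cutk_def divide_right_mono)
  have d: "2 * (1 + (norm x)\<^sup>2) / ?s ^ 3 = 2 * cutk x * (1 / ?s)\<^sup>2"
    using x by (simp add: cutk_def power2_eq_square power3_eq_cube)
  have "\<bar>cutk2 i x\<bar> \<le> 6 * (1 / ?s) + 2 * cutk x * (1 / ?s)\<^sup>2"
    unfolding cutk2_def d using x k by (auto simp: power2_eq_square divide_simps)
  also have "\<dots> \<le> 6 * cutk x + 6 * cutk x * (1 / ?s)\<^sup>2"
    using c k by (intro add_mono mult_right_mono) auto
  also have "\<dots> = 6 * cutk x * (1 + (1 / ?s)\<^sup>2)" by (simp add: algebra_simps)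
  also have "\<dots> \<le> 6 * cutk x * D\<^sup>2"
  proof (rule mult_left_mono)
    show "1 + (1 / ?s)\<^sup>2 \<le> D\<^sup>2" using x by (simp add: D_def power2_sum)
  qed (use k in simp)
  finally show "\<bar>cutk2 i x\<bar> \<le> 6 * cutk x * D\<^sup>2" .
qed

end

section \<open>Growth, smoothness off the thin space and Euler's identity\<close>

locale homogeneous_thin_solution =
  fixes m :: "'n::finite" and l :: real and u :: "real ^ 'n \<Rightarrow> real"
  assumes l_pos: "l > 0"
    and sol: "thin_obstacle_solution m u"
    and hom: "homogeneous l u"
begin

lemma u_cont: "continuous_on UNIV u"
  using sol by (simp add: thin_obstacle_solution_def)

lemma u_measurable [measurable]: "u \<in> borel_measurable borel"
  using u_cont by (rule borel_measurable_continuous_onI)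

lemma u_scale: "t > 0 \<Longrightarrow> u (t *\<^sub>R x) = t powr l * u x"
  using hom by (simp add: homogeneous_def)

lemma u_zero: "u 0 = 0"
proof -
  have "u 0 = 2 powr l * u 0" using u_scale[of 2 0] by simp
  moreover have "2 powr l \<noteq> (1::real)" using l_pos by simp
  ultimately show ?thesis by simp
qed

lemma u_bound_powr:
  obtains C where "C > 0" "\<And>x. \<bar>u x\<bar> \<le> C * norm x powr l"
proof -
  have "bounded (u ` sphere 0 1)"
    by (intro compact_imp_bounded compact_continuous_image continuous_on_subset[OF u_cont]) auto
  then obtain C where C: "C > 0" "\<And>x. x \<in> sphere 0 1 \<Longrightarrow> \<bar>u x\<bar> \<le> C"
    by (auto simp: bounded_pos)
  have "\<bar>u x\<bar> \<le> C * norm x powr l" for x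
  proof (cases "x = 0")
    case False
    have "u x = norm x powr l * u (x /\<^sub>R norm x)"
      using u_scale[of "norm x" "x /\<^sub>R norm x"] False by simp
    then have "\<bar>u x\<bar> = norm x powr l * \<bar>u (x /\<^sub>R norm x)\<bar>" by (simp add: abs_mult)
    also have "\<dots> \<le> norm x powr l * C"
      using False by (intro mult_left_mono C) auto
    finally show ?thesis by (simp add: mult.commute)
  qed (simp add: u_zero)
  then show ?thesis using that C by blast
qed

lemma u_bound:
  obtains C where "C > 0" "\<And>x. \<bar>u x\<bar> \<le> C * (1 + norm x) ^ nat \<lceil>l\<rceil>"
proof -
  obtain C where C: "C > 0" "\<And>x. \<bar>u x\<bar> \<le> C * norm x powr l" using u_bound_powr by blast
  have "\<bar>u x\<bar> \<le> C * (1 + norm x) ^ nat \<lceil>l\<rceil>" for x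
  proof -
    have "norm x powr l \<le> (1 + norm x) powr l" using l_pos by (intro powr_mono2) auto
    also have "\<dots> \<le> (1 + norm x) powr real (nat \<lceil>l\<rceil>)"
      by (intro powr_mono real_nat_ceiling_ge) auto
    also have "\<dots> = (1 + norm x) ^ nat \<lceil>l\<rceil>" by (rule powr_realpow) (simp add: add_pos_nonneg)
    finally show ?thesis using C(2)[of x] C(1) by (meson mult_left_mono less_imp_le order_trans)
  qed
  then show ?thesis using that C by blast
qed

lemma u_reflect: "u (thin_reflection m x) = u x"
  using sol by (simp add: thin_obstacle_solution_def)

lemma off_thin: "x $ m \<noteq> 0 \<Longrightarrow> x \<in> - contact_set m u"
  by (auto simp: contact_set_def thin_space_def)

lemma u_C2: "C2_on (- contact_set m u) u"
  using sol by (simp add: thin_obstacle_solution_def harmonic_on_def)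

lemma u_deriv: "x $ m \<noteq> 0 \<Longrightarrow> ((\<lambda>r. u (x + r *\<^sub>R axis i 1)) has_real_derivative partial i u x) (at 0)"
  using u_C2 off_thin[of x] by (intro directional_derivative) (auto simp: C2_on_def)

lemma u_deriv2: "x $ m \<noteq> 0 \<Longrightarrow>
    ((\<lambda>r. partial i u (x + r *\<^sub>R axis i 1)) has_real_derivative partial i (partial i u) x) (at 0)"
  using u_C2 off_thin[of x] by (intro directional_derivative) (auto simp: C2_on_def)

lemma partial_u_cont: "continuous_on {x. x $ m > 0} (partial i u)"
  using u_C2 off_thin
  by (intro continuous_at_imp_continuous_on) (fastforce simp: C2_on_def intro!: differentiable_imp_continuous_within)

lemma partial2_u_cont: "continuous_on {x. x $ m > 0} (partial i (partial i u))"
proof (rule continuous_on_subset)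
  show "continuous_on (- contact_set m u) (partial i (partial i u))"
    using u_C2 by (simp add: C2_on_def)
qed (use off_thin in force)

lemma u_harmonic: "x $ m \<noteq> 0 \<Longrightarrow> (\<Sum>i\<in>UNIV. partial i (partial i u) x) = 0"
  using sol off_thin[of x] by (auto simp: thin_obstacle_solution_def harmonic_on_def laplacian_def)

lemma u_euler:
  assumes "x $ m \<noteq> 0"
  shows "(\<Sum>i\<in>UNIV. x $ i * partial i u x) = l * u x"
proof -
  have diff: "u differentiable (at x)" using u_C2 off_thin[OF assms] by (auto simp: C2_on_def)
  interpret L: linear "frechet_derivative u (at x)"
    using diff by (rule linear_frechet_derivative)
  have f: "(u has_derivative frechet_derivative u (at x)) (at (1 *\<^sub>R x))"
    using diff by (simp add: frechet_derivative_works)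
  have g: "((\<lambda>r::real. r *\<^sub>R x) has_derivative (\<lambda>r. r *\<^sub>R x)) (at 1)"
    by (auto intro!: derivative_eq_intros)
  have "((\<lambda>r::real. u (r *\<^sub>R x)) has_derivative
      (\<lambda>r. frechet_derivative u (at x) (r *\<^sub>R x))) (at 1)"
    using has_derivative_compose[OF g f] by simp
  moreover have "(\<lambda>r. frechet_derivative u (at x) (r *\<^sub>R x)) = (*) (frechet_derivative u (at x) x)"
    by (auto simp: L.scaleR)
  ultimately have 1: "((\<lambda>r::real. u (r *\<^sub>R x)) has_real_derivative frechet_derivative u (at x) x) (at 1)"
    by (simp add: has_field_derivative_def)
  have "((\<lambda>r::real. r powr l * u x) has_real_derivative l * u x) (at 1)"
    by (auto intro!: derivative_eq_intros)
  then have "((\<lambda>r::real. u (r *\<^sub>R x)) has_real_derivative l * u x) (at 1)"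
    by (rule has_field_derivative_transform_within_open[where S = "{0<..}"]) (auto simp: u_scale)
  with 1 have "frechet_derivative u (at x) x = l * u x" by (rule DERIV_unique)
  moreover have "frechet_derivative u (at x) x = (\<Sum>i\<in>UNIV. x $ i * partial i u x)"
  proof -
    have "frechet_derivative u (at x) x = frechet_derivative u (at x) (\<Sum>i\<in>UNIV. x $ i *\<^sub>R axis i 1)"
      using basis_expansion[of x] by (simp add: scalar_mult_eq_scaleR)
    also have "\<dots> = (\<Sum>i\<in>UNIV. x $ i * partial i u x)"
      by (simp add: L.sum L.scaleR partial_def)
    finally show ?thesis .
  qed
  ultimately show ?thesis by simp
qed

text \<open>\<open>G (g \<partial>\<^sub>i u - u \<partial>\<^sub>i g)\<close> is a compactly supported field.\<close>

lemma gauss_green: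
  fixes g :: "real ^ 'n \<Rightarrow> real" and g1 g2 :: "'n \<Rightarrow> real ^ 'n \<Rightarrow> real"
  assumes K: "compact K" "K \<subseteq> {x. x $ m > 0}"
    and zero: "\<And>x. x \<notin> K \<Longrightarrow> g x = 0" "\<And>i x. x \<notin> K \<Longrightarrow> g1 i x = 0" "\<And>i x. x \<notin> K \<Longrightarrow> g2 i x = 0"
    and d1: "\<And>i x. x $ m > 0 \<Longrightarrow> ((\<lambda>r. g (x + r *\<^sub>R axis i 1)) has_real_derivative g1 i x) (at 0)"
    and d2: "\<And>i x. x $ m > 0 \<Longrightarrow> ((\<lambda>r. g1 i (x + r *\<^sub>R axis i 1)) has_real_derivative g2 i x) (at 0)"
    and c: "continuous_on {x. x $ m > 0} g" "\<And>i. continuous_on {x. x $ m > 0} (g1 i)"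
      "\<And>i. continuous_on {x. x $ m > 0} (g2 i)"
  shows "(\<integral>x. exp (- (norm x)\<^sup>2 / 2) * u x * (\<Sum>i\<in>UNIV. g2 i x - x $ i * g1 i x) \<partial>lborel)
    = - l * (\<integral>x. exp (- (norm x)\<^sup>2 / 2) * u x * g x \<partial>lborel)"
proof -
  let ?G = "\<lambda>x::real^'n. exp (- (norm x)\<^sup>2 / 2)"
  define F where "F i x = ?G x * (g x * partial i u x - u x * g1 i x)" for i x
  define F' where "F' i x = ?G x * (g x * partial i (partial i u) x - u x * g2 i x)
     - x $ i * (?G x * (g x * partial i u x - u x * g1 i x))" for i x
  let ?P = "{x::real^'n. x $ m > 0}"
  have oP: "open ?P" by (intro open_Collect_less continuous_intros)
  have clK: "closed K" using K(1) by (rule compact_imp_closed)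
  have un: "?P \<union> - K = UNIV" using K(2) by auto
  \<comment> \<open>The open half-space and the complement of \<open>K\<close> form an open cover of
    the whole space, so continuity inside the half-space together with vanishing off
    \<open>K\<close> is enough.\<close>
  have glue: "continuous_on UNIV f" if "continuous_on ?P f" "\<And>x. x \<notin> K \<Longrightarrow> f x = 0" for f :: "real^'n \<Rightarrow> real"
  proof -
    have "continuous_on (- K) f" using that(2) by (subst continuous_on_cong[OF refl, of _ _ "\<lambda>_. 0"]) auto
    then show ?thesis
      using continuous_on_open_Un[OF oP _ that(1)] clK un by (metis open_Compl)
  qed
  have uP: "continuous_on ?P u" by (rule continuous_on_subset[OF u_cont]) simp
  have GP: "continuous_on ?P ?G" by (intro continuous_intros) simp
  have cF: "continuous_on UNIV (F i)" for i
    unfolding F_def[abs_def] by (rule glue) (intro continuous_intros GP uP c partial_u_cont | simp add: zero)+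
  have cF': "continuous_on UNIV (F' i)" for i
    unfolding F'_def[abs_def]
    by (rule glue) (intro continuous_intros GP uP c partial_u_cont partial2_u_cont | simp add: zero)+
  have dF: "((\<lambda>r. F i (x + r *\<^sub>R axis i 1)) has_real_derivative F' i x) (at 0)" for i x
  proof (cases "x \<in> K")
    case True
    then have x: "x $ m > 0" using K(2) by auto
    then have x': "x $ m \<noteq> 0" by simp
    show ?thesis unfolding F_def F'_def
      by (rule derivative_eq_intros gauss_line_deriv d1[OF x] d2[OF x] u_deriv[OF x'] u_deriv2[OF x'] refl)+
        (simp add: algebra_simps)
  next
    case False
    have "open ((\<lambda>r::real. x + r *\<^sub>R axis i 1) -` (- K))"
      using clK by (intro open_vimage continuous_intros) auto
    moreover have "F' i x = 0" using zero[OF False] by (simp add: F'_def)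
    ultimately show ?thesis
      using False zero
      by (intro has_field_derivative_transform_within_open[OF DERIV_const[of 0], where S = "(\<lambda>r::real. x + r *\<^sub>R axis i 1) -` (- K)", THEN DERIV_cong])
        (auto simp: F_def)
  qed
  have int0: "(\<integral>x. F' i x \<partial>lborel) = 0" for i
    by (rule integral_directional_derivative_zero[OF cF cF' dF, where K = K])
      (use K(1) zero in \<open>auto simp: F_def F'_def compact_imp_bounded\<close>)
  have cpt: "integrable lborel f" if "continuous_on UNIV f" "\<And>x. x \<notin> K \<Longrightarrow> f x = 0" for f :: "real^'n \<Rightarrow> real"
  proof -
    have "integrable lborel (\<lambda>x. indicator K x *\<^sub>R f x)"
      using K(1) by (rule borel_integrable_compact) (rule continuous_on_subset[OF that(1)], simp)
    moreover have "(\<lambda>x. indicator K x *\<^sub>R f x) = f"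
      by (rule ext) (use that(2) in \<open>auto simp: indicator_def\<close>)
    ultimately show ?thesis by simp
  qed
  have intF': "integrable lborel (F' i)" for i
    by (rule cpt[OF cF']) (simp add: F'_def zero)
  \<comment> \<open>In the divergence the products of first derivatives of \<open>g\<close> and
    \<open>u\<close> cancel. What remains is simplified by \<open>\<Delta> u = 0\<close> and by
    Euler's identity for \<open>x \<cdot> \<nabla> u\<close>, so that no derivative of
    \<open>u\<close> survives.\<close>
  have sum: "(\<Sum>i\<in>UNIV. F' i x) = - (?G x * u x * (\<Sum>i\<in>UNIV. g2 i x - x $ i * g1 i x)) - l * (?G x * u x * g x)" for x
  proof (cases "x \<in> K")
    case True
    then have x: "x $ m \<noteq> 0" using K(2) by auto
    have "(\<Sum>i\<in>UNIV. F' i x) = ?G x * g x * (\<Sum>i\<in>UNIV. partial i (partial i u) x)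
       - ?G x * u x * (\<Sum>i\<in>UNIV. g2 i x - x $ i * g1 i x) - ?G x * g x * (\<Sum>i\<in>UNIV. x $ i * partial i u x)"
      unfolding F'_def sum_distrib_left sum_subtractf[symmetric]
      by (intro sum.cong refl) (simp add: algebra_simps)
    then show ?thesis unfolding u_harmonic[OF x] u_euler[OF x] by simp
  qed (simp add: F'_def zero)
  have i1: "integrable lborel (\<lambda>x. ?G x * u x * (\<Sum>i\<in>UNIV. g2 i x - x $ i * g1 i x))"
    by (rule cpt, rule glue) (intro continuous_intros GP uP c | simp add: zero)+
  have i2: "integrable lborel (\<lambda>x. ?G x * u x * g x)"
    by (rule cpt, rule glue) (intro continuous_intros GP uP c | simp add: zero)+
  have "0 = (\<integral>x. (\<Sum>i\<in>UNIV. F' i x) \<partial>lborel)"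
    using intF' int0 by simp
  also have "\<dots> = - (\<integral>x. ?G x * u x * (\<Sum>i\<in>UNIV. g2 i x - x $ i * g1 i x) \<partial>lborel) - l * (\<integral>x. ?G x * u x * g x \<partial>lborel)"
    unfolding sum using i1 i2 by simp
  finally show ?thesis by simp
qed

abbreviation gauss :: "real ^ 'n \<Rightarrow> real" where "gauss x \<equiv> exp (- (norm x)\<^sup>2 / 2)"

section \<open>Green's formula for functions of the normal coordinate\<close>

lemma gauss_weighted_bound:
  assumes "\<And>x. \<bar>f x\<bar> \<le> C * (1 + norm x) ^ N" "C \<ge> 0"
  obtains B where "B \<ge> 0" "\<And>x. \<bar>gauss x * u x * f x\<bar> \<le> B * ((1 + norm x) ^ (nat \<lceil>l\<rceil> + N) * exp (- (1/2) * (norm x)\<^sup>2))"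
proof -
  obtain Cu where Cu: "Cu > 0" "\<And>x. \<bar>u x\<bar> \<le> Cu * (1 + norm x) ^ nat \<lceil>l\<rceil>" using u_bound by blast
  have "\<bar>gauss x * u x * f x\<bar> \<le> (Cu * C) * ((1 + norm x) ^ (nat \<lceil>l\<rceil> + N) * exp (- (1/2) * (norm x)\<^sup>2))" for x
  proof -
    have "\<bar>u x\<bar> * \<bar>f x\<bar> \<le> (Cu * (1 + norm x) ^ nat \<lceil>l\<rceil>) * (C * (1 + norm x) ^ N)"
      using Cu assms by (intro mult_mono) auto
    then have "gauss x * (\<bar>u x\<bar> * \<bar>f x\<bar>) \<le> gauss x * ((Cu * (1 + norm x) ^ nat \<lceil>l\<rceil>) * (C * (1 + norm x) ^ N))"
      by (rule mult_left_mono) simp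
    then show ?thesis by (simp add: abs_mult power_add mult_ac)
  qed
  then show ?thesis using that[of "Cu * C"] Cu assms by simp
qed

lemma gauss_weighted_integrable:
  assumes "f \<in> borel_measurable borel" "\<And>x. \<bar>f x\<bar> \<le> C * (1 + norm x) ^ N" "C \<ge> 0"
  shows "integrable lborel (\<lambda>x. gauss x * u x * f x)"
proof -
  obtain B where B: "B \<ge> 0" "\<And>x. \<bar>gauss x * u x * f x\<bar> \<le> B * ((1 + norm x) ^ (nat \<lceil>l\<rceil> + N) * exp (- (1/2) * (norm x)\<^sup>2))"
    using gauss_weighted_bound[OF assms(2,3)] by blast
  show ?thesis
    by (rule integrable_gaussian_bound[OF _ _ B(2)]) (use assms(1) in auto)
qed

text \<open>Formally both boundary terms, \<open>u\<^sub>n b\<close> and \<open>u b1\<close>, vanish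
  because \<open>b\<close> and \<open>b1\<close> are zero on the thin space. This is made
  quantitative: each derivative of the cutoff costs a factor \<open>1 + 1 / s\<close>, and
  \<open>b = O(s^2)\<close>, \<open>b1 = O(s)\<close> near 0 pay for two derivatives, so the
  integrands stay dominated uniformly in the cutoff parameter \<open>e\<close>.\<close>

lemma half_space_identity:
  fixes b b1 b2 :: "real \<Rightarrow> real"
  assumes C: "C \<ge> 0"
    and db: "\<And>s. s > 0 \<Longrightarrow> (b has_real_derivative b1 s) (at s)"
    and db1: "\<And>s. s > 0 \<Longrightarrow> (b1 has_real_derivative b2 s) (at s)"
    and cb2: "continuous_on {0<..} b2"
    and bnd: "\<And>s. s > 0 \<Longrightarrow> \<bar>b s\<bar> \<le> C * s\<^sup>2 * (1 + s) ^ N"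
      "\<And>s. s > 0 \<Longrightarrow> \<bar>b1 s\<bar> \<le> C * s * (1 + s) ^ N"
      "\<And>s. s > 0 \<Longrightarrow> \<bar>b2 s\<bar> \<le> C * (1 + s) ^ N"
  shows "(\<integral>x. gauss x * u x * (if x $ m > 0 then b2 (x $ m) - x $ m * b1 (x $ m) else 0) \<partial>lborel)
    = - l * (\<integral>x. gauss x * u x * (if x $ m > 0 then b (x $ m) else 0) \<partial>lborel)"
proof -
  define k where "k = cutk m"
  define k1 where "k1 = cutk1 m"
  define k2 where "k2 = cutk2 m"
  let ?P = "{x::real^'n. x $ m > 0}"
  have oP: "open ?P" by (intro open_Collect_less continuous_intros)
  define g where "g e x = (if x $ m > 0 then max 0 (1 - e * k x) ^ 3 * b (x $ m) else 0)" for e x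
  \<comment> \<open>With \<open>q = max 0 (1 - e * k x)\<close> the cutoff \<open>q ^ 3\<close> has
    derivative \<open>- 3 e q^2 k1\<close> and second derivative
    \<open>6 e^2 q k1^2 - 3 e q^2 k2\<close>; \<open>g1\<close> and \<open>g2\<close> come from the
    product rule with \<open>b (x $ m)\<close>.\<close>
  define g1 where "g1 e i x = (if x $ m > 0 then of_bool (i = m) * max 0 (1 - e * k x) ^ 3 * b1 (x $ m)
      - 3 * e * max 0 (1 - e * k x) ^ 2 * k1 i x * b (x $ m) else 0)" for e i x
  define g2 where "g2 e i x = (if x $ m > 0 then of_bool (i = m) * max 0 (1 - e * k x) ^ 3 * b2 (x $ m)
      - of_bool (i = m) * (6 * e * max 0 (1 - e * k x) ^ 2 * k1 i x * b1 (x $ m))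
      + 6 * e\<^sup>2 * max 0 (1 - e * k x) * (k1 i x)\<^sup>2 * b (x $ m)
      - 3 * e * max 0 (1 - e * k x) ^ 2 * k2 i x * b (x $ m) else 0)" for e i x
  define S where "S e x = (\<Sum>i\<in>UNIV. g2 e i x - x $ i * g1 e i x)" for e x
  have cb1: "continuous_on {0<..} b1" and cb: "continuous_on {0<..} b"
    using DERIV_isCont[OF db] DERIV_isCont[OF db1] by (auto intro!: continuous_at_imp_continuous_on)
  have cbx: "continuous_on ?P (\<lambda>x. b (x $ m))" "continuous_on ?P (\<lambda>x. b1 (x $ m))" "continuous_on ?P (\<lambda>x. b2 (x $ m))"
    using cb cb1 cb2
    by (auto intro!: continuous_on_compose2[of "{0<..}" _ ?P "\<lambda>x. x $ m"] continuous_intros)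
  have ck: "continuous_on ?P k" "continuous_on ?P (k1 i)" "continuous_on ?P (k2 i)" for i
    unfolding k_def k1_def k2_def cutk_def[abs_def] cutk1_def[abs_def] cutk2_def[abs_def]
    by (intro continuous_intros; force)+
  have cg: "continuous_on ?P (g e)" "continuous_on ?P (g1 e i)" "continuous_on ?P (g2 e i)" for e i
  proof -
    have "continuous_on ?P (\<lambda>x. max 0 (1 - e * k x) ^ 3 * b (x $ m))"
      "continuous_on ?P (\<lambda>x. of_bool (i = m) * max 0 (1 - e * k x) ^ 3 * b1 (x $ m)
        - 3 * e * max 0 (1 - e * k x) ^ 2 * k1 i x * b (x $ m))"
      "continuous_on ?P (\<lambda>x. of_bool (i = m) * max 0 (1 - e * k x) ^ 3 * b2 (x $ m)
        - of_bool (i = m) * (6 * e * max 0 (1 - e * k x) ^ 2 * k1 i x * b1 (x $ m))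
        + 6 * e\<^sup>2 * max 0 (1 - e * k x) * (k1 i x)\<^sup>2 * b (x $ m)
        - 3 * e * max 0 (1 - e * k x) ^ 2 * k2 i x * b (x $ m))"
      by (intro continuous_intros cbx ck)+
    then show "continuous_on ?P (g e)" "continuous_on ?P (g1 e i)" "continuous_on ?P (g2 e i)"
      by (simp_all add: g_def g1_def g2_def cong: continuous_on_cong_simp)
  qed
  have dx: "((\<lambda>r. f (x $ m + r * of_bool (i = m))) has_real_derivative of_bool (i = m) * f' (x $ m)) (at 0)"
    if "(f has_real_derivative f' (x $ m)) (at (x $ m))" for f f' :: "real \<Rightarrow> real" and x :: "real^'n" and i
  proof -
    have "((\<lambda>r. x $ m + r * of_bool (i = m)) has_real_derivative of_bool (i = m)) (at 0)"
      by (auto intro!: derivative_eq_intros)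
    from DERIV_chain2[OF _ this, of f "f' (x $ m)"] that show ?thesis by (simp add: mult.commute)
  qed
  have dk: "((\<lambda>r. k (x + r *\<^sub>R axis i 1)) has_real_derivative k1 i x) (at 0)"
    "((\<lambda>r. k1 i (x + r *\<^sub>R axis i 1)) has_real_derivative k2 i x) (at 0)" if "x $ m > 0" for i x
    using cutk_deriv[OF that] cutk1_deriv[OF that] by (simp_all add: k_def k1_def k2_def)
  have dg: "((\<lambda>r. g e (x + r *\<^sub>R axis i 1)) has_real_derivative g1 e i x) (at 0)"
    "((\<lambda>r. g1 e i (x + r *\<^sub>R axis i 1)) has_real_derivative g2 e i x) (at 0)" if x: "x $ m > 0" for e i x
  proof -
    let ?U = "(\<lambda>r::real. x + r *\<^sub>R axis i 1) -` ?P"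
    have U: "open ?U"
      by (intro open_vimage[OF oP] continuous_intros)
    have U0: "0 \<in> ?U" using x by simp
    have dq: "((\<lambda>r. 1 - e * k (x + r *\<^sub>R axis i 1)) has_real_derivative - e * k1 i x) (at 0)"
      by (rule derivative_eq_intros dk[OF x] refl)+ simp
    have dq3: "((\<lambda>r. max 0 (1 - e * k (x + r *\<^sub>R axis i 1)) ^ 3) has_real_derivative
        3 * max 0 (1 - e * k x) ^ 2 * (- e * k1 i x)) (at 0)"
      using DERIV_chain2[OF max_0_power_deriv[of 1] dq] by (simp add: numeral_2_eq_2 numeral_3_eq_3)
    have dq2: "((\<lambda>r. max 0 (1 - e * k (x + r *\<^sub>R axis i 1)) ^ 2) has_real_derivative
        2 * max 0 (1 - e * k x) * (- e * k1 i x)) (at 0)"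
      using DERIV_chain2[OF max_0_power_deriv[of 0] dq] by (simp add: numeral_2_eq_2)
    note d = dq3 dq2 dx[of b b1, OF db[OF x]] dx[of b1 b2, OF db1[OF x]] dk[OF x]
    have "((\<lambda>r. max 0 (1 - e * k (x + r *\<^sub>R axis i 1)) ^ 3 * b (x $ m + r * of_bool (i = m)))
      has_real_derivative g1 e i x) (at 0)"
      by (rule d derivative_eq_intros refl)+ (use x in \<open>simp add: g1_def algebra_simps\<close>)
    then show "((\<lambda>r. g e (x + r *\<^sub>R axis i 1)) has_real_derivative g1 e i x) (at 0)"
      by (rule has_field_derivative_transform_within_open[OF _ U U0])
        (auto simp: g_def coord_axis_line simp del: vector_add_component vector_scaleR_component)
    have "((\<lambda>r. of_bool (i = m) * max 0 (1 - e * k (x + r *\<^sub>R axis i 1)) ^ 3 * b1 (x $ m + r * of_bool (i = m))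
      - 3 * e * max 0 (1 - e * k (x + r *\<^sub>R axis i 1)) ^ 2 * k1 i (x + r *\<^sub>R axis i 1) * b (x $ m + r * of_bool (i = m)))
      has_real_derivative g2 e i x) (at 0)"
      by (rule d derivative_eq_intros refl)+
        (use x in \<open>cases "i = m"; simp add: g2_def algebra_simps power2_eq_square\<close>)
    then show "((\<lambda>r. g1 e i (x + r *\<^sub>R axis i 1)) has_real_derivative g2 e i x) (at 0)"
      by (rule has_field_derivative_transform_within_open[OF _ U U0])
        (auto simp: g1_def coord_axis_line simp del: vector_add_component vector_scaleR_component)
  qed
  have green: "(\<integral>x. gauss x * u x * S e x \<partial>lborel) = - l * (\<integral>x. gauss x * u x * g e x \<partial>lborel)" if e: "e > 0" for e
  proof -
    \<comment> \<open>This is \<open>e * cutk x \<le> 1\<close> cleared of its denominator. The left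
      side is positive, so membership forces \<open>x $ m > 0\<close>, and comparison with
      \<open>norm x\<close> makes the set bounded.\<close>
    let ?K = "{x::real^'n. e * (1 + (norm x)\<^sup>2) \<le> x $ m}"
    have sub: "?K \<subseteq> ?P"
    proof
      fix x :: "real^'n" assume "x \<in> ?K"
      moreover have "0 < e * (1 + (norm x)\<^sup>2)" using e by (intro mult_pos_pos add_pos_nonneg) auto
      ultimately show "x \<in> ?P" by simp
    qed
    have "norm x \<le> 1 / e" if "x \<in> ?K" for x
    proof -
      have "e * (norm x)\<^sup>2 \<le> e * (1 + (norm x)\<^sup>2)" using e by simp
      also have "\<dots> \<le> norm x" using that component_le_norm_cart[of x m] by simp
      finally have "norm x * (e * norm x) \<le> norm x * 1" by (simp add: power2_eq_square mult_ac)
      then have "e * norm x \<le> 1 \<or> norm x = 0"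
        by (metis linorder_not_less mult_less_cancel_left_pos norm_ge_zero order_le_less)
      then show ?thesis using e by (auto simp: field_simps)
    qed
    then have "bounded ?K" unfolding bounded_iff by blast
    moreover have "closed ?K" by (intro closed_Collect_le continuous_intros)
    ultimately have K: "compact ?K" by (simp add: compact_eq_bounded_closed)
    have z: "max 0 (1 - e * k x) = 0" if "x \<notin> ?K" "x $ m > 0" for x
      using that by (simp add: k_def cutk_def field_simps)
    show ?thesis unfolding S_def
      by (rule gauss_green[OF K sub _ _ _ dg cg]) (auto simp: g_def g1_def g2_def z)
  qed
  \<comment> \<open>None of these bounds involves \<open>e\<close>. The identity
    \<open>s * (1 + 1 / s) = 1 + s\<close> turns the powers of \<open>?D\<close> into polynomial
    growth. The constants add up the terms of the product rule: 4 = 1 + 3 and 31 = 1 + 6 + 6 +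
    18.\<close>
  have bounds: "\<bar>g e x\<bar> \<le> C * (1 + norm x) ^ (N + 2)" "\<bar>g1 e i x\<bar> \<le> 4 * C * (1 + norm x) ^ (N + 2)"
    "\<bar>g2 e i x\<bar> \<le> 31 * C * (1 + norm x) ^ (N + 2)" if e: "0 < e" for e i x
  proof -
    let ?R = "C * (1 + norm x) ^ (N + 2)"
    have R0: "?R \<ge> 0" using C by simp
    have "\<bar>g e x\<bar> \<le> ?R \<and> \<bar>g1 e i x\<bar> \<le> 4 * ?R \<and> \<bar>g2 e i x\<bar> \<le> 31 * ?R"
    proof (cases "x $ m > 0 \<and> 1 - e * k x > 0")
      case False
      then show ?thesis using R0 by (auto simp: g_def g1_def g2_def)
    next
      case True
      then have x: "x $ m > 0" and q: "1 - e * k x > 0" by auto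
      let ?s = "x $ m" and ?D = "1 + 1 / x $ m" and ?q = "max 0 (1 - e * k x)"
      have s: "?s \<le> norm x" using component_le_norm_cart[of x m] by simp
      note kb = cutk_bounds[OF x, folded k_def k1_def k2_def]
      have D1: "?D \<ge> 1" using x by simp
      have q1: "0 \<le> ?q" "?q \<le> 1" using e kb(1) by auto
      then have q2: "0 \<le> ?q\<^sup>2" "?q\<^sup>2 \<le> 1" "0 \<le> ?q ^ 3" "?q ^ 3 \<le> 1"
        by (auto intro: power_le_one)
      have DR: "C * ?s\<^sup>2 * (1 + ?s) ^ N * ?D\<^sup>2 \<le> ?R" "C * ?s * (1 + ?s) ^ N * ?D \<le> ?R" "C * (1 + ?s) ^ N \<le> ?R"
      proof -
        have "?s * ?D = 1 + ?s" using x by (simp add: field_simps)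
        then have "?s\<^sup>2 * ?D\<^sup>2 = (1 + ?s)\<^sup>2" by (metis power_mult_distrib)
        moreover have "C * ?s\<^sup>2 * (1 + ?s) ^ N * ?D\<^sup>2 = C * ((1 + ?s) ^ N * (?s\<^sup>2 * ?D\<^sup>2))"
          by (simp only: mult_ac)
        ultimately have "C * ?s\<^sup>2 * (1 + ?s) ^ N * ?D\<^sup>2 = C * (1 + ?s) ^ (N + 2)"
          by (simp only: power_add)
        moreover have "C * (1 + ?s) ^ j \<le> ?R" if "j \<le> N + 2" for j
        proof -
          have "(1 + ?s) ^ j \<le> (1 + norm x) ^ j" using x s by (intro power_mono) auto
          also have "\<dots> \<le> (1 + norm x) ^ (N + 2)" using that by (intro power_increasing) auto
          finally show ?thesis using C by (rule mult_left_mono)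
        qed
        moreover have "C * ?s * (1 + ?s) ^ N * ?D = C * (1 + ?s) ^ (N + 1)"
        proof -
          have "C * ?s * (1 + ?s) ^ N * ?D = C * ((1 + ?s) ^ N * (?s * ?D))" by (simp only: mult_ac)
          then show ?thesis by (simp only: \<open>?s * ?D = 1 + ?s\<close> power_add power_one_right)
        qed
        ultimately show "C * ?s\<^sup>2 * (1 + ?s) ^ N * ?D\<^sup>2 \<le> ?R" "C * ?s * (1 + ?s) ^ N * ?D \<le> ?R" "C * (1 + ?s) ^ N \<le> ?R"
          by (metis le_add1 le_add2 nat_add_left_cancel_le one_le_numeral order_refl)+
      qed
      have Db2: "\<bar>b ?s\<bar> * ?D\<^sup>2 \<le> ?R"
        using mult_right_mono[OF bnd(1)[OF x], of "?D\<^sup>2"] DR(1) by simp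
      have Db: "\<bar>b ?s\<bar> * ?D \<le> ?R"
        using Db2 mult_left_mono[of ?D "?D\<^sup>2" "\<bar>b ?s\<bar>"] D1 by (simp add: power2_eq_square)
      have b0: "\<bar>b ?s\<bar> \<le> ?R"
        using Db mult_left_mono[of 1 ?D "\<bar>b ?s\<bar>"] D1 by simp
      have Db1: "\<bar>b1 ?s\<bar> * ?D \<le> ?R"
        by (rule order_trans[OF mult_right_mono[OF bnd(2)[OF x]] DR(2)]) (use D1 in linarith)
      have b10: "\<bar>b1 ?s\<bar> \<le> ?R"
        using Db1 mult_left_mono[of 1 ?D "\<bar>b1 ?s\<bar>"] D1 by simp
      have b20: "\<bar>b2 ?s\<bar> \<le> ?R" using bnd(3)[OF x] DR(3) by simp
      have ek: "e * \<bar>k1 i x\<bar> \<le> ?D" "e * \<bar>k2 i x\<bar> \<le> 6 * ?D\<^sup>2"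
      proof -
        have "e * \<bar>k1 i x\<bar> \<le> (e * k x) * ?D" using mult_left_mono[OF kb(2), of e i] e by (simp add: mult_ac)
        also have "\<dots> \<le> 1 * ?D" using q D1 by (intro mult_right_mono) auto
        finally show "e * \<bar>k1 i x\<bar> \<le> ?D" by simp
        have "e * \<bar>k2 i x\<bar> \<le> (e * k x) * (6 * ?D\<^sup>2)" using mult_left_mono[OF kb(3), of e i] e by (simp add: mult_ac)
        also have "\<dots> \<le> 1 * (6 * ?D\<^sup>2)" using q by (intro mult_right_mono) auto
        finally show "e * \<bar>k2 i x\<bar> \<le> 6 * ?D\<^sup>2" by simp
      qed
      have t: "\<bar>c * y\<bar> \<le> \<bar>y\<bar>" if "0 \<le> c" "c \<le> 1" for c y :: real
        using that by (simp add: abs_mult mult_left_le_one_le)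
      have T1: "\<bar>?q ^ 3 * b ?s\<bar> \<le> ?R" using t[OF q2(3,4), of "b ?s"] b0 by simp
      have T2: "\<bar>of_bool (i = m) * ?q ^ 3 * b1 ?s\<bar> \<le> ?R"
        using t[of "of_bool (i = m) * ?q ^ 3" "b1 ?s"] q2 b10 by auto
      have T3: "\<bar>of_bool (i = m) * ?q ^ 3 * b2 ?s\<bar> \<le> ?R"
        using t[of "of_bool (i = m) * ?q ^ 3" "b2 ?s"] q2 b20 by auto
      have T4: "\<bar>3 * e * ?q\<^sup>2 * k1 i x * b ?s\<bar> \<le> 3 * ?R"
      proof -
        have "\<bar>?q\<^sup>2 * (3 * (e * k1 i x) * b ?s)\<bar> \<le> \<bar>3 * (e * k1 i x) * b ?s\<bar>" by (rule t[OF q2(1,2)])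
        also have "\<dots> = 3 * (e * \<bar>k1 i x\<bar> * \<bar>b ?s\<bar>)" using e by (simp add: abs_mult)
        also have "\<dots> \<le> 3 * (?D * \<bar>b ?s\<bar>)" using ek(1) by (intro mult_left_mono mult_right_mono) auto
        also have "\<dots> \<le> 3 * ?R" using Db by (simp add: mult.commute)
        finally show ?thesis by (simp add: mult_ac)
      qed
      have T5: "\<bar>of_bool (i = m) * (6 * e * ?q\<^sup>2 * k1 i x * b1 ?s)\<bar> \<le> 6 * ?R"
      proof -
        have "\<bar>(of_bool (i = m) * ?q\<^sup>2) * (6 * (e * k1 i x) * b1 ?s)\<bar> \<le> \<bar>6 * (e * k1 i x) * b1 ?s\<bar>"
          using q2 by (intro t) auto
        also have "\<dots> = 6 * (e * \<bar>k1 i x\<bar> * \<bar>b1 ?s\<bar>)" using e by (simp add: abs_mult)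
        also have "\<dots> \<le> 6 * (?D * \<bar>b1 ?s\<bar>)" using ek(1) by (intro mult_left_mono mult_right_mono) auto
        also have "\<dots> \<le> 6 * ?R" using Db1 by (simp add: mult.commute)
        finally show ?thesis by (simp only: mult_ac)
      qed
      have T6: "\<bar>6 * e\<^sup>2 * ?q * (k1 i x)\<^sup>2 * b ?s\<bar> \<le> 6 * ?R"
      proof -
        have "\<bar>?q * (6 * (e * k1 i x)\<^sup>2 * b ?s)\<bar> \<le> \<bar>6 * (e * k1 i x)\<^sup>2 * b ?s\<bar>" by (rule t[OF q1])
        also have "\<dots> = 6 * ((e * \<bar>k1 i x\<bar>)\<^sup>2 * \<bar>b ?s\<bar>)" using e by (simp add: abs_mult power_mult_distrib)
        also have "\<dots> \<le> 6 * (?D\<^sup>2 * \<bar>b ?s\<bar>)"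
          using ek(1) e by (intro mult_left_mono mult_right_mono power_mono) auto
        also have "\<dots> \<le> 6 * ?R" using Db2 by (simp add: mult.commute)
        finally show ?thesis by (simp add: power_mult_distrib mult_ac)
      qed
      have T7: "\<bar>3 * e * ?q\<^sup>2 * k2 i x * b ?s\<bar> \<le> 18 * ?R"
      proof -
        have "\<bar>?q\<^sup>2 * (3 * (e * k2 i x) * b ?s)\<bar> \<le> \<bar>3 * (e * k2 i x) * b ?s\<bar>" by (rule t[OF q2(1,2)])
        also have "\<dots> = 3 * (e * \<bar>k2 i x\<bar> * \<bar>b ?s\<bar>)" using e by (simp add: abs_mult)
        also have "\<dots> \<le> 3 * (6 * ?D\<^sup>2 * \<bar>b ?s\<bar>)" using ek(2) by (intro mult_left_mono mult_right_mono) auto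
        also have "\<dots> \<le> 18 * ?R" using Db2 by (simp add: mult.commute)
        finally show ?thesis by (simp add: mult_ac)
      qed
      have G1: "\<bar>g1 e i x\<bar> \<le> \<bar>of_bool (i = m) * ?q ^ 3 * b1 ?s\<bar> + \<bar>3 * e * ?q\<^sup>2 * k1 i x * b ?s\<bar>"
        using x unfolding g1_def by (simp only: if_True abs_triangle_ineq4)
      have G2: "\<bar>g2 e i x\<bar> \<le> \<bar>of_bool (i = m) * ?q ^ 3 * b2 ?s\<bar> + \<bar>of_bool (i = m) * (6 * e * ?q\<^sup>2 * k1 i x * b1 ?s)\<bar>
         + \<bar>6 * e\<^sup>2 * ?q * (k1 i x)\<^sup>2 * b ?s\<bar> + \<bar>3 * e * ?q\<^sup>2 * k2 i x * b ?s\<bar>"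
        using x unfolding g2_def if_P[OF x] by linarith
      have "\<bar>g e x\<bar> \<le> ?R" using T1 x by (simp only: g_def if_True)
      moreover have "\<bar>g1 e i x\<bar> \<le> 4 * ?R"
        using order_trans[OF G1 add_mono[OF T2 T4]] by simp
      moreover have "\<bar>g2 e i x\<bar> \<le> 31 * ?R"
        using order_trans[OF G2 add_mono[OF add_mono[OF add_mono[OF T3 T5] T6] T7]] by simp
      ultimately show ?thesis by blast
    qed
    then show "\<bar>g e x\<bar> \<le> ?R" "\<bar>g1 e i x\<bar> \<le> 4 * C * (1 + norm x) ^ (N + 2)"
      "\<bar>g2 e i x\<bar> \<le> 31 * C * (1 + norm x) ^ (N + 2)" by auto
  qed
  have Sb: "\<bar>S e x\<bar> \<le> real CARD('n) * (35 * C) * (1 + norm x) ^ (N + 3)" if e: "e > 0" for e x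
  proof -
    have "\<bar>S e x\<bar> \<le> (\<Sum>i\<in>(UNIV::'n set). (35 * C) * (1 + norm x) ^ (N + 3))"
      unfolding S_def
    proof (rule order_trans[OF sum_abs sum_mono])
      fix i
      let ?R = "C * (1 + norm x) ^ (N + 2)"
      have R: "?R \<ge> 0" using C by simp
      have "\<bar>g2 e i x - x $ i * g1 e i x\<bar> \<le> \<bar>g2 e i x\<bar> + \<bar>x $ i\<bar> * \<bar>g1 e i x\<bar>"
        using abs_triangle_ineq4[of "g2 e i x" "x $ i * g1 e i x"] by (simp add: abs_mult)
      also have "\<dots> \<le> 31 * C * (1 + norm x) ^ (N + 2) + norm x * (4 * C * (1 + norm x) ^ (N + 2))"
        using bounds(2,3)[OF e, of i x] component_le_norm_cart[of x i]
        by (intro add_mono mult_mono) auto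
      also have "\<dots> = ?R * 31 + ?R * (4 * norm x)" by (simp add: algebra_simps)
      also have "\<dots> \<le> ?R * (35 * (1 + norm x))"
        unfolding distrib_left[symmetric] using R by (intro mult_left_mono) auto
      also have "\<dots> = (35 * C) * (1 + norm x) ^ (N + 3)" by (simp add: power_add power3_eq_cube power2_eq_square)
      finally show "\<bar>g2 e i x - x $ i * g1 e i x\<bar> \<le> (35 * C) * (1 + norm x) ^ (N + 3)" .
    qed
    then show ?thesis by (simp add: mult.assoc)
  qed
  define e where "e j = 1 / real (Suc j)" for j
  have e0: "e j > 0" for j by (simp add: e_def)
  have e_lim: "e \<longlonglongrightarrow> 0" unfolding e_def by (rule LIMSEQ_Suc[OF lim_1_over_n])
  have meas: "f \<in> borel_measurable borel" if "continuous_on ?P f" "\<And>x. \<not> x $ m > 0 \<Longrightarrow> f x = 0" for f :: "real^'n \<Rightarrow> real"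
  proof -
    have "(\<lambda>x. indicator ?P x *\<^sub>R f x) \<in> borel_measurable borel"
      using oP that(1) by (intro borel_measurable_continuous_on_indicator) auto
    moreover have "(\<lambda>x. indicator ?P x *\<^sub>R f x) = f"
      by (rule ext) (use that(2) in \<open>auto simp: indicator_def\<close>)
    ultimately show ?thesis by simp
  qed
  have mg [measurable]: "g e \<in> borel_measurable borel" "g1 e i \<in> borel_measurable borel" "g2 e i \<in> borel_measurable borel" for e i
    by (rule meas[OF cg(1)] meas[OF cg(2)] meas[OF cg(3)]; simp add: g_def g1_def g2_def)+
  have mS [measurable]: "S e \<in> borel_measurable borel" for e unfolding S_def[abs_def] by measurable
  have [measurable]: "(\<lambda>x. if 0 < x $ m then b (x $ m) else 0) \<in> borel_measurable (borel :: (real^'n) measure)"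
    "(\<lambda>x. if 0 < x $ m then b2 (x $ m) - x $ m * b1 (x $ m) else 0) \<in> borel_measurable (borel :: (real^'n) measure)"
  proof -
    have "continuous_on ?P (\<lambda>x. b2 (x $ m) - x $ m * b1 (x $ m))" by (intro continuous_intros cbx)
    then show "(\<lambda>x. if 0 < x $ m then b (x $ m) else 0) \<in> borel_measurable (borel :: (real^'n) measure)"
    "(\<lambda>x. if 0 < x $ m then b2 (x $ m) - x $ m * b1 (x $ m) else 0) \<in> borel_measurable (borel :: (real^'n) measure)"
      using cbx(1) by (auto intro!: meas cong: continuous_on_cong_simp)
  qed
  have lims: "(\<lambda>j. g (e j) x) \<longlonglongrightarrow> (if x $ m > 0 then b (x $ m) else 0)"
    "(\<lambda>j. g1 (e j) i x) \<longlonglongrightarrow> (if x $ m > 0 then of_bool (i = m) * b1 (x $ m) else 0)"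
    "(\<lambda>j. g2 (e j) i x) \<longlonglongrightarrow> (if x $ m > 0 then of_bool (i = m) * b2 (x $ m) else 0)" for x i
    unfolding g_def g1_def g2_def
    by (auto intro!: tendsto_eq_intros e_lim)
  have S_lim: "(\<lambda>j. S (e j) x) \<longlonglongrightarrow> (if x $ m > 0 then b2 (x $ m) - x $ m * b1 (x $ m) else 0)" for x
  proof -
    have "(\<lambda>j. S (e j) x) \<longlonglongrightarrow> (\<Sum>i\<in>UNIV. (if x $ m > 0 then of_bool (i = m) * b2 (x $ m) else 0)
        - x $ i * (if x $ m > 0 then of_bool (i = m) * b1 (x $ m) else 0))"
      unfolding S_def by (intro tendsto_intros lims)
    also have "(\<Sum>i\<in>UNIV. (if x $ m > 0 then of_bool (i = m) * b2 (x $ m) else 0)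
        - x $ i * (if x $ m > 0 then of_bool (i = m) * b1 (x $ m) else 0))
      = (\<Sum>i\<in>UNIV. if i = m then (if x $ m > 0 then b2 (x $ m) - x $ m * b1 (x $ m) else 0) else 0)"
      by (intro sum.cong) auto
    finally show ?thesis by (simp only: sum.delta finite UNIV_I if_True)
  qed
  obtain B1 where B1: "\<And>j x. \<bar>gauss x * u x * S (e j) x\<bar> \<le> B1 * ((1 + norm x) ^ (nat \<lceil>l\<rceil> + (N + 3)) * exp (- (1/2) * (norm x)\<^sup>2))"
  proof -
    obtain B where B: "\<And>x. \<bar>gauss x * u x * (real CARD('n) * (35 * C) * (1 + norm x) ^ (N + 3))\<bar>
        \<le> B * ((1 + norm x) ^ (nat \<lceil>l\<rceil> + (N + 3)) * exp (- (1/2) * (norm x)\<^sup>2))"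
      using gauss_weighted_bound[of "\<lambda>x. real CARD('n) * (35 * C) * (1 + norm x) ^ (N + 3)" "real CARD('n) * (35 * C)" "N + 3"] C
      by (auto simp: abs_mult)
    have "\<bar>gauss x * u x * S (e j) x\<bar> \<le> \<bar>gauss x * u x * (real CARD('n) * (35 * C) * (1 + norm x) ^ (N + 3))\<bar>" for j x
      unfolding abs_mult[of "gauss x * u x"] using Sb[OF e0, of j x] by (intro mult_left_mono) auto
    then show ?thesis using that B order_trans by blast
  qed
  obtain B2 where B2: "\<And>j x. \<bar>gauss x * u x * g (e j) x\<bar> \<le> B2 * ((1 + norm x) ^ (nat \<lceil>l\<rceil> + (N + 2)) * exp (- (1/2) * (norm x)\<^sup>2))"
  proof -
    obtain B where B: "\<And>x. \<bar>gauss x * u x * (C * (1 + norm x) ^ (N + 2))\<bar>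
        \<le> B * ((1 + norm x) ^ (nat \<lceil>l\<rceil> + (N + 2)) * exp (- (1/2) * (norm x)\<^sup>2))"
      using gauss_weighted_bound[of "\<lambda>x. C * (1 + norm x) ^ (N + 2)" C "N + 2"] C
      by (auto simp: abs_mult)
    have "\<bar>gauss x * u x * g (e j) x\<bar> \<le> \<bar>gauss x * u x * (C * (1 + norm x) ^ (N + 2))\<bar>" for j x
      unfolding abs_mult[of "gauss x * u x"] using bounds(1)[OF e0, of j x] by (intro mult_left_mono) auto
    then show ?thesis using that B order_trans by blast
  qed
  have wint: "integrable lborel (\<lambda>x::real^'n. B * ((1 + norm x) ^ M * exp (- (1/2) * (norm x)\<^sup>2)))" for B :: real and M
    by (rule integrable_gaussian_bound[where c = "1/2" and C = "\<bar>B\<bar>" and N = M]) (auto simp: abs_mult)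
  have L1: "(\<lambda>j. \<integral>x. gauss x * u x * S (e j) x \<partial>lborel) \<longlonglongrightarrow>
     (\<integral>x. gauss x * u x * (if x $ m > 0 then b2 (x $ m) - x $ m * b1 (x $ m) else 0) \<partial>lborel)"
  proof (rule integral_dominated_convergence[OF _ _ wint[of B1 "nat \<lceil>l\<rceil> + (N + 3)"]])
    show "AE x in lborel. (\<lambda>j. gauss x * u x * S (e j) x) \<longlonglongrightarrow>
      gauss x * u x * (if x $ m > 0 then b2 (x $ m) - x $ m * b1 (x $ m) else 0)"
      by (intro AE_I2 tendsto_mult tendsto_const S_lim)
    show "AE x in lborel. norm (gauss x * u x * S (e j) x) \<le> B1 * ((1 + norm x) ^ (nat \<lceil>l\<rceil> + (N + 3)) * exp (- (1/2) * (norm x)\<^sup>2))" for j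
      using B1 by (intro AE_I2) (simp only: real_norm_def)
  qed measurable
  have L2: "(\<lambda>j. \<integral>x. gauss x * u x * g (e j) x \<partial>lborel) \<longlonglongrightarrow>
     (\<integral>x. gauss x * u x * (if x $ m > 0 then b (x $ m) else 0) \<partial>lborel)"
  proof (rule integral_dominated_convergence[OF _ _ wint[of B2 "nat \<lceil>l\<rceil> + (N + 2)"]])
    show "AE x in lborel. (\<lambda>j. gauss x * u x * g (e j) x) \<longlonglongrightarrow>
      gauss x * u x * (if x $ m > 0 then b (x $ m) else 0)"
      by (intro AE_I2 tendsto_mult tendsto_const lims)
    show "AE x in lborel. norm (gauss x * u x * g (e j) x) \<le> B2 * ((1 + norm x) ^ (nat \<lceil>l\<rceil> + (N + 2)) * exp (- (1/2) * (norm x)\<^sup>2))" for j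
      using B2 by (intro AE_I2) (simp only: real_norm_def)
  qed measurable
  have "(\<lambda>j. - l * (\<integral>x. gauss x * u x * g (e j) x \<partial>lborel)) \<longlonglongrightarrow>
     - l * (\<integral>x. gauss x * u x * (if x $ m > 0 then b (x $ m) else 0) \<partial>lborel)"
    by (intro tendsto_intros L2)
  then show ?thesis using L1 unfolding green[OF e0] by (rule LIMSEQ_unique[rotated])
qed

end

section \<open>The sign of the Gaussian mean over the half-space\<close>

text \<open>One map with three uses: the factor -1 gives the reflection, a factor
  \<open>d > 0\<close> rescales a thin layer to unit width, and the factor 0 projects onto the thin
  space, as the limit of the latter.\<close>

definition scale_coord :: "'n::finite \<Rightarrow> real \<Rightarrow> real ^ 'n \<Rightarrow> real ^ 'n" where
  "scale_coord m c x = (\<chi> i. if i = m then c * x $ i else x $ i)"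

lemma scale_coord_nth: "scale_coord m c x $ i = (if i = m then c * x $ i else x $ i)"
  by (simp add: scale_coord_def)

lemma thin_reflection_eq_scale_coord: "thin_reflection m = scale_coord m (-1)"
  by (auto simp: thin_reflection_def scale_coord_def fun_eq_iff vec_eq_iff)

lemma scale_coord_measurable [measurable]: "scale_coord m c \<in> borel_measurable borel"
  unfolding scale_coord_def[abs_def]
proof (rule borel_measurable_continuous_onI, rule continuous_on_vec_lambda)
  show "continuous_on UNIV (\<lambda>x::real^'a. if i = m then c * x $ i else x $ i)" for i
    by (cases "i = m") (auto intro!: continuous_intros)
qed

lemma integral_scale_coord:
  fixes f :: "real ^ 'n::finite \<Rightarrow> real"
  assumes c: "c \<noteq> 0" and f: "f \<in> borel_measurable borel"
  shows "(\<integral>x. f x \<partial>lborel) = \<bar>c\<bar> * (\<integral>x. f (scale_coord m c x) \<partial>lborel)"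
proof -
  define k where "k j = (if j = axis m (1::real) then c else 1)" for j :: "real ^ 'n"
  have ax: "axis i 1 \<in> (Basis :: (real ^ 'n) set)" for i by (auto simp: Basis_vec_def)
  have T: "0 + (\<Sum>j\<in>Basis. (k j * (x \<bullet> j)) *\<^sub>R j) = scale_coord m c x" for x
  proof -
    have "(\<Sum>j\<in>Basis. (k j * (x \<bullet> j)) *\<^sub>R j) \<bullet> axis i 1 = scale_coord m c x \<bullet> axis i 1" for i
      by (subst inner_sum_left_Basis) (auto simp: k_def scale_coord_nth inner_axis axis_eq_axis ax)
    then show ?thesis by (simp add: vec_eq_iff inner_axis)
  qed
  have P: "(\<Prod>j\<in>Basis. \<bar>k j\<bar>) = \<bar>c\<bar>"
  proof -
    have "(\<Prod>j\<in>(Basis::(real^'n) set). \<bar>k j\<bar>) = (\<Prod>j\<in>(Basis::(real^'n) set). if j = axis m 1 then \<bar>c\<bar> else 1)"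
      by (intro prod.cong) (auto simp: k_def)
    also have "\<dots> = \<bar>c\<bar>" by (subst prod.delta) (auto simp: ax)
    finally show ?thesis .
  qed
  have "lborel = density (distr lborel borel (scale_coord m c)) (\<lambda>_. \<bar>c\<bar>)"
    using lborel_affine_euclidean[of k 0] c unfolding T P by (simp add: k_def)
  then have "(\<integral>x. f x \<partial>lborel) = (\<integral>x. f x \<partial>density (distr lborel borel (scale_coord m c)) (\<lambda>_. \<bar>c\<bar>))"
    by simp
  also have "\<dots> = \<bar>c\<bar> * (\<integral>x. f (scale_coord m c x) \<partial>lborel)"
    using f by (subst integral_density) (auto simp: integral_distr)
  finally show ?thesis .
qed

text \<open>\<open>1 - bump\<close> is concave on \<open>t \<ge> 0\<close> and has slope 1 at 0. Subtracting multiples of 1 and of \<open>d * (1 - bump (s / d))\<close>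
  makes a test function vanish to second order on the thin space; as \<open>d\<close> tends to 0, the latter
  contributes the integral of \<open>u\<close> over the thin space.\<close>

definition bump :: "real \<Rightarrow> real" where "bump t = exp (- t - t\<^sup>2 / 2)"

text \<open>Everything follows from \<open>(1 + t + t^2 / 2) * bump t \<le> 1\<close>. The
  combinations are those produced by differentiation: \<open>(1 + t) * bump t\<close> is
  \<open>- bump'\<close>, \<open>(2 * t + t^2) * bump t\<close> is \<open>bump''\<close>, and
  \<open>(t + t^2) * bump t\<close> is \<open>- t * bump'\<close>.\<close>

lemma bump_bounds:
  assumes "t \<ge> 0"
  shows "0 < bump t" "bump t \<le> 1" "(1 + t) * bump t \<le> 1" "(2 * t + t\<^sup>2) * bump t \<le> 2" "(t + t\<^sup>2) * bump t \<le> 2"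
proof -
  have "1 + (t + t\<^sup>2 / 2) \<le> exp (t + t\<^sup>2 / 2)" by (rule exp_ge_add_one_self)
  moreover have "bump t * exp (t + t\<^sup>2 / 2) = 1" by (simp add: bump_def flip: exp_add)
  moreover show b: "0 < bump t" by (simp add: bump_def)
  ultimately have le: "bump t * (1 + (t + t\<^sup>2 / 2)) \<le> 1" by (metis mult_left_mono less_imp_le)
  have *: "bump t * y \<le> 1" if "y \<le> 1 + (t + t\<^sup>2 / 2)" for y
    using le mult_left_mono[OF that, of "bump t"] b by linarith
  show "bump t \<le> 1" using *[of 1] assms by simp
  show "(1 + t) * bump t \<le> 1" using *[of "1 + t"] by (simp add: mult.commute)
  show "(2 * t + t\<^sup>2) * bump t \<le> 2" using *[of "t + t\<^sup>2 / 2"] by (simp add: algebra_simps)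
  show "(t + t\<^sup>2) * bump t \<le> 2" using *[of "t / 2 + t\<^sup>2 / 2"] assms by (simp add: algebra_simps)
qed

context homogeneous_thin_solution
begin

section \<open>A boundary layer at the thin space and its limit\<close>

lemma u_thin_nonneg: "x $ m = 0 \<Longrightarrow> u x \<ge> 0"
  using sol by (auto simp: thin_obstacle_solution_def thin_space_def)

definition half_mass :: real where
  "half_mass = (\<integral>x. gauss x * u x * (if x $ m > 0 then 1 else 0) \<partial>lborel)"

text \<open>Since \<open>h'' - s h' + l h = 0\<close>, the expression
  \<open>b2 - s * b1 + l * b\<close> for the corrected function \<open>b\<close> contains only what
  the subtracted terms leave: \<open>- l * h 0\<close> from the constant, and
  \<open>h' 0 * Q\<close> from the layer \<open>d * (1 - bump (s / d))\<close>. Its weighted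
  integral over the half-space is 0 by \<open>half_space_identity\<close>.\<close>

lemma half_mass_eq:
  assumes h: "hermite_sol l h h'" and d: "d > 0"
  shows "l * h 0 * half_mass = h' 0 * (\<integral>x. gauss x * u x * (if x $ m > 0
     then (2 * (x $ m / d) + (x $ m / d)\<^sup>2) * bump (x $ m / d) / d
       + d * ((x $ m / d + (x $ m / d)\<^sup>2) * bump (x $ m / d)) - l * d * (1 - bump (x $ m / d)) else 0) \<partial>lborel)"
proof -
  have dh: "\<And>s. (h has_real_derivative h' s) (at s)"
    and dh': "\<And>s. (h' has_real_derivative (s * h' s - l * h s)) (at s)"
    using h by (auto simp: hermite_sol_def)
  obtain C0 N0 where hb0: "\<forall>s\<ge>0. \<bar>h s\<bar> \<le> C0 * (1 + s) ^ N0 \<and> \<bar>h' s\<bar> \<le> C0 * (1 + s) ^ N0"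
    using h unfolding hermite_sol_def by blast
  then have hb: "\<And>s. s \<ge> 0 \<Longrightarrow> \<bar>h s\<bar> \<le> C0 * (1 + s) ^ N0" "\<And>s. s \<ge> 0 \<Longrightarrow> \<bar>h' s\<bar> \<le> C0 * (1 + s) ^ N0"
    by auto
  have C0: "C0 \<ge> 0" using hb(1)[of 0] by simp
  define b where "b s = h s - h 0 - h' 0 * (d * (1 - bump (s / d)))" for s
  define b1 where "b1 s = h' s - h' 0 * ((1 + s / d) * bump (s / d))" for s
  define b2 where "b2 s = s * h' s - l * h s + h' 0 * ((2 * (s / d) + (s / d)\<^sup>2) * bump (s / d) / d)" for s
  define Q where "Q s = (2 * (s / d) + (s / d)\<^sup>2) * bump (s / d) / d
       + d * ((s / d + (s / d)\<^sup>2) * bump (s / d)) - l * d * (1 - bump (s / d))" for s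
  have db: "(b has_real_derivative b1 s) (at s)" for s
    unfolding b_def b1_def bump_def
    by (rule derivative_eq_intros dh refl | use d in \<open>simp add: field_simps\<close>)+
  have db1: "(b1 has_real_derivative b2 s) (at s)" for s
    unfolding b1_def b2_def bump_def
    by (rule derivative_eq_intros dh' refl | use d in \<open>simp add: field_simps power2_eq_square\<close>)+
  have ch: "continuous_on UNIV h" "continuous_on UNIV h'"
    using DERIV_isCont[OF dh] DERIV_isCont[OF dh'] by (auto intro!: continuous_at_imp_continuous_on)
  have cb: "continuous_on UNIV b" "continuous_on UNIV b2" "continuous_on UNIV Q"
    unfolding b_def[abs_def] b2_def[abs_def] Q_def[abs_def] bump_def[abs_def]
    by (intro continuous_intros ch; use d in simp)+
  have aux: "\<bar>a * (Y / d)\<bar> = \<bar>a\<bar> / d * Y" if "0 \<le> Y" for a Y using that d by (simp add: abs_mult)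
  define C where "C = C0 * (1 + l) + 2 * \<bar>h' 0\<bar> / d"
  have C: "C \<ge> 0" using C0 l_pos d by (simp add: C_def)
  have B2: "\<bar>b2 s\<bar> \<le> C * (1 + s) ^ Suc N0" if s: "s \<ge> 0" for s
  proof -
    let ?P = "(1 + s) ^ N0"
    have "\<bar>s * h' s\<bar> \<le> s * (C0 * ?P)" using hb(2)[OF s] s by (simp add: abs_mult mult_left_mono)
    moreover have "\<bar>l * h s\<bar> \<le> l * (C0 * (1 + s) ^ Suc N0)"
    proof -
      have "\<bar>h s\<bar> \<le> C0 * (1 + s) ^ N0" by (rule hb(1)[OF s])
      also have "\<dots> \<le> C0 * (1 + s) ^ Suc N0" using s C0 by (intro mult_left_mono power_increasing) auto
      finally show ?thesis using l_pos by (simp add: abs_mult mult_left_mono)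
    qed
    moreover have "s * (C0 * ?P) \<le> C0 * (1 + s) ^ Suc N0" using C0 s by (simp add: algebra_simps)
    moreover have "\<bar>h' 0 * ((2 * (s / d) + (s / d)\<^sup>2) * bump (s / d) / d)\<bar> \<le> 2 * \<bar>h' 0\<bar> / d * (1 + s) ^ Suc N0"
    proof -
      have t: "s / d \<ge> 0" using s d by simp
      have "0 \<le> (2 * (s / d) + (s / d)\<^sup>2) * bump (s / d)"
        using t bump_bounds(1)[OF t] by (intro mult_nonneg_nonneg add_nonneg_nonneg) auto
      then have "\<bar>h' 0 * ((2 * (s / d) + (s / d)\<^sup>2) * bump (s / d) / d)\<bar> = \<bar>h' 0\<bar> / d * ((2 * (s / d) + (s / d)\<^sup>2) * bump (s / d))"
        by (rule aux)
      also have "\<dots> \<le> \<bar>h' 0\<bar> / d * 2" using bump_bounds(4)[OF t] d by (intro mult_left_mono) auto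
      also have "\<dots> \<le> \<bar>h' 0\<bar> / d * (2 * (1 + s) ^ Suc N0)"
        using d s one_le_power[of "1 + s" "Suc N0"] by (intro mult_left_mono) auto
      finally show ?thesis by (simp add: mult_ac)
    qed
    moreover have "C * (1 + s) ^ Suc N0 = C0 * (1 + s) ^ Suc N0 + l * (C0 * (1 + s) ^ Suc N0)
        + 2 * \<bar>h' 0\<bar> / d * (1 + s) ^ Suc N0"
      unfolding C_def by (simp only: distrib_right distrib_left mult_1_right mult_ac)
    moreover have "\<bar>b2 s\<bar> \<le> \<bar>s * h' s\<bar> + \<bar>l * h s\<bar> + \<bar>h' 0 * ((2 * (s / d) + (s / d)\<^sup>2) * bump (s / d) / d)\<bar>"
      unfolding b2_def by linarith
    ultimately show ?thesis by linarith
  qed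
  \<comment> \<open>Used twice, from \<open>b2\<close> to \<open>b1\<close> and from
    \<open>b1\<close> to \<open>b\<close>: both functions vanish at 0, which is what the two
    subtracted terms were chosen for.\<close>
  have mvt: "\<bar>f s\<bar> \<le> B * s" if s: "s > 0" and f: "\<And>t. (f has_real_derivative f' t) (at t)" "f 0 = 0"
      and f': "\<And>t. 0 \<le> t \<Longrightarrow> t \<le> s \<Longrightarrow> \<bar>f' t\<bar> \<le> B" for f f' :: "real \<Rightarrow> real" and s B
  proof -
    have "norm (f s - f 0) \<le> B * norm (s - 0)"
    proof (rule field_differentiable_bound)
      show "convex {0..s}" by simp
      show "(f has_field_derivative f' t) (at t within {0..s})" for t
        using f(1) has_field_derivative_at_within by blast
      show "norm (f' t) \<le> B" if "t \<in> {0..s}" for t using f' that by simp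
    qed (use s in auto)
    then show ?thesis using f(2) s by simp
  qed
  have mono: "C * (1 + t) ^ Suc N0 \<le> C * (1 + s) ^ Suc N0" if "0 \<le> t" "t \<le> s" for s t
    using that C by (intro mult_left_mono power_mono) auto
  have B1: "\<bar>b1 s\<bar> \<le> C * s * (1 + s) ^ Suc N0" if s: "s > 0" for s
  proof -
    have "\<bar>b1 s\<bar> \<le> C * (1 + s) ^ Suc N0 * s"
    proof (rule mvt[OF s db1])
      show "b1 0 = 0" by (simp add: b1_def bump_def)
      show "\<bar>b2 t\<bar> \<le> C * (1 + s) ^ Suc N0" if "0 \<le> t" "t \<le> s" for t
        using B2[OF that(1)] mono[OF that] by linarith
    qed
    then show ?thesis by (simp only: mult_ac)
  qed
  have B0: "\<bar>b s\<bar> \<le> C * s\<^sup>2 * (1 + s) ^ Suc N0" if s: "s > 0" for s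
  proof -
    have "\<bar>b s\<bar> \<le> (s * (C * (1 + s) ^ Suc N0)) * s"
    proof (rule mvt[OF s db])
      show "b 0 = 0" by (simp add: b_def bump_def)
      show "\<bar>b1 t\<bar> \<le> s * (C * (1 + s) ^ Suc N0)" if "0 \<le> t" "t \<le> s" for t
      proof (cases "t = 0")
        case True
        then show ?thesis using s C by (simp add: b1_def bump_def)
      next
        case False
        then have "\<bar>b1 t\<bar> \<le> t * (C * (1 + t) ^ Suc N0)" using B1[of t] that by (simp add: mult_ac)
        also have "\<dots> \<le> s * (C * (1 + s) ^ Suc N0)" by (rule mult_mono[OF that(2) mono[OF that]]) (use s C that in auto)
        finally show ?thesis .
      qed
    qed
    then show ?thesis by (simp only: mult_ac power2_eq_square)
  qed
  have id: "(\<integral>x. gauss x * u x * (if x $ m > 0 then b2 (x $ m) - x $ m * b1 (x $ m) else 0) \<partial>lborel)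
    = - l * (\<integral>x. gauss x * u x * (if x $ m > 0 then b (x $ m) else 0) \<partial>lborel)"
    by (rule half_space_identity[OF C db db1 continuous_on_subset[OF cb(2)] B0 B1 B2]) auto
  have eq: "b2 s - s * b1 s = - l * b s - l * h 0 + h' 0 * Q s" for s
    unfolding b_def b1_def b2_def Q_def using d by (simp add: field_simps power2_eq_square)
  have xm: "\<bar>x $ m\<bar> \<le> norm x" for x :: "real^'n" by (rule component_le_norm_cart)
  have ig: "integrable lborel (\<lambda>x. gauss x * u x * (if x $ m > 0 then f (x $ m) else 0))"
    if f: "continuous_on UNIV f" "\<And>s. s > 0 \<Longrightarrow> \<bar>f s\<bar> \<le> K * (1 + s) ^ M" "K \<ge> 0" for f K M
  proof (rule gauss_weighted_integrable[where C = K and N = M])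
    have [measurable]: "f \<in> borel_measurable borel" using f(1) by (rule borel_measurable_continuous_onI)
    show "(\<lambda>x::real^'n. if x $ m > 0 then f (x $ m) else 0) \<in> borel_measurable borel" by measurable
    show "\<bar>if x $ m > 0 then f (x $ m) else 0\<bar> \<le> K * (1 + norm x) ^ M" for x :: "real^'n"
    proof (cases "x $ m > 0")
      case True
      then have "\<bar>f (x $ m)\<bar> \<le> K * (1 + x $ m) ^ M" by (rule f(2))
      also have "\<dots> \<le> K * (1 + norm x) ^ M" using True xm[of x] f(3) by (intro mult_left_mono power_mono) auto
      finally show ?thesis using True by simp
    qed (use f(3) in simp)
  qed (rule f(3))
  have i1: "integrable lborel (\<lambda>x. gauss x * u x * (if x $ m > 0 then b (x $ m) else 0))"
  proof (rule ig[OF cb(1) _ C])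
    fix s :: real assume s: "s > 0"
    have "\<bar>b s\<bar> \<le> C * s\<^sup>2 * (1 + s) ^ Suc N0" by (rule B0[OF s])
    also have "\<dots> \<le> C * (1 + s)\<^sup>2 * (1 + s) ^ Suc N0"
      using s C by (intro mult_right_mono mult_left_mono power_mono) auto
    finally show "\<bar>b s\<bar> \<le> C * (1 + s) ^ (2 + Suc N0)" by (simp only: power_add mult.assoc)
  qed
  have i2: "integrable lborel (\<lambda>x. gauss x * u x * (if x $ m > 0 then 1 else 0))"
    by (rule ig[where K = 1 and M = 0]) auto
  have i3: "integrable lborel (\<lambda>x. gauss x * u x * (if x $ m > 0 then Q (x $ m) else 0))"
  proof (rule ig[OF cb(3), where K = "2 / d + 2 * d + l * d" and M = 0])
    fix s :: real assume s: "s > 0"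
    have t: "s / d \<ge> 0" using s d by simp
    note bb = bump_bounds[OF t]
    have "\<bar>(2 * (s / d) + (s / d)\<^sup>2) * bump (s / d) / d\<bar> \<le> 2 / d"
      using bb t d by (simp add: abs_mult divide_right_mono)
    moreover have "\<bar>d * ((s / d + (s / d)\<^sup>2) * bump (s / d))\<bar> \<le> 2 * d"
      using bb t d by (simp add: abs_mult)
    moreover have "\<bar>l * d * (1 - bump (s / d))\<bar> \<le> l * d"
      using bb d l_pos by (simp add: abs_mult mult_left_le)
    ultimately have "\<bar>Q s\<bar> \<le> 2 / d + 2 * d + l * d"
      unfolding Q_def by linarith
    then show "\<bar>Q s\<bar> \<le> (2 / d + 2 * d + l * d) * (1 + s) ^ 0" by simp
  qed (use d l_pos in auto)
  have lin: "(\<integral>x. \<alpha> * f x - \<beta> * g x + \<gamma> * k x \<partial>lborel)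
      = \<alpha> * (\<integral>x. f x \<partial>lborel) - \<beta> * (\<integral>x. g x \<partial>lborel) + \<gamma> * (\<integral>x. k x \<partial>lborel)"
    if "integrable lborel f" "integrable lborel g" "integrable lborel k"
    for \<alpha> \<beta> \<gamma> :: real and f g k :: "real ^ 'n \<Rightarrow> real"
    using that by simp
  have "(\<integral>x. gauss x * u x * (if x $ m > 0 then b2 (x $ m) - x $ m * b1 (x $ m) else 0) \<partial>lborel)
    = (\<integral>x. - l * (gauss x * u x * (if x $ m > 0 then b (x $ m) else 0))
       - l * h 0 * (gauss x * u x * (if x $ m > 0 then 1 else 0))
       + h' 0 * (gauss x * u x * (if x $ m > 0 then Q (x $ m) else 0)) \<partial>lborel)"
    by (intro Bochner_Integration.integral_cong refl) (simp add: eq algebra_simps)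
  also have "\<dots> = - l * (\<integral>x. gauss x * u x * (if x $ m > 0 then b (x $ m) else 0) \<partial>lborel)
       - l * h 0 * half_mass + h' 0 * (\<integral>x. gauss x * u x * (if x $ m > 0 then Q (x $ m) else 0) \<partial>lborel)"
    unfolding half_mass_def by (rule lin[OF i1 i2 i3])
  finally show ?thesis unfolding id Q_def by simp
qed

text \<open>As \<open>d\<close> tends to 0, the singular part of the layer is
  \<open>bump'' (s / d) / d\<close>. Substituting \<open>s = d * t\<close> turns its integral into
  \<open>I d\<close>, with limit \<open>I 0\<close>, where \<open>u\<close> is evaluated on the thin
  space only. Since \<open>bump''\<close> has integral 1 over \<open>t > 0\<close>,
  \<open>I 0\<close> is the integral of \<open>u G\<close> over the thin space, written as an
  integral over the whole space. The other layer terms carry a factor \<open>d\<close>.\<close>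

lemma half_mass_nonneg:
  assumes h: "hermite_sol l h h'" and pos: "h 0 * h' 0 > 0"
  shows "half_mass \<ge> 0"
proof -
  let ?M = "\<lambda>x::real^'n. if x $ m > 0 then (2 * x $ m + (x $ m)\<^sup>2) * bump (x $ m) else 0"
  define e where "e j = 1 / real (Suc j)" for j
  have e0: "0 < e j" "e j \<le> 1" for j by (auto simp: e_def)
  have e_lim: "e \<longlonglongrightarrow> 0" unfolding e_def by (rule LIMSEQ_Suc[OF lim_1_over_n])
  define T where "T = scale_coord m"
  define I where "I d = (\<integral>x. gauss (T d x) * u (T d x) * ?M x \<partial>lborel)" for d
  define J where "J d = (\<integral>x. gauss x * u x * (if x $ m > 0
     then (x $ m / d + (x $ m / d)\<^sup>2) * bump (x $ m / d) - l * (1 - bump (x $ m / d)) else 0) \<partial>lborel)" for d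
  have [measurable]: "bump \<in> borel_measurable borel" unfolding bump_def[abs_def] by measurable
  have [measurable]: "T d \<in> borel_measurable borel" for d unfolding T_def by measurable
  have int1: "integrable lborel (\<lambda>x. gauss x * u x * (if x $ m > 0 then (2 * (x $ m / d) + (x $ m / d)\<^sup>2) * bump (x $ m / d) / d else 0))"
    if d: "d > 0" for d
  proof (rule gauss_weighted_integrable[where C = "2 / d" and N = 0])
    fix x :: "real^'n"
    show "\<bar>if x $ m > 0 then (2 * (x $ m / d) + (x $ m / d)\<^sup>2) * bump (x $ m / d) / d else 0\<bar> \<le> 2 / d * (1 + norm x) ^ 0"
      using d bump_bounds[of "x $ m / d"] by (auto simp: abs_mult divide_right_mono)
  qed (use d in auto)
  have bJ: "\<bar>if x $ m > 0 then (x $ m / d + (x $ m / d)\<^sup>2) * bump (x $ m / d) - l * (1 - bump (x $ m / d)) else 0\<bar> \<le> 2 + l"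
    if d: "d > 0" for d and x :: "real^'n"
  proof (cases "x $ m > 0")
    case True
    then have t: "x $ m / d \<ge> 0" using d by simp
    note bb = bump_bounds[OF t]
    have "0 \<le> (x $ m / d + (x $ m / d)\<^sup>2) * bump (x $ m / d)" using t bb(1) by simp
    moreover have "0 \<le> l * (1 - bump (x $ m / d))" "l * (1 - bump (x $ m / d)) \<le> l"
      using bb(1,2) l_pos by (auto simp: mult_left_le)
    ultimately have "\<bar>(x $ m / d + (x $ m / d)\<^sup>2) * bump (x $ m / d) - l * (1 - bump (x $ m / d))\<bar> \<le> 2 + l"
      using bb(5) l_pos by linarith
    then show ?thesis using True by simp
  qed (use l_pos in simp)
  have int2: "integrable lborel (\<lambda>x. gauss x * u x * (if x $ m > 0
     then (x $ m / d + (x $ m / d)\<^sup>2) * bump (x $ m / d) - l * (1 - bump (x $ m / d)) else 0))"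
    if d: "d > 0" for d
    by (rule gauss_weighted_integrable[where C = "2 + l" and N = 0]) (use bJ[OF d] l_pos in auto)
  have key: "l * h 0 * half_mass = h' 0 * (I d + d * J d)" if d: "d > 0" for d
  proof -
    have "l * h 0 * half_mass = h' 0 * (\<integral>x. gauss x * u x * (if x $ m > 0
     then (2 * (x $ m / d) + (x $ m / d)\<^sup>2) * bump (x $ m / d) / d
       + d * ((x $ m / d + (x $ m / d)\<^sup>2) * bump (x $ m / d)) - l * d * (1 - bump (x $ m / d)) else 0) \<partial>lborel)"
      by (rule half_mass_eq[OF h d])
    also have "(\<integral>x. gauss x * u x * (if x $ m > 0
     then (2 * (x $ m / d) + (x $ m / d)\<^sup>2) * bump (x $ m / d) / d
       + d * ((x $ m / d + (x $ m / d)\<^sup>2) * bump (x $ m / d)) - l * d * (1 - bump (x $ m / d)) else 0) \<partial>lborel)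
      = (\<integral>x. gauss x * u x * (if x $ m > 0 then (2 * (x $ m / d) + (x $ m / d)\<^sup>2) * bump (x $ m / d) / d else 0)
        + d * (gauss x * u x * (if x $ m > 0
     then (x $ m / d + (x $ m / d)\<^sup>2) * bump (x $ m / d) - l * (1 - bump (x $ m / d)) else 0)) \<partial>lborel)"
      by (intro Bochner_Integration.integral_cong refl) (simp add: algebra_simps)
    also have "\<dots> = (\<integral>x. gauss x * u x * (if x $ m > 0 then (2 * (x $ m / d) + (x $ m / d)\<^sup>2) * bump (x $ m / d) / d else 0) \<partial>lborel)
       + d * J d"
      unfolding J_def using int1[OF d] int2[OF d]
      by (subst Bochner_Integration.integral_add) (auto intro: integrable_mult_right)
    also have "(\<integral>x. gauss x * u x * (if x $ m > 0 then (2 * (x $ m / d) + (x $ m / d)\<^sup>2) * bump (x $ m / d) / d else 0) \<partial>lborel)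
      = \<bar>d\<bar> * (\<integral>x. gauss (T d x) * u (T d x) * (if T d x $ m > 0 then (2 * (T d x $ m / d) + (T d x $ m / d)\<^sup>2) * bump (T d x $ m / d) / d else 0) \<partial>lborel)"
      unfolding T_def using d by (intro integral_scale_coord) auto
    also have "\<dots> = (\<integral>x. d * (gauss (T d x) * u (T d x) * (if T d x $ m > 0 then (2 * (T d x $ m / d) + (T d x $ m / d)\<^sup>2) * bump (T d x $ m / d) / d else 0)) \<partial>lborel)"
      using d by simp
    also have "\<dots> = I d"
      unfolding I_def using d
      by (intro Bochner_Integration.integral_cong refl) (simp add: T_def scale_coord_nth zero_less_mult_iff)
    finally show ?thesis .
  qed
  have "(\<lambda>j. I (e j)) \<longlonglongrightarrow> I 0"
  proof -
    obtain C where C: "C > 0" "\<And>x. \<bar>u x\<bar> \<le> C * (1 + norm x) ^ nat \<lceil>l\<rceil>" using u_bound by blast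
    let ?w = "\<lambda>x::real^'n. C * 3 * ((1 + norm x) ^ (nat \<lceil>l\<rceil> + 2) * exp (- (1/2) * (norm x)\<^sup>2))"
    have w: "integrable lborel ?w"
      by (rule integrable_gaussian_bound[where c = "1/2" and C = "C * 3" and N = "nat \<lceil>l\<rceil> + 2"]) (use C in \<open>auto simp: abs_mult\<close>)
    show ?thesis unfolding I_def
    proof (rule integral_dominated_convergence[OF _ _ w])
      have cont: "isCont (\<lambda>x. gauss x * u x) y" for y
        using u_cont by (intro continuous_intros) (auto simp: continuous_on_eq_continuous_at)
      have Tl: "(\<lambda>j. T (e j) x) \<longlonglongrightarrow> T 0 x" for x
        unfolding T_def scale_coord_def
        by (intro tendsto_vec_lambda) (auto intro!: tendsto_eq_intros e_lim)
      show "AE x in lborel. (\<lambda>j. gauss (T (e j) x) * u (T (e j) x) * ?M x) \<longlonglongrightarrow> gauss (T 0 x) * u (T 0 x) * ?M x"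
        by (intro AE_I2 tendsto_mult[OF _ tendsto_const] isCont_tendsto_compose[OF cont Tl])
      show "AE x in lborel. norm (gauss (T (e j) x) * u (T (e j) x) * ?M x) \<le> ?w x" for j
      proof (rule AE_I2)
        fix x :: "real^'n"
        let ?y = "T (e j) x"
        have ny: "(norm z)\<^sup>2 = (\<Sum>i\<in>UNIV. (z $ i)\<^sup>2)" for z :: "real^'n"
          by (simp add: norm_vec_def L2_set_def sum_nonneg)
        have n1: "norm ?y \<le> norm x"
        proof (rule power2_le_imp_le)
          show "(norm ?y)\<^sup>2 \<le> (norm x)\<^sup>2" unfolding ny
          proof (rule sum_mono)
            fix i
            have "\<bar>?y $ i\<bar> \<le> \<bar>x $ i\<bar>" using e0[of j] by (auto simp: T_def scale_coord_nth abs_mult mult_left_le_one_le)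
            then show "(?y $ i)\<^sup>2 \<le> (x $ i)\<^sup>2" by (simp add: abs_le_square_iff)
          qed
        qed simp
        \<comment> \<open>The map \<open>T\<close> flattens the normal coordinate, so
          \<open>gauss ?y\<close> no longer decays uniformly in that direction. The factor
          \<open>exp (- t^2 / 2)\<close> in \<open>bump\<close> restores the missing decay.\<close>
        have n2: "(norm x)\<^sup>2 \<le> (norm ?y)\<^sup>2 + (x $ m)\<^sup>2"
        proof -
          have "(norm x)\<^sup>2 \<le> (\<Sum>i\<in>UNIV. (?y $ i)\<^sup>2 + (if i = m then (x $ m)\<^sup>2 else 0))"
            unfolding ny by (intro sum_mono) (auto simp: T_def scale_coord_nth)
          also have "\<dots> = (norm ?y)\<^sup>2 + (x $ m)\<^sup>2" unfolding ny by (simp add: sum.distrib)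
          finally show ?thesis .
        qed
        show "norm (gauss ?y * u ?y * ?M x) \<le> ?w x"
        proof (cases "x $ m > 0")
          case True
          let ?s = "x $ m"
          have s: "?s \<le> norm x" using component_le_norm_cart[of x m] by simp
          have "gauss ?y * bump ?s \<le> exp (- (1/2) * (norm x)\<^sup>2)"
            using n2 True unfolding bump_def exp_add[symmetric] by simp
          moreover have "2 * ?s + ?s\<^sup>2 \<le> 3 * (1 + norm x)\<^sup>2"
          proof -
            have "?s\<^sup>2 \<le> (norm x)\<^sup>2" using s True by (intro power_mono) auto
            moreover have "(1 + norm x)\<^sup>2 = 1 + 2 * norm x + (norm x)\<^sup>2" by (simp add: power2_sum)
            ultimately show ?thesis using s norm_ge_zero[of x] zero_le_power2[of "norm x"] by linarith
          qed
          moreover have "\<bar>u ?y\<bar> \<le> C * (1 + norm x) ^ nat \<lceil>l\<rceil>"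
          proof -
            have "(1 + norm ?y) ^ nat \<lceil>l\<rceil> \<le> (1 + norm x) ^ nat \<lceil>l\<rceil>" using n1 by (intro power_mono) auto
            then have "C * (1 + norm ?y) ^ nat \<lceil>l\<rceil> \<le> C * (1 + norm x) ^ nat \<lceil>l\<rceil>"
              using C(1) by (intro mult_left_mono) auto
            then show ?thesis by (rule order_trans[OF C(2)])
          qed
          ultimately have "(gauss ?y * bump ?s) * (2 * ?s + ?s\<^sup>2) * \<bar>u ?y\<bar>
            \<le> exp (- (1/2) * (norm x)\<^sup>2) * (3 * (1 + norm x)\<^sup>2) * (C * (1 + norm x) ^ nat \<lceil>l\<rceil>)"
            using C True bump_bounds(1)[of ?s] by (intro mult_mono) auto
          moreover have "norm (gauss ?y * u ?y * ?M x) = (gauss ?y * bump ?s) * (2 * ?s + ?s\<^sup>2) * \<bar>u ?y\<bar>"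
            using True bump_bounds(1)[of ?s] by (simp add: abs_mult)
          moreover have "exp (- (1/2) * (norm x)\<^sup>2) * (3 * (1 + norm x)\<^sup>2) * (C * (1 + norm x) ^ nat \<lceil>l\<rceil>) = ?w x"
            by (simp only: power_add mult_ac)
          ultimately show ?thesis by linarith
        qed (use C in simp)
      qed
    qed measurable
  qed
  moreover have "(\<lambda>j. e j * J (e j)) \<longlonglongrightarrow> 0"
  proof -
    let ?K = "\<integral>x. \<bar>gauss x * u x * (2 + l)\<bar> \<partial>lborel"
    have iK: "integrable lborel (\<lambda>x. gauss x * u x * (2 + l))"
      by (rule gauss_weighted_integrable[where C = "2 + l" and N = 0]) (use l_pos in auto)
    have "\<bar>J d\<bar> \<le> ?K" if d: "d > 0" for d
      unfolding J_def
    proof (rule order_trans[OF integral_abs_bound integral_mono])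
      fix x :: "real^'n"
      show "\<bar>gauss x * u x * (if x $ m > 0 then (x $ m / d + (x $ m / d)\<^sup>2) * bump (x $ m / d) - l * (1 - bump (x $ m / d)) else 0)\<bar>
        \<le> \<bar>gauss x * u x * (2 + l)\<bar>"
        unfolding abs_mult[of "gauss x * u x"] using bJ[OF d, of x] l_pos by (intro mult_left_mono) auto
    qed (use int2[OF d] iK in auto)
    then have b: "norm (e j * J (e j)) \<le> e j * ?K" for j
      using e0[of j] by (simp add: abs_mult mult_left_mono)
    have "(\<lambda>j. e j * ?K) \<longlonglongrightarrow> 0" by (auto intro!: tendsto_eq_intros e_lim)
    then show ?thesis by (rule Lim_null_comparison[rotated]) (use b in auto)
  qed
  ultimately have "(\<lambda>j. h' 0 * (I (e j) + e j * J (e j))) \<longlonglongrightarrow> h' 0 * (I 0 + 0)"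
    by (intro tendsto_intros)
  then have "(\<lambda>j. l * h 0 * half_mass) \<longlonglongrightarrow> h' 0 * I 0"
    using key[OF e0(1)] by simp
  then have "l * h 0 * half_mass = h' 0 * I 0" by (simp add: LIMSEQ_const_iff)
  moreover have "I 0 \<ge> 0" unfolding I_def
  proof (rule Bochner_Integration.integral_nonneg)
    fix x :: "real^'n"
    have "u (T 0 x) \<ge> 0" by (rule u_thin_nonneg) (simp add: T_def scale_coord_nth)
    then show "0 \<le> gauss (T 0 x) * u (T 0 x) * ?M x" using bump_bounds(1)[of "x $ m"] by auto
  qed
  \<comment> \<open>Only the sign of the product \<open>h 0 * h' 0\<close> is known, so the limit
    identity is multiplied by \<open>h' 0\<close>.\<close>
  ultimately have "(l * (h 0 * h' 0)) * half_mass = (h' 0)\<^sup>2 * I 0" "(h' 0)\<^sup>2 * I 0 \<ge> 0"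
  proof -
    assume A: "l * h 0 * half_mass = h' 0 * I 0" and B: "I 0 \<ge> 0"
    have "(l * (h 0 * h' 0)) * half_mass = h' 0 * (l * h 0 * half_mass)" by (simp only: mult_ac)
    then show "(l * (h 0 * h' 0)) * half_mass = (h' 0)\<^sup>2 * I 0" by (simp add: A power2_eq_square)
    show "(h' 0)\<^sup>2 * I 0 \<ge> 0" using B by simp
  qed
  then show ?thesis using pos l_pos by (metis mult_pos_pos zero_le_mult_iff not_less)
qed

text \<open>Green's formula lives on the half-space, the comparison on the whole space. Evenness
  links the two means, the thin space being a null set.\<close>

lemma integral_gauss_u: "(\<integral>x. gauss x * u x \<partial>lborel) = 2 * half_mass"
proof -
  have nr: "norm (scale_coord m (-1) x) = norm x" for x :: "real^'n"
    unfolding norm_vec_def L2_set_def by (intro arg_cong[where f = sqrt] sum.cong) (auto simp: scale_coord_nth)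
  have i: "integrable lborel (\<lambda>x. gauss x * u x * f x)" if "f \<in> borel_measurable borel" "\<And>x. \<bar>f x\<bar> \<le> 1" for f
    by (rule gauss_weighted_integrable[where C = 1 and N = 0]) (use that in auto)
  have "(\<integral>x. gauss x * u x * (if x $ m < 0 then 1 else 0) \<partial>lborel)
    = \<bar>- 1\<bar> * (\<integral>x. gauss (scale_coord m (-1) x) * u (scale_coord m (-1) x) * (if scale_coord m (-1) x $ m < 0 then 1 else 0) \<partial>lborel)"
    by (rule integral_scale_coord) auto
  also have "\<dots> = half_mass"
    unfolding half_mass_def by (simp add: nr scale_coord_nth u_reflect[unfolded thin_reflection_eq_scale_coord])
  finally have neg: "(\<integral>x. gauss x * u x * (if x $ m < 0 then 1 else 0) \<partial>lborel) = half_mass" .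
  have "negligible {x::real^'n. x $ m = 0}" by (rule negligible_standard_hyperplane_cart)
  then have "AE x in lebesgue. x \<notin> {x::real^'n. x $ m = 0}"
    unfolding negligible_iff_null_sets by (rule AE_not_in)
  then have "AE x in lborel. x \<notin> {x::real^'n. x $ m = 0}"
    by (subst (asm) AE_completion_iff) auto
  then have "(\<integral>x. gauss x * u x \<partial>lborel) = (\<integral>x. gauss x * u x * (if x $ m > 0 then 1 else 0)
     + gauss x * u x * (if x $ m < 0 then 1 else 0) \<partial>lborel)"
    by (intro integral_cong_AE) (auto elim!: AE_mp)
  also have "\<dots> = half_mass + half_mass"
    using neg i by (subst Bochner_Integration.integral_add) (auto simp: half_mass_def)
  finally show ?thesis by simp
qed

end

section \<open>Gaussian averages\<close>

lemma line_derivative_shift: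
  fixes f :: "real ^ 'n::finite \<Rightarrow> real"
  assumes "((\<lambda>s. f ((x + r *\<^sub>R e) + s *\<^sub>R e)) has_real_derivative D) (at 0)"
  shows "((\<lambda>s. f (x + s *\<^sub>R e)) has_real_derivative D) (at r)"
proof -
  have "((\<lambda>s. f (x + (s + r) *\<^sub>R e)) has_real_derivative D) (at 0)"
    using assms by (simp add: scaleR_add_left add.assoc add.commute add.left_commute)
  then have "((\<lambda>s. f (x + s *\<^sub>R e)) has_real_derivative D) (at (0 + r))"
    by (subst DERIV_shift)
  then show ?thesis by simp
qed

lemma second_derivative_nonneg_at_min:
  fixes f f' :: "real \<Rightarrow> real"
  assumes d: "d > 0"
    and f: "\<And>r. \<bar>r\<bar> < d \<Longrightarrow> (f has_real_derivative f' r) (at r)"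
    and f': "(f' has_real_derivative D) (at 0)"
    and min: "\<And>r. \<bar>r\<bar> < d \<Longrightarrow> f 0 \<le> f r"
  shows "f' 0 = 0" "D \<ge> 0"
proof -
  show z: "f' 0 = 0"
    by (rule DERIV_local_min[OF f[of 0] d]) (use d min in auto)
  show "D \<ge> 0"
  proof (rule ccontr)
    assume "\<not> D \<ge> 0"
    then obtain c where c: "c > 0" "\<And>h. 0 < h \<Longrightarrow> h < c \<Longrightarrow> f' (0 + h) < f' 0"
      using DERIV_neg_dec_right[OF f'] by auto
    define h where "h = min c d / 2"
    have h: "0 < h" "h < c" "h < d" using c(1) d by (auto simp: h_def min_def)
    have "f h < f 0"
    proof (rule DERIV_neg_imp_decreasing_open[OF h(1)])
      show "\<exists>y. (f has_real_derivative y) (at r) \<and> y < 0" if "0 < r" "r < h" for r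
        using f[of r] c(2)[of r] z that h by (intro exI[of _ "f' r"]) auto
      show "continuous_on {0..h} f"
        using f h by (intro continuous_at_imp_continuous_on ballI DERIV_isCont[OF f]) auto
    qed
    then show False using min[of h] h by simp
  qed
qed

text \<open>The right side minus the left side is half of
  \<open>(norm (z - 2 *\<^sub>R w))^2\<close>. It allows a Gaussian with bounded shift to be
  dominated by a centred one with half the exponent.\<close>

lemma norm_diff_sq_bound:
  fixes z w :: "'a::real_inner"
  shows "(norm z)\<^sup>2 / 2 - (norm w)\<^sup>2 \<le> (norm (z - w))\<^sup>2"
proof -
  have "0 \<le> (norm (z - 2 *\<^sub>R w))\<^sup>2" by simp
  then show ?thesis
    by (simp add: power2_norm_eq_inner inner_diff_left inner_diff_right inner_commute algebra_simps)
qed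

context homogeneous_thin_solution
begin

lemma gauss_shift_bound:
  assumes "norm w \<le> R"
  shows "gauss (z - w) \<le> exp (R\<^sup>2 / 2) * exp (- (1/4) * (norm z)\<^sup>2)"
proof -
  have "(norm w)\<^sup>2 \<le> R\<^sup>2" using assms by (intro power_mono) auto
  then have "- (norm (z - w))\<^sup>2 / 2 \<le> R\<^sup>2 / 2 + - (1/4) * (norm z)\<^sup>2"
    using norm_diff_sq_bound[of z w] by simp
  then show ?thesis unfolding exp_add[symmetric] by simp
qed

lemma shifted_bound:
  assumes w: "norm w \<le> R" and f: "\<bar>f\<bar> \<le> K * (1 + norm z) ^ N" and K: "K \<ge> 0"
    and C: "C \<ge> 0" "\<bar>u z\<bar> \<le> C * (1 + norm z) ^ L"
  shows "\<bar>f * gauss (z - w) * u z\<bar> \<le> (K * exp (R\<^sup>2 / 2) * C) * ((1 + norm z) ^ (N + L) * exp (- (1/4) * (norm z)\<^sup>2))"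
proof -
  have "\<bar>f\<bar> * gauss (z - w) * \<bar>u z\<bar>
      \<le> (K * (1 + norm z) ^ N) * (exp (R\<^sup>2 / 2) * exp (- (1/4) * (norm z)\<^sup>2)) * (C * (1 + norm z) ^ L)"
    using assms gauss_shift_bound[OF w] by (intro mult_mono) auto
  then show ?thesis by (simp add: abs_mult power_add mult_ac)
qed

lemma shifted_integrable:
  assumes f: "f \<in> borel_measurable borel" "\<And>z. \<bar>f z\<bar> \<le> K * (1 + norm z) ^ N" and K: "K \<ge> 0"
  shows "integrable lborel (\<lambda>z. f z * gauss (z - w) * u z)"
proof -
  obtain C where C: "C > 0" "\<And>x. \<bar>u x\<bar> \<le> C * (1 + norm x) ^ nat \<lceil>l\<rceil>" using u_bound by blast
  show ?thesis
  proof (rule integrable_gaussian_bound)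
    show "\<bar>f z * gauss (z - w) * u z\<bar> \<le> (K * exp ((norm w)\<^sup>2 / 2) * C) * ((1 + norm z) ^ (N + nat \<lceil>l\<rceil>) * exp (- (1/4) * (norm z)\<^sup>2))" for z
      by (rule shifted_bound[OF order_refl f(2) K]) (use C in auto)
  qed (use f in auto)
qed

definition mollified :: "real ^ 'n \<Rightarrow> real" where
  "mollified x = (\<integral>z. gauss (z - x) * u z \<partial>lborel)"

text \<open>The weights \<open>y\<close> and \<open>y^2 - 1\<close> are the Hermite polynomials
  produced by differentiating the kernel once and twice. The derivatives fall on the kernel because
  \<open>u\<close> need not be differentiable on the contact set.\<close>

definition mollified1 :: "'n \<Rightarrow> real ^ 'n \<Rightarrow> real" where
  "mollified1 i x = (\<integral>z. (z $ i - x $ i) * gauss (z - x) * u z \<partial>lborel)"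

definition mollified2 :: "'n \<Rightarrow> real ^ 'n \<Rightarrow> real" where
  "mollified2 i x = (\<integral>z. ((z $ i - x $ i)\<^sup>2 - 1) * gauss (z - x) * u z \<partial>lborel)"

lemma gauss_shift_line:
  "gauss (z - (x + r *\<^sub>R axis i 1)) = exp (- ((norm (z - x))\<^sup>2 - 2 * r * (z $ i - x $ i) + r\<^sup>2) / 2)"
  using norm_axis_line[of "z - x" "- r" i] by (simp add: diff_diff_eq algebra_simps)

lemma coord_diff_bound:
  fixes x z :: "real ^ 'n"
  assumes "\<bar>r\<bar> \<le> 1"
  shows "\<bar>z $ i - x $ i - r\<bar> \<le> (2 + norm x) * (1 + norm z)"
proof -
  have "\<bar>z $ i - x $ i - r\<bar> \<le> norm z + norm x + 1"
    using component_le_norm_cart[of z i] component_le_norm_cart[of x i] assms by linarith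
  also have "\<dots> \<le> (2 + norm x) * (1 + norm z)" by (simp add: algebra_simps)
  finally show ?thesis .
qed

text \<open>Covers both derivatives at once: a kernel \<open>p v * exp (- v^2 / 2)\<close> in the
  coordinate \<open>v = z $ i - x $ i\<close> is differentiated in \<open>x\<close>, which replaces
  \<open>p\<close> by \<open>v * p - p'\<close>. The cases are \<open>p = 1\<close> and
  \<open>p v = v\<close>.\<close>

lemma mollified_deriv_aux:
  fixes p p' :: "real \<Rightarrow> real"
  assumes p: "\<And>v. (p has_real_derivative p' v) (at v)"
    and bp: "\<And>v. \<bar>p v\<bar> \<le> 2 * (1 + \<bar>v\<bar>) ^ 2" "\<And>v. \<bar>v * p v - p' v\<bar> \<le> 2 * (1 + \<bar>v\<bar>) ^ 2"
    and mp: "p' \<in> borel_measurable borel"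
  shows "((\<lambda>r. \<integral>z. p (z $ i - (x + r *\<^sub>R axis i 1) $ i) * gauss (z - (x + r *\<^sub>R axis i 1)) * u z \<partial>lborel)
    has_real_derivative (\<integral>z. ((z $ i - x $ i) * p (z $ i - x $ i) - p' (z $ i - x $ i)) * gauss (z - x) * u z \<partial>lborel)) (at 0)"
proof -
  obtain C where C: "C > 0" "\<And>x. \<bar>u x\<bar> \<le> C * (1 + norm x) ^ nat \<lceil>l\<rceil>" using u_bound by blast
  have [measurable]: "p \<in> borel_measurable borel"
    using DERIV_isCont[OF p] by (intro borel_measurable_continuous_onI continuous_at_imp_continuous_on) auto
  note mp[measurable]
  let ?v = "\<lambda>r z. z $ i - (x + r *\<^sub>R axis i 1) $ i"
  have v: "?v r z = z $ i - x $ i - r" for r z by (simp add: axis_def)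
  define K where "K = 2 * (3 + norm x) ^ 2"
  have vb: "2 * (1 + \<bar>?v r z\<bar>) ^ 2 \<le> K * (1 + norm z) ^ 2" if "\<bar>r\<bar> \<le> 1" for r z
  proof -
    have "1 + \<bar>?v r z\<bar> \<le> 1 * (1 + norm z) + (2 + norm x) * (1 + norm z)"
      unfolding v using coord_diff_bound[OF that, of z i x] by (intro add_mono) auto
    also have "\<dots> = (3 + norm x) * (1 + norm z)" by (simp add: algebra_simps)
    finally have "(1 + \<bar>?v r z\<bar>) ^ 2 \<le> ((3 + norm x) * (1 + norm z)) ^ 2" by (intro power_mono) auto
    then show ?thesis by (simp add: K_def power_mult_distrib)
  qed
  have nb: "norm (x + r *\<^sub>R axis i 1) \<le> norm x + 1" if "\<bar>r\<bar> \<le> 1" for r :: real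
    using norm_triangle_ineq[of x "r *\<^sub>R axis i 1"] that by simp
  have K: "K \<ge> 0" by (simp add: K_def)
  let ?w = "\<lambda>z::real^'n. (K * exp ((norm x + 1)\<^sup>2 / 2) * C) * ((1 + norm z) ^ (2 + nat \<lceil>l\<rceil>) * exp (- (1/4) * (norm z)\<^sup>2))"
  have "((\<lambda>r. \<integral>z. p (?v r z) * gauss (z - (x + r *\<^sub>R axis i 1)) * u z \<partial>lborel)
    has_real_derivative (\<integral>z. (?v 0 z * p (?v 0 z) - p' (?v 0 z)) * gauss (z - (x + 0 *\<^sub>R axis i 1)) * u z \<partial>lborel)) (at 0)"
  proof (rule integral_has_real_derivative_dominated[where d = 1 and w = ?w])
    show "integrable lborel ?w"
      by (rule integrable_gaussian_bound[where c = "1/4" and C = "K * exp ((norm x + 1)\<^sup>2 / 2) * C" and N = "2 + nat \<lceil>l\<rceil>"])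
        (use K C in \<open>auto simp: abs_mult\<close>)
    fix r :: real assume "\<bar>r - 0\<bar> < 1"
    then have r: "\<bar>r\<bar> \<le> 1" by simp
    show "integrable lborel (\<lambda>z. p (?v r z) * gauss (z - (x + r *\<^sub>R axis i 1)) * u z)"
      by (rule shifted_integrable[where K = K and N = 2]) (use order_trans[OF bp(1) vb[OF r]] K in auto)
    fix z :: "real^'n"
    show "\<bar>(?v r z * p (?v r z) - p' (?v r z)) * gauss (z - (x + r *\<^sub>R axis i 1)) * u z\<bar> \<le> ?w z"
      by (rule shifted_bound[OF nb[OF r] order_trans[OF bp(2) vb[OF r]] K]) (use C in auto)
    have dp: "((\<lambda>r. p (z $ i - x $ i - r)) has_real_derivative p' (z $ i - x $ i - r) * (- 1)) (at r)"
      by (rule DERIV_chain2[OF p]) (auto intro!: derivative_eq_intros)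
    have de: "((\<lambda>r. exp (- ((norm (z - x))\<^sup>2 - 2 * r * (z $ i - x $ i) + r\<^sup>2) / 2)) has_real_derivative
        (z $ i - x $ i - r) * exp (- ((norm (z - x))\<^sup>2 - 2 * r * (z $ i - x $ i) + r\<^sup>2) / 2)) (at r)"
      by (auto intro!: derivative_eq_intros simp: field_simps)
    have alg: "(a * (- 1) * E + v * E * P) * U = (v * P - a) * E * U" for a E v P U :: real
      by (simp add: algebra_simps)
    show "((\<lambda>r. p (?v r z) * gauss (z - (x + r *\<^sub>R axis i 1)) * u z) has_real_derivative
        (?v r z * p (?v r z) - p' (?v r z)) * gauss (z - (x + r *\<^sub>R axis i 1)) * u z) (at r)"
      unfolding v gauss_shift_line by (rule DERIV_cong[OF DERIV_cmult_right[OF DERIV_mult[OF dp de]] alg])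
  qed auto
  then show ?thesis by simp
qed

lemma mollified_deriv:
  "((\<lambda>r. mollified (x + r *\<^sub>R axis i 1)) has_real_derivative mollified1 i x) (at 0)"
  using mollified_deriv_aux[of "\<lambda>_. 1" "\<lambda>_. 0" i x]
  by (simp add: mollified_def mollified1_def power2_eq_square algebra_simps)

lemma mollified1_deriv:
  "((\<lambda>r. mollified1 i (x + r *\<^sub>R axis i 1)) has_real_derivative mollified2 i x) (at 0)"
proof -
  have "((\<lambda>r. \<integral>z. (z $ i - (x + r *\<^sub>R axis i 1) $ i) * gauss (z - (x + r *\<^sub>R axis i 1)) * u z \<partial>lborel)
    has_real_derivative (\<integral>z. ((z $ i - x $ i) * (z $ i - x $ i) - 1) * gauss (z - x) * u z \<partial>lborel)) (at 0)"
  proof (rule mollified_deriv_aux)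
    fix v :: real
    show "\<bar>v\<bar> \<le> 2 * (1 + \<bar>v\<bar>) ^ 2" by (simp add: power2_sum)
    have "\<bar>v * v - 1\<bar> \<le> \<bar>v * v\<bar> + 1" by linarith
    then show "\<bar>v * v - 1\<bar> \<le> 2 * (1 + \<bar>v\<bar>) ^ 2" by (simp add: power2_eq_square algebra_simps)
  qed auto
  then show ?thesis unfolding mollified1_def mollified2_def by (simp only: power2_eq_square)
qed

text \<open>Substituting \<open>t *\<^sub>R z\<close> for \<open>z\<close> and using homogeneity
  shows that the integral of \<open>gauss (t *\<^sub>R z - x) * u z\<close> is
  \<open>t powr (- (n + l)) * mollified x\<close>, where \<open>n\<close> is the dimension.
  Differentiation at \<open>t = 1\<close> gives the claim.\<close>

lemma mollified_scaling:
  "(\<integral>z. (z \<bullet> (z - x)) * gauss (z - x) * u z \<partial>lborel) = (real CARD('n) + l) * mollified x"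
proof -
  obtain C where C: "C > 0" "\<And>x. \<bar>u x\<bar> \<le> C * (1 + norm x) ^ nat \<lceil>l\<rceil>" using u_bound by blast
  define \<Phi> where "\<Phi> t = (\<integral>z. gauss (t *\<^sub>R z - x) * u z \<partial>lborel)" for t
  have \<Phi>: "t powr (- (real CARD('n) + l)) * mollified x = \<Phi> t" if t: "t > 0" for t
  proof -
    have "mollified x = t ^ DIM(real^'n) * (\<integral>z. gauss (t *\<^sub>R z - x) * u (t *\<^sub>R z) \<partial>lborel)"
      unfolding mollified_def using t by (intro integral_scaleR_lborel) auto
    also have "(\<integral>z. gauss (t *\<^sub>R z - x) * u (t *\<^sub>R z) \<partial>lborel) = (\<integral>z. t powr l * (gauss (t *\<^sub>R z - x) * u z) \<partial>lborel)"
      using t by (intro Bochner_Integration.integral_cong refl) (simp add: u_scale)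
    also have "\<dots> = t powr l * \<Phi> t" by (simp add: \<Phi>_def)
    also have "t ^ DIM(real^'n) * (t powr l * \<Phi> t) = t powr (real CARD('n) + l) * \<Phi> t"
      using t by (simp add: powr_add powr_realpow)
    finally have "mollified x = t powr (real CARD('n) + l) * \<Phi> t" .
    moreover have "t powr (- a) * t powr a = 1" for a using t by (simp add: powr_minus)
    ultimately show ?thesis by (simp only: mult.assoc[symmetric] mult_1_left)
  qed
  \<comment> \<open>For \<open>t \<ge> 1/2\<close> at least a quarter of \<open>(norm z)^2\<close>
    survives the scaling. The shift by \<open>x\<close> halves it, and the exponent of
    \<open>gauss\<close> halves it again, hence 1/16.\<close>
  have gb: "gauss (t *\<^sub>R z - x) \<le> exp ((norm x)\<^sup>2 / 2) * exp (- (1/16) * (norm z)\<^sup>2)" if t: "\<bar>t - 1\<bar> < 1/2" for t z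
  proof -
    have "1/2 \<le> t" using t by linarith
    then have "1/4 \<le> t\<^sup>2" using power_mono[of "1/2" t 2] by (simp add: power2_eq_square)
    then have "1/4 * (norm z)\<^sup>2 \<le> t\<^sup>2 * (norm z)\<^sup>2" by (rule mult_right_mono) simp
    then have "(norm z)\<^sup>2 / 8 - (norm x)\<^sup>2 \<le> (norm (t *\<^sub>R z - x))\<^sup>2"
      using norm_diff_sq_bound[of "t *\<^sub>R z" x] by (simp add: power_mult_distrib)
    then have "- (norm (t *\<^sub>R z - x))\<^sup>2 / 2 \<le> (norm x)\<^sup>2 / 2 + - (1/16) * (norm z)\<^sup>2" by simp
    then show ?thesis unfolding exp_add[symmetric] by simp
  qed
  define E where "E = exp ((norm x)\<^sup>2 / 2)"
  have E: "E > 0" by (simp add: E_def)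
  have nt: "(norm (t *\<^sub>R z - x))\<^sup>2 = t\<^sup>2 * (norm z)\<^sup>2 - 2 * t * (z \<bullet> x) + (norm x)\<^sup>2" for t z
    unfolding power2_norm_eq_inner
    by (simp add: inner_diff_left inner_diff_right inner_commute power2_eq_square algebra_simps)
  let ?g = "\<lambda>t z. - (t * (norm z)\<^sup>2 - z \<bullet> x) * gauss (t *\<^sub>R z - x) * u z"
  let ?w = "\<lambda>z::real^'n. ((2 + norm x) * E * C) * ((1 + norm z) ^ (2 + nat \<lceil>l\<rceil>) * exp (- (1/16) * (norm z)\<^sup>2))"
  have bd: "\<bar>c * gauss (t *\<^sub>R z - x) * u z\<bar> \<le> (K * E * C) * ((1 + norm z) ^ (N + nat \<lceil>l\<rceil>) * exp (- (1/16) * (norm z)\<^sup>2))"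
    if t: "\<bar>t - 1\<bar> < 1/2" and c: "\<bar>c\<bar> \<le> K * (1 + norm z) ^ N" "K \<ge> 0" for c t z K N
  proof -
    have "\<bar>c\<bar> * gauss (t *\<^sub>R z - x) * \<bar>u z\<bar>
      \<le> (K * (1 + norm z) ^ N) * (E * exp (- (1/16) * (norm z)\<^sup>2)) * (C * (1 + norm z) ^ nat \<lceil>l\<rceil>)"
      using gb[OF t, of z] c C E unfolding E_def by (intro mult_mono) auto
    then show ?thesis by (simp add: abs_mult power_add mult_ac)
  qed
  have "(\<Phi> has_real_derivative (\<integral>z. ?g 1 z \<partial>lborel)) (at 1)"
    unfolding \<Phi>_def[abs_def]
  proof (rule integral_has_real_derivative_dominated[where d = "1/2" and w = ?w])
    show "integrable lborel ?w"
      by (rule integrable_gaussian_bound[where c = "1/16" and C = "(2 + norm x) * E * C" and N = "2 + nat \<lceil>l\<rceil>"])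
        (use E C in \<open>auto simp: abs_mult\<close>)
    fix t :: real assume t: "\<bar>t - 1\<bar> < 1/2"
    show "integrable lborel (\<lambda>z. gauss (t *\<^sub>R z - x) * u z)"
    proof (rule integrable_gaussian_bound)
      show "\<bar>gauss (t *\<^sub>R z - x) * u z\<bar> \<le> (1 * E * C) * ((1 + norm z) ^ (0 + nat \<lceil>l\<rceil>) * exp (- (1/16) * (norm z)\<^sup>2))" for z
        using bd[OF t, of 1 1 z 0] by simp
    qed auto
    fix z :: "real^'n"
    show "((\<lambda>t. gauss (t *\<^sub>R z - x) * u z) has_real_derivative ?g t z) (at t)"
      unfolding nt by (auto intro!: derivative_eq_intros simp: field_simps)
    show "\<bar>?g t z\<bar> \<le> ?w z"
    proof (rule bd[OF t])
      have "\<bar>z \<bullet> x\<bar> \<le> norm z * norm x" by (rule Cauchy_Schwarz_ineq2)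
      moreover have "\<bar>t * (norm z)\<^sup>2\<bar> \<le> 2 * (norm z)\<^sup>2"
      proof -
        have "\<bar>t\<bar> \<le> 2" using t by linarith
        then show ?thesis unfolding abs_mult by (intro mult_mono) auto
      qed
      ultimately have "\<bar>- (t * (norm z)\<^sup>2 - z \<bullet> x)\<bar> \<le> 2 * (norm z)\<^sup>2 + norm z * norm x" by linarith
      also have "\<dots> \<le> (2 + norm x) * (1 + norm z)\<^sup>2"
        by (simp add: power2_sum algebra_simps)
      finally show "\<bar>- (t * (norm z)\<^sup>2 - z \<bullet> x)\<bar> \<le> (2 + norm x) * (1 + norm z) ^ 2" .
    qed simp
  qed auto
  moreover have "(\<Phi> has_real_derivative - (real CARD('n) + l) * mollified x) (at 1)"
  proof (rule has_field_derivative_transform_within_open[where S = "{0<..}"])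
    show "((\<lambda>t. t powr (- (real CARD('n) + l)) * mollified x) has_real_derivative - (real CARD('n) + l) * mollified x) (at 1)"
      by (auto intro!: derivative_eq_intros)
  qed (use \<Phi> in auto)
  ultimately have "(\<integral>z. ?g 1 z \<partial>lborel) = - (real CARD('n) + l) * mollified x" by (rule DERIV_unique)
  moreover have "?g 1 z = - ((z \<bullet> (z - x)) * gauss (z - x) * u z)" for z
  proof -
    have "1 * (norm z)\<^sup>2 - z \<bullet> x = z \<bullet> (z - x)" by (simp add: inner_diff_right power2_norm_eq_inner)
    then show ?thesis by (simp only: scaleR_one mult_minus_left)
  qed
  ultimately have "- (\<integral>z. (z \<bullet> (z - x)) * gauss (z - x) * u z \<partial>lborel) = - (real CARD('n) + l) * mollified x"
    by (simp only: Bochner_Integration.integral_minus)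
  then show ?thesis by (simp only: mult_minus_left neg_equal_iff_equal)
qed

text \<open>Under the integral the Laplacian contributes the weight
  \<open>(norm (z - x))^2 - n\<close> and the drift contributes \<open>x \<bullet> (z - x)\<close>.
  Their sum \<open>z \<bullet> (z - x) - n\<close> is exactly what the scaling identity evaluates,
  leaving \<open>(n + l) - n = l\<close>.\<close>

lemma mollified_equation:
  "(\<Sum>i\<in>UNIV. mollified2 i x) + (\<Sum>i\<in>UNIV. x $ i * mollified1 i x) = l * mollified x"
proof -
  have cb: "\<bar>z $ i - x $ i\<bar> \<le> (2 + norm x) * (1 + norm z)" for z i
    using coord_diff_bound[of 0 z i x] by simp
  have i1: "integrable lborel (\<lambda>z. (z $ i - x $ i) * gauss (z - x) * u z)" for i
    by (rule shifted_integrable[where K = "2 + norm x" and N = 1]) (use cb in auto)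
  have i2: "integrable lborel (\<lambda>z. ((z $ i - x $ i)\<^sup>2 - 1) * gauss (z - x) * u z)" for i
  proof (rule shifted_integrable[where K = "(2 + norm x)\<^sup>2 + 1" and N = 2])
    fix z :: "real^'n"
    have "\<bar>(z $ i - x $ i)\<^sup>2 - 1\<bar> \<le> (z $ i - x $ i)\<^sup>2 + 1"
      using zero_le_power2[of "z $ i - x $ i"] by linarith
    also have "\<dots> \<le> ((2 + norm x) * (1 + norm z))\<^sup>2 + 1"
      using power_mono[OF cb, of z i 2] by simp
    also have "\<dots> = (2 + norm x)\<^sup>2 * (1 + norm z)\<^sup>2 + 1" by (simp only: power_mult_distrib)
    also have "\<dots> \<le> (2 + norm x)\<^sup>2 * (1 + norm z)\<^sup>2 + 1 * (1 + norm z)\<^sup>2" by simp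
    also have "\<dots> = ((2 + norm x)\<^sup>2 + 1) * (1 + norm z) ^ 2" by (simp only: distrib_right)
    finally show "\<bar>(z $ i - x $ i)\<^sup>2 - 1\<bar> \<le> ((2 + norm x)\<^sup>2 + 1) * (1 + norm z) ^ 2" .
  qed auto
  have i0: "integrable lborel (\<lambda>z. gauss (z - x) * u z)"
    using shifted_integrable[of "\<lambda>_. 1" 1 0 x] by simp
  have "(\<Sum>i\<in>UNIV. mollified2 i x) + (\<Sum>i\<in>UNIV. x $ i * mollified1 i x)
    = (\<integral>z. (\<Sum>i\<in>UNIV. ((z $ i - x $ i)\<^sup>2 - 1) * gauss (z - x) * u z) + (\<Sum>i\<in>UNIV. x $ i * ((z $ i - x $ i) * gauss (z - x) * u z)) \<partial>lborel)"
    unfolding mollified1_def mollified2_def using i1 i2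
    by (subst Bochner_Integration.integral_add) (auto intro!: Bochner_Integration.integrable_sum integrable_mult_right)
  also have "\<dots> = (\<integral>z. (z \<bullet> (z - x)) * gauss (z - x) * u z - real CARD('n) * (gauss (z - x) * u z) \<partial>lborel)"
  proof (rule Bochner_Integration.integral_cong[OF refl])
    fix z :: "real^'n"
    have "(\<Sum>i\<in>UNIV. ((z $ i - x $ i)\<^sup>2 - 1) * gauss (z - x) * u z) + (\<Sum>i\<in>UNIV. x $ i * ((z $ i - x $ i) * gauss (z - x) * u z))
      = (\<Sum>i\<in>UNIV. z $ i * (z $ i - x $ i) - 1) * (gauss (z - x) * u z)"
      unfolding sum.distrib[symmetric] sum_distrib_right
      by (intro sum.cong refl) (simp add: power2_eq_square algebra_simps)
    also have "(\<Sum>i\<in>UNIV. z $ i * (z $ i - x $ i) - 1) = z \<bullet> (z - x) - real CARD('n)"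
      by (simp add: inner_vec_def sum_subtractf)
    finally show "(\<Sum>i\<in>UNIV. ((z $ i - x $ i)\<^sup>2 - 1) * gauss (z - x) * u z) + (\<Sum>i\<in>UNIV. x $ i * ((z $ i - x $ i) * gauss (z - x) * u z))
      = (z \<bullet> (z - x)) * gauss (z - x) * u z - real CARD('n) * (gauss (z - x) * u z)"
      by (simp add: left_diff_distrib mult.assoc)
  qed
  also have "\<dots> = (\<integral>z. (z \<bullet> (z - x)) * gauss (z - x) * u z \<partial>lborel) - real CARD('n) * mollified x"
  proof -
    have "integrable lborel (\<lambda>z. (z \<bullet> (z - x)) * gauss (z - x) * u z)"
    proof (rule shifted_integrable[where K = "1 + norm x" and N = 2])
      fix z :: "real^'n"
      have "\<bar>z \<bullet> (z - x)\<bar> \<le> norm z * norm (z - x)" by (rule Cauchy_Schwarz_ineq2)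
      also have "\<dots> \<le> norm z * (norm z + norm x)" by (intro mult_left_mono norm_triangle_ineq4) auto
      also have "\<dots> \<le> (1 + norm x) * (1 + norm z) ^ 2" by (simp add: power2_sum power2_eq_square algebra_simps)
      finally show "\<bar>z \<bullet> (z - x)\<bar> \<le> (1 + norm x) * (1 + norm z) ^ 2" .
    qed auto
    then show ?thesis using i0 by (simp add: mollified_def)
  qed
  also have "\<dots> = l * mollified x" unfolding mollified_scaling by (simp add: algebra_simps)
  finally show ?thesis .
qed

lemma mollified_cont: "continuous_on UNIV mollified"
  unfolding continuous_on_sequentially comp_def
proof (intro allI ballI impI)
  fix X :: "nat \<Rightarrow> real^'n" and a assume "(\<forall>n. X n \<in> UNIV) \<and> X \<longlonglongrightarrow> a"
  then have X: "X \<longlonglongrightarrow> a" by simp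
  then have "bounded (range X)" by (rule convergent_imp_bounded)
  then obtain R where R: "\<And>j. norm (X j) \<le> R" by (auto simp: bounded_iff)
  obtain C where C: "C > 0" "\<And>x. \<bar>u x\<bar> \<le> C * (1 + norm x) ^ nat \<lceil>l\<rceil>" using u_bound by blast
  let ?w = "\<lambda>z::real^'n. (1 * exp (R\<^sup>2 / 2) * C) * ((1 + norm z) ^ (0 + nat \<lceil>l\<rceil>) * exp (- (1/4) * (norm z)\<^sup>2))"
  show "(\<lambda>j. mollified (X j)) \<longlonglongrightarrow> mollified a"
    unfolding mollified_def
  proof (rule integral_dominated_convergence[where w = ?w])
    show "integrable lborel ?w"
      by (rule integrable_gaussian_bound[where c = "1/4" and C = "1 * exp (R\<^sup>2 / 2) * C" and N = "0 + nat \<lceil>l\<rceil>"])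
        (use C in \<open>auto simp: abs_mult\<close>)
    show "AE z in lborel. (\<lambda>j. gauss (z - X j) * u z) \<longlonglongrightarrow> gauss (z - a) * u z"
      by (intro AE_I2 tendsto_intros X) simp
    show "AE z in lborel. norm (gauss (z - X j) * u z) \<le> ?w z" for j
    proof (rule AE_I2)
      fix z
      show "norm (gauss (z - X j) * u z) \<le> ?w z"
        using shifted_bound[OF R, of 1 1 z 0 C "nat \<lceil>l\<rceil>" j] C by simp
    qed
  qed auto
qed

lemma mollified_reflect: "mollified (thin_reflection m x) = mollified x"
proof -
  have nr: "norm (scale_coord m (-1) z - scale_coord m (-1) x) = norm (z - x)" for z x :: "real^'n"
    unfolding norm_vec_def L2_set_def
    by (intro arg_cong[where f = sqrt] sum.cong) (auto simp: scale_coord_nth power2_commute)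
  have "mollified (scale_coord m (-1) x)
    = \<bar>-1\<bar> * (\<integral>z. gauss (scale_coord m (-1) z - scale_coord m (-1) x) * u (scale_coord m (-1) z) \<partial>lborel)"
    unfolding mollified_def by (rule integral_scale_coord) auto
  also have "\<dots> = mollified x"
    by (simp add: nr mollified_def u_reflect[unfolded thin_reflection_eq_scale_coord])
  finally show ?thesis by (simp add: thin_reflection_eq_scale_coord)
qed

text \<open>An even differentiable function has zero normal derivative on the thin space. In the
  comparison the sign of \<open>u\<^sub>n\<close> is therefore not disturbed by the average.\<close>

lemma mollified1_thin:
  assumes "x $ m = 0"
  shows "mollified1 m x = 0"
proof -
  have "thin_reflection m (x + r *\<^sub>R axis m 1) = x + (- r) *\<^sub>R axis m 1" for r
    using assms by (auto simp: thin_reflection_def vec_eq_iff axis_def)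
  then have e: "mollified (x + (- r) *\<^sub>R axis m 1) = mollified (x + r *\<^sub>R axis m 1)" for r
    by (metis mollified_reflect)
  have "((\<lambda>r. mollified (x + (- r) *\<^sub>R axis m 1)) has_real_derivative mollified1 m x * (- 1)) (at 0)"
    by (rule DERIV_chain2[where f = "\<lambda>r. mollified (x + r *\<^sub>R axis m 1)" and g = uminus])
      (use mollified_deriv[of x m] in \<open>auto intro!: derivative_eq_intros\<close>)
  then have "((\<lambda>r. mollified (x + r *\<^sub>R axis m 1)) has_real_derivative mollified1 m x * (- 1)) (at 0)"
    unfolding e .
  then have "mollified1 m x * (- 1) = mollified1 m x" using mollified_deriv by (rule DERIV_unique)
  then show ?thesis by simp
qed

end

section \<open>Comparison with the Gaussian average\<close>

context homogeneous_thin_solution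
begin

definition gmass :: real where "gmass = (\<integral>z. gauss z \<partial>lborel)"

lemma gauss_integrable: "integrable lborel gauss"
  using gaussian_integrable[of "1/2", where 'a = "real^'n"] by simp

lemma gmass_pos: "gmass > 0"
proof -
  have "gmass \<ge> 0" unfolding gmass_def by (intro Bochner_Integration.integral_nonneg) simp
  moreover have "gmass \<noteq> 0"
  proof
    assume "gmass = 0"
    then have "AE z in lborel. gauss z = 0"
      using integral_nonneg_eq_0_iff_AE[OF gauss_integrable] by (simp add: gmass_def)
    then have "AE z in (lborel :: (real^'n) measure). False" by simp
    then show False by (simp add: AE_iff_measurable[OF _ refl])
  qed
  ultimately show ?thesis by simp
qed

definition gauss_average :: "real ^ 'n \<Rightarrow> real" where "gauss_average x = mollified x / gmass"

lemma mollified_translate: "mollified x = (\<integral>z. gauss z * u (x + z) \<partial>lborel)"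
proof -
  have "mollified x = (\<integral>z. gauss (x + z - x) * u (x + z) \<partial>lborel)"
    unfolding mollified_def by (rule integral_translate_lborel[symmetric]) simp
  then show ?thesis by simp
qed

text \<open>Division by \<open>norm x\<close> brings \<open>x\<close> to the unit sphere and shrinks
  the Gaussian to width \<open>1 / norm x\<close>. Displacements below \<open>d\<close> are
  controlled by uniform continuity of \<open>u\<close> on a compact ball; larger ones carry little
  Gaussian mass.\<close>

lemma u_minus_gauss_average_small:
  assumes tau: "\<tau> > 0"
  obtains R where "R > 0" "\<And>x. norm x \<ge> R \<Longrightarrow> \<bar>u x - gauss_average x\<bar> \<le> \<tau> * norm x powr l"
proof -
  obtain C where C: "C > 0" "\<And>x. \<bar>u x\<bar> \<le> C * (1 + norm x) ^ nat \<lceil>l\<rceil>" using u_bound by blast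
  have "uniformly_continuous_on (cball 0 2) u"
    by (intro compact_uniformly_continuous continuous_on_subset[OF u_cont]) auto
  then obtain d0 where d0: "d0 > 0" "\<And>a b. a \<in> cball 0 2 \<Longrightarrow> b \<in> cball 0 2 \<Longrightarrow> dist b a < d0 \<Longrightarrow> dist (u b) (u a) < \<tau> / 2"
    using uniformly_continuous_onE[OF _ half_gt_zero[OF tau]] by metis
  define d where "d = min d0 1"
  have d: "d > 0" "d \<le> 1" "d \<le> d0" using d0(1) by (auto simp: d_def)
  let ?L = "nat \<lceil>l\<rceil>"
  define K where "K = C * 2 ^ ?L + C * 2 ^ ?L"
  have K: "K > 0" using C(1) by (simp add: K_def)
  let ?p = "\<lambda>z::real^'n. (1 + norm z) ^ Suc ?L"
  define M where "M = (\<integral>z. gauss z * ?p z \<partial>lborel)"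
  have ip: "integrable lborel (\<lambda>z. gauss z * ?p z)"
    by (rule integrable_gaussian_bound[where c = "1/2" and C = 1 and N = "Suc ?L"]) (auto simp: abs_mult)
  have M: "M \<ge> 0" unfolding M_def by (intro Bochner_Integration.integral_nonneg) simp
  have iu: "integrable lborel (\<lambda>z. gauss z * u (x + z))" for x
  proof (rule integrable_gaussian_bound)
    fix z :: "real^'n"
    have "(1 + norm (x + z)) ^ ?L \<le> ((1 + norm x) * (1 + norm z)) ^ ?L"
    proof (rule power_mono)
      have "(1 + norm x) * (1 + norm z) = 1 + norm x + norm z + norm x * norm z" by (simp add: algebra_simps)
      moreover have "0 \<le> norm x * norm z" by simp
      ultimately show "1 + norm (x + z) \<le> (1 + norm x) * (1 + norm z)"
        using norm_triangle_ineq[of x z] by linarith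
    qed simp
    then have "C * (1 + norm (x + z)) ^ ?L \<le> C * ((1 + norm x) ^ ?L * (1 + norm z) ^ ?L)"
      using C(1) by (simp add: power_mult_distrib)
    then have "\<bar>u (x + z)\<bar> \<le> C * ((1 + norm x) ^ ?L * (1 + norm z) ^ ?L)" by (rule order_trans[OF C(2)])
    then have "gauss z * \<bar>u (x + z)\<bar> \<le> gauss z * (C * ((1 + norm x) ^ ?L * (1 + norm z) ^ ?L))"
      by (rule mult_left_mono) simp
    then show "\<bar>gauss z * u (x + z)\<bar> \<le> (C * (1 + norm x) ^ ?L) * ((1 + norm z) ^ ?L * exp (- (1/2) * (norm z)\<^sup>2))"
      by (simp add: abs_mult mult_ac)
  qed auto
  have main: "\<bar>u x - gauss_average x\<bar> \<le> norm x powr l * (\<tau> / 2 + K * M / (d * gmass) / norm x)" if x: "norm x \<ge> 1" for x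
  proof -
    let ?r = "norm x"
    have r: "?r > 0" using x by linarith
    have pw: "\<bar>u x - u (x + z)\<bar> \<le> ?r powr l * (\<tau> / 2 + K / (d * ?r) * ?p z)" for z
    proof -
      define a where "a = x /\<^sub>R ?r"
      define b where "b = z /\<^sub>R ?r"
      have na: "norm a = 1" using r by (simp add: a_def)
      have nb: "norm b = norm z / ?r" by (simp add: b_def divide_inverse_commute)
      have "u x = ?r powr l * u a" using u_scale[of ?r a] r by (simp add: a_def)
      moreover have "u (x + z) = ?r powr l * u (a + b)"
        using u_scale[of ?r "a + b"] r by (simp add: a_def b_def scaleR_add_right)
      ultimately have eq: "\<bar>u x - u (x + z)\<bar> = ?r powr l * \<bar>u a - u (a + b)\<bar>"
        by (simp add: abs_mult flip: right_diff_distrib)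
      have "\<bar>u a - u (a + b)\<bar> \<le> \<tau> / 2 + K / (d * ?r) * ?p z"
      proof (cases "norm b < d")
        case True
        have "norm (a + b) \<le> 2" using norm_triangle_ineq[of a b] na True d by linarith
        moreover have "dist (a + b) a < d0" using True d by (simp add: dist_norm)
        ultimately have "dist (u (a + b)) (u a) < \<tau> / 2"
          using na by (intro d0(2)) simp_all
        moreover have "K / (d * ?r) * ?p z \<ge> 0" using K d r by simp
        ultimately show ?thesis unfolding dist_real_def by linarith
      next
        case False
        \<comment> \<open>A rescaled displacement of at least \<open>d\<close> makes this quotient
          at least 1. Inserting it as a factor costs one more power of \<open>1 + norm z\<close>,
          hence the exponent \<open>Suc ?L\<close>, and gains the decay
          \<open>1 / ?r\<close>.\<close>
        then have "1 \<le> norm z / (d * ?r)" using d r nb by (simp add: field_simps)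
        also have "\<dots> \<le> (1 + norm z) / (d * ?r)" using d r by (intro divide_right_mono) auto
        finally have big: "1 \<le> (1 + norm z) / (d * ?r)" .
        have nbz: "norm b \<le> norm z" unfolding nb using frac_le[of "norm z" "norm z" 1 "norm x"] x by simp
        have "\<bar>u a\<bar> \<le> C * 2 ^ ?L * (1 + norm z) ^ ?L"
        proof -
          have "\<bar>u a\<bar> \<le> C * 2 ^ ?L * 1" using C(2)[of a] na by simp
          also have "\<dots> \<le> C * 2 ^ ?L * (1 + norm z) ^ ?L"
            using C(1) by (intro mult_left_mono one_le_power) auto
          finally show ?thesis .
        qed
        moreover have "\<bar>u (a + b)\<bar> \<le> C * 2 ^ ?L * (1 + norm z) ^ ?L"
        proof -
          have "norm (a + b) \<le> 1 + norm z" using norm_triangle_ineq[of a b] na nbz by linarith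
          then have "1 + norm (a + b) \<le> 1 + (1 + norm z)" by simp
          also have "\<dots> \<le> 2 * (1 + norm z)" by simp
          finally have "1 + norm (a + b) \<le> 2 * (1 + norm z)" .
          then have "(1 + norm (a + b)) ^ ?L \<le> (2 * (1 + norm z)) ^ ?L" by (intro power_mono) auto
          then have "C * (1 + norm (a + b)) ^ ?L \<le> C * (2 * (1 + norm z)) ^ ?L" using C(1) by (intro mult_left_mono) auto
          also have "\<dots> = C * 2 ^ ?L * (1 + norm z) ^ ?L" by (simp only: power_mult_distrib mult.assoc)
          finally show ?thesis by (rule order_trans[OF C(2)])
        qed
        ultimately have "\<bar>u a - u (a + b)\<bar> \<le> C * 2 ^ ?L * (1 + norm z) ^ ?L + C * 2 ^ ?L * (1 + norm z) ^ ?L" by linarith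
        also have "\<dots> = K * (1 + norm z) ^ ?L * 1" by (simp add: K_def algebra_simps)
        also have "\<dots> \<le> K * (1 + norm z) ^ ?L * ((1 + norm z) / (d * ?r))"
          using big K by (intro mult_left_mono) auto
        also have "\<dots> = K / (d * ?r) * ?p z" by (simp add: mult_ac)
        finally show ?thesis using tau by linarith
      qed
      then show ?thesis unfolding eq by (rule mult_left_mono) simp
    qed
    have E1: "gmass * (u x - gauss_average x) = (\<integral>z. gauss z * (u x - u (x + z)) \<partial>lborel)"
    proof -
      have "(\<integral>z. gauss z * (u x - u (x + z)) \<partial>lborel) = (\<integral>z. gauss z * u x - gauss z * u (x + z) \<partial>lborel)"
        by (simp add: right_diff_distrib)
      also have "\<dots> = (\<integral>z. gauss z * u x \<partial>lborel) - (\<integral>z. gauss z * u (x + z) \<partial>lborel)"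
        by (rule Bochner_Integration.integral_diff[OF integrable_mult_left[OF gauss_integrable] iu])
      also have "(\<integral>z. gauss z * u x \<partial>lborel) = gmass * u x" by (simp add: gmass_def)
      also have "(\<integral>z. gauss z * u (x + z) \<partial>lborel) = mollified x" by (simp add: mollified_translate)
      finally show ?thesis using gmass_pos by (simp add: gauss_average_def right_diff_distrib)
    qed
    have E2: "\<bar>\<integral>z. gauss z * (u x - u (x + z)) \<partial>lborel\<bar>
      \<le> (\<integral>z. ?r powr l * (\<tau> / 2) * gauss z + ?r powr l * (K / (d * ?r)) * (gauss z * ?p z) \<partial>lborel)"
    proof (rule order_trans[OF integral_abs_bound integral_mono])
      have "integrable lborel (\<lambda>z. gauss z * u x - gauss z * u (x + z))"
        by (rule Bochner_Integration.integrable_diff[OF integrable_mult_left[OF gauss_integrable] iu])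
      then show "integrable lborel (\<lambda>z. \<bar>gauss z * (u x - u (x + z))\<bar>)"
        by (simp only: right_diff_distrib) (rule integrable_abs)
      show "integrable lborel (\<lambda>z. ?r powr l * (\<tau> / 2) * gauss z + ?r powr l * (K / (d * ?r)) * (gauss z * ?p z))"
        by (rule Bochner_Integration.integrable_add[OF integrable_mult_right[OF gauss_integrable] integrable_mult_right[OF ip]])
      fix z
      have "gauss z * \<bar>u x - u (x + z)\<bar> \<le> gauss z * (?r powr l * (\<tau> / 2 + K / (d * ?r) * ?p z))"
        using pw by (rule mult_left_mono) simp
      then show "\<bar>gauss z * (u x - u (x + z))\<bar> \<le> ?r powr l * (\<tau> / 2) * gauss z + ?r powr l * (K / (d * ?r)) * (gauss z * ?p z)"
        by (simp only: abs_mult abs_exp_cancel distrib_left mult_ac)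
    qed
    note E2
    also have "(\<integral>z. ?r powr l * (\<tau> / 2) * gauss z + ?r powr l * (K / (d * ?r)) * (gauss z * ?p z) \<partial>lborel)
      = ?r powr l * (\<tau> / 2) * gmass + ?r powr l * (K / (d * ?r)) * M"
      unfolding gmass_def M_def
      by (subst Bochner_Integration.integral_add[OF integrable_mult_right[OF gauss_integrable] integrable_mult_right[OF ip]]) simp
    also have "\<dots> = gmass * (?r powr l * (\<tau> / 2 + K * M / (d * gmass) / ?r))"
      using gmass_pos d r by (simp add: field_simps)
    finally have "\<bar>gmass * (u x - gauss_average x)\<bar> \<le> gmass * (?r powr l * (\<tau> / 2 + K * M / (d * gmass) / ?r))"
      unfolding E1 .
    then have "gmass * \<bar>u x - gauss_average x\<bar> \<le> gmass * (?r powr l * (\<tau> / 2 + K * M / (d * gmass) / ?r))"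
      unfolding abs_mult abs_of_pos[OF gmass_pos] .
    then show ?thesis using gmass_pos by simp
  qed
  define B where "B = K * M / (d * gmass)"
  have B: "B \<ge> 0" using K M d gmass_pos by (simp add: B_def)
  have "\<bar>u x - gauss_average x\<bar> \<le> \<tau> * norm x powr l" if x: "norm x \<ge> 1 + 2 * B / \<tau>" for x
  proof -
    have "2 * B / \<tau> \<ge> 0" using B tau by simp
    then have x1: "norm x \<ge> 1" using x by linarith
    have "2 * B / \<tau> \<le> norm x" using x by linarith
    moreover have "norm x > 0" using x1 by linarith
    ultimately have "B / norm x \<le> \<tau> / 2" using tau by (simp add: field_simps)
    then have "\<tau> / 2 + B / norm x \<le> \<tau>" by linarith
    then have "norm x powr l * (\<tau> / 2 + B / norm x) \<le> norm x powr l * \<tau>"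
      by (rule mult_left_mono) simp
    then show ?thesis using main[OF x1] unfolding B_def by (simp add: mult.commute)
  qed
  moreover have "1 + 2 * B / \<tau> > 0" using B tau by (simp add: add_pos_nonneg)
  ultimately show ?thesis using that by blast
qed

text \<open>A strict supersolution of \<open>\<Delta>q + x \<cdot> \<nabla>q - l q = 0\<close> in the half-space, growing like \<open>|x| powr l\<close>
  and with negative normal derivative on the thin space.\<close>

definition barK :: real where "barK = 1 + real CARD('n) + 2 * \<bar>l / 2 - 1\<bar>"
definition bar0 :: "real ^ 'n \<Rightarrow> real" where "bar0 x = barK + (norm x)\<^sup>2 + exp (- x $ m)"
definition barrier :: "real ^ 'n \<Rightarrow> real" where "barrier x = bar0 x powr (l / 2)"
definition bar1 :: "'n \<Rightarrow> real ^ 'n \<Rightarrow> real" where "bar1 i x = 2 * x $ i - of_bool (i = m) * exp (- x $ m)"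
definition barrier1 :: "'n \<Rightarrow> real ^ 'n \<Rightarrow> real" where
  "barrier1 i x = l / 2 * bar0 x powr (l / 2 - 1) * bar1 i x"
definition barrier2 :: "'n \<Rightarrow> real ^ 'n \<Rightarrow> real" where
  "barrier2 i x = l / 2 * ((l / 2 - 1) * bar0 x powr (l / 2 - 2) * bar1 i x * bar1 i x
     + bar0 x powr (l / 2 - 1) * (2 + of_bool (i = m) * exp (- x $ m)))"

lemma barK_ge: "barK \<ge> 1" by (simp add: barK_def)

lemma bar0_pos: "bar0 x > 0"
  using barK_ge unfolding bar0_def by (intro add_pos_pos add_pos_nonneg) auto

lemma bar0_deriv: "((\<lambda>r. bar0 (x + r *\<^sub>R axis i 1)) has_real_derivative bar1 i x) (at 0)"
  unfolding bar0_def bar1_def norm_axis_line coord_axis_line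
  by (auto intro!: derivative_eq_intros)

lemma bar1_deriv: "((\<lambda>r. bar1 i (x + r *\<^sub>R axis i 1)) has_real_derivative 2 + of_bool (i = m) * exp (- x $ m)) (at 0)"
  unfolding bar1_def coord_axis_line
  by (auto intro!: derivative_eq_intros)

lemma bar0_powr_deriv:
  "((\<lambda>r. bar0 (x + r *\<^sub>R axis i 1) powr a) has_real_derivative a * bar0 x powr (a - 1) * bar1 i x) (at 0)"
  using DERIV_fun_powr[OF bar0_deriv, of x i a] bar0_pos[of x] by simp

lemma barrier_deriv: "((\<lambda>r. barrier (x + r *\<^sub>R axis i 1)) has_real_derivative barrier1 i x) (at 0)"
  unfolding barrier_def barrier1_def by (rule bar0_powr_deriv)

lemma barrier1_deriv: "((\<lambda>r. barrier1 i (x + r *\<^sub>R axis i 1)) has_real_derivative barrier2 i x) (at 0)"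
proof -
  have e: "l / 2 - 2 = l / 2 - 1 - 1" by simp
  show ?thesis unfolding barrier1_def barrier2_def e
    by (rule derivative_eq_intros bar0_powr_deriv bar1_deriv refl)+ (simp add: algebra_simps)
qed

lemma barrier_cont: "continuous_on UNIV barrier"
  unfolding barrier_def[abs_def] using bar0_pos
  by (intro continuous_intros) (auto simp: bar0_def[abs_def] less_imp_neq[symmetric] intro!: continuous_intros)

lemma barrier_ge: "norm x powr l \<le> barrier x"
proof -
  have "norm x powr l = ((norm x)\<^sup>2) powr (l / 2)"
  proof (cases "x = 0")
    case False
    then have "(norm x)\<^sup>2 = norm x powr 2" by simp
    then have "((norm x)\<^sup>2) powr (l / 2) = norm x powr (2 * (l / 2))" by (simp only: powr_powr)
    then show ?thesis by simp
  qed simp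
  also have "\<dots> \<le> barrier x"
    unfolding barrier_def bar0_def using l_pos barK_ge by (intro powr_mono2) auto
  finally show ?thesis .
qed

text \<open>With \<open>\<rho> = bar0 x\<close>, the left side minus the right side is
  \<open>l / 2 * \<rho> powr (l / 2 - 1)\<close> times \<open>(l / 2 - 1) |\<nabla>\<rho>|^2 /
  \<rho> + \<Delta>\<rho> + x \<cdot> \<nabla>\<rho> - 2 \<rho>\<close>. The quadratic parts of the
  last two terms cancel, and \<open>|\<nabla>\<rho>|^2 \<le> 4 \<rho>\<close>, so a large constant
  in \<open>\<rho>\<close> decides the sign.\<close>

lemma barrier_supersolution:
  assumes x: "x $ m \<ge> 0"
  shows "(\<Sum>i\<in>UNIV. barrier2 i x) + (\<Sum>i\<in>UNIV. x $ i * barrier1 i x) < l * barrier x"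
proof -
  let ?E = "exp (- x $ m)" and ?\<rho> = "bar0 x" and ?P = "bar0 x powr (l / 2 - 1)"
  have E: "0 < ?E" "?E \<le> 1" using x by auto
  have P: "?P > 0" using bar0_pos[of x] by simp
  have nx: "(norm x)\<^sup>2 = (\<Sum>i\<in>UNIV. x $ i * x $ i)"
    by (simp add: power2_norm_eq_inner inner_vec_def)
  have p2: "bar0 x powr (l / 2 - 2) = ?P / ?\<rho>"
    using bar0_pos[of x] powr_diff[of ?\<rho> "l / 2 - 1" 1] by simp
  have p0: "barrier x = ?P * ?\<rho>"
    unfolding barrier_def using bar0_pos[of x] powr_add[of ?\<rho> "l / 2 - 1" 1] by simp
  have s1: "(\<Sum>i\<in>UNIV. bar1 i x * bar1 i x) = 4 * (norm x)\<^sup>2 - 4 * x $ m * ?E + ?E\<^sup>2"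
  proof -
    have "(\<Sum>i\<in>UNIV. bar1 i x * bar1 i x) = (\<Sum>i\<in>UNIV. 4 * (x $ i * x $ i) + (if i = m then ?E\<^sup>2 - 4 * x $ m * ?E else 0))"
      by (intro sum.cong refl) (auto simp: bar1_def power2_eq_square algebra_simps)
    then show ?thesis by (simp add: sum.distrib nx sum_distrib_left)
  qed
  have s2: "(\<Sum>i\<in>UNIV. 2 + of_bool (i = m) * ?E) = 2 * real CARD('n) + ?E"
  proof -
    have "(\<Sum>i\<in>(UNIV::'n set). 2 + of_bool (i = m) * ?E) = (\<Sum>i\<in>(UNIV::'n set). 2 + (if i = m then ?E else 0))"
      by (intro sum.cong) auto
    then show ?thesis by (simp add: sum.distrib)
  qed
  have s3: "(\<Sum>i\<in>UNIV. x $ i * bar1 i x) = 2 * (norm x)\<^sup>2 - x $ m * ?E"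
  proof -
    have "(\<Sum>i\<in>UNIV. x $ i * bar1 i x) = (\<Sum>i\<in>UNIV. 2 * (x $ i * x $ i) + (if i = m then - (x $ m * ?E) else 0))"
      by (intro sum.cong refl) (auto simp: bar1_def algebra_simps)
    then show ?thesis by (simp add: sum.distrib nx sum_distrib_left)
  qed
  define S where "S = 4 * (norm x)\<^sup>2 - 4 * x $ m * ?E + ?E\<^sup>2"
  have S0: "0 \<le> S" unfolding S_def s1[symmetric] by (intro sum_nonneg) simp
  have "S \<le> 4 * ?\<rho>"
  proof -
    have "?E\<^sup>2 \<le> 1" using E by (simp add: power_le_one)
    moreover have "0 \<le> 4 * x $ m * ?E" using x by simp
    moreover have "4 * a - c + q \<le> 4 * (K + a + e)" if "q \<le> 1" "0 \<le> c" "1 \<le> K" "0 < e" for a c q K e :: real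
      using that by simp
    ultimately show ?thesis using barK_ge E(1) unfolding S_def bar0_def by blast
  qed
  then have Sr: "S / ?\<rho> \<le> 4" "0 \<le> S / ?\<rho>" using bar0_pos[of x] S0 by (auto simp: divide_le_eq)
  have rho: "?\<rho> = 1 + real CARD('n) + 2 * \<bar>l / 2 - 1\<bar> + (norm x)\<^sup>2 + ?E"
    by (simp add: bar0_def barK_def)
  have "(l / 2 - 1) * (S / ?\<rho>) \<le> \<bar>l / 2 - 1\<bar> * 4" using Sr by (intro mult_mono) auto
  moreover have "0 \<le> x $ m * ?E" using x by simp
  \<comment> \<open>Here the constant \<open>barK\<close> is explained: \<open>2 * ?\<rho>\<close>
    contains \<open>4 * \<bar>l / 2 - 1\<bar>\<close> against the gradient term and twice the
    dimension against the Laplacian of \<open>(norm x)^2\<close>; the summand 1 of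
    \<open>barK\<close> leaves room for strictness.\<close>
  ultimately have neg: "(l / 2 - 1) * (S / ?\<rho>) + (2 * real CARD('n) + ?E) + (2 * (norm x)\<^sup>2 - x $ m * ?E) - 2 * ?\<rho> < 0"
    using E rho by linarith
  have "(\<Sum>i\<in>UNIV. barrier2 i x) + (\<Sum>i\<in>UNIV. x $ i * barrier1 i x)
    = l / 2 * ((l / 2 - 1) * (?P / ?\<rho>) * (\<Sum>i\<in>UNIV. bar1 i x * bar1 i x) + ?P * (\<Sum>i\<in>UNIV. 2 + of_bool (i = m) * ?E))
      + l / 2 * ?P * (\<Sum>i\<in>UNIV. x $ i * bar1 i x)"
    unfolding barrier1_def barrier2_def p2 sum_distrib_left sum.distrib[symmetric]
    by (intro sum.cong refl) (simp only: distrib_left mult_ac)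
  also have "\<dots> = l * barrier x + l / 2 * ?P * ((l / 2 - 1) * (S / ?\<rho>) + (2 * real CARD('n) + ?E) + (2 * (norm x)\<^sup>2 - x $ m * ?E) - 2 * ?\<rho>)"
  proof -
    have "h * ((h - 1) * (P / r) * S + P * A) + h * P * B = (2 * h) * (P * r) + h * P * ((h - 1) * (S / r) + A + B - 2 * r)"
      for h P r S A B :: real by (simp add: algebra_simps)
    from this[of "l / 2" ?P ?\<rho> S "2 * real CARD('n) + ?E" "2 * (norm x)\<^sup>2 - x $ m * ?E"]
    show ?thesis unfolding s1 s2 s3 S_def[symmetric] p0 by simp
  qed
  also have "\<dots> < l * barrier x"
    using neg P l_pos by (simp add: mult_pos_neg)
  finally show ?thesis .
qed

section \<open>The maximum principle\<close>

lemma u_normal: "x $ m = 0 \<Longrightarrow> \<exists>d\<le>0. ((\<lambda>r. u (x + r *\<^sub>R axis m 1)) has_real_derivative d) (at_right 0)"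
  using sol by (auto simp: thin_obstacle_solution_def thin_space_def has_normal_derivative_def)

text \<open>The barrier dominates at infinity, so a negative value of \<open>W\<close> would produce
  a negative minimum over the closed half-space. At a thin point the inward derivative of
  \<open>W\<close> is strictly negative: that of \<open>u\<close> is at most 0, that of the average
  is 0 and that of the barrier is negative. At an interior point,
  \<open>0 \<le> \<Delta>W + x \<cdot> \<nabla>W < l W < 0\<close>. Both are impossible.\<close>

lemma gauss_average_le_perturbed:
  assumes \<delta>: "\<delta> > 0" and p: "p $ m \<ge> 0"
  shows "u p - gauss_average p + \<delta> * barrier p \<ge> 0"
proof (rule ccontr)
  define W where "W x = u x - gauss_average x + \<delta> * barrier x" for x
  assume "\<not> u p - gauss_average p + \<delta> * barrier p \<ge> 0"
  then have Wp: "W p < 0" by (simp add: W_def)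
  obtain R where R: "R > 0" "\<And>x. norm x \<ge> R \<Longrightarrow> \<bar>u x - gauss_average x\<bar> \<le> \<delta> * norm x powr l"
    using u_minus_gauss_average_small[OF \<delta>] by blast
  have far: "W x \<ge> 0" if "norm x \<ge> R" for x
  proof -
    have "\<delta> * norm x powr l \<le> \<delta> * barrier x" using \<delta> barrier_ge by (intro mult_left_mono) auto
    then show ?thesis using R(2)[OF that] unfolding W_def by linarith
  qed
  let ?S = "{x::real^'n. x $ m \<ge> 0} \<inter> cball 0 R"
  have "closed {x::real^'n. x $ m \<ge> 0}" by (intro closed_Collect_le continuous_intros)
  then have cS: "compact ?S" by (simp add: closed_Int_compact)
  have "norm p < R" using far[of p] Wp by linarith
  then have pS: "p \<in> ?S" using p by simp
  have sc: "continuous_on UNIV gauss_average"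
    unfolding gauss_average_def[abs_def] using gmass_pos by (intro continuous_intros mollified_cont) auto
  have "continuous_on UNIV W" unfolding W_def[abs_def] by (intro continuous_intros u_cont sc barrier_cont)
  then have "continuous_on ?S W" by (rule continuous_on_subset) simp
  then obtain y where y: "y \<in> ?S" "\<And>x. x \<in> ?S \<Longrightarrow> W y \<le> W x"
    using continuous_attains_inf[OF cS] pS by blast
  have Wy: "W y < 0" using y(2)[OF pS] Wp by linarith
  have min: "W y \<le> W x" if "x $ m \<ge> 0" for x
    using y(2)[of x] far[of x] Wy that by (cases "norm x \<le> R") auto
  have ds: "((\<lambda>r. gauss_average (x + r *\<^sub>R axis i 1)) has_real_derivative mollified1 i x / gmass) (at 0)" for x i
    unfolding gauss_average_def by (rule DERIV_cdivide[OF mollified_deriv])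
  have ds1: "((\<lambda>r. mollified1 i (x + r *\<^sub>R axis i 1) / gmass) has_real_derivative mollified2 i x / gmass) (at 0)" for x i
    by (rule DERIV_cdivide[OF mollified1_deriv])
  show False
  proof (cases "y $ m = 0")
    case True
    obtain d where d: "d \<le> 0" "((\<lambda>r. u (y + r *\<^sub>R axis m 1)) has_real_derivative d) (at_right 0)"
      using u_normal[OF True] by blast
    have "((\<lambda>r. W (y + r *\<^sub>R axis m 1)) has_real_derivative d - mollified1 m y / gmass + \<delta> * barrier1 m y) (at_right 0)"
      unfolding W_def
      by (intro DERIV_add DERIV_diff DERIV_cmult d(2) has_field_derivative_at_within[OF ds]
          has_field_derivative_at_within[OF barrier_deriv])
    moreover have "d - mollified1 m y / gmass + \<delta> * barrier1 m y < 0"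
    proof -
      have "barrier1 m y < 0"
        using True l_pos bar0_pos[of y] by (simp add: barrier1_def bar1_def)
      then have "\<delta> * barrier1 m y < 0" using \<delta> by (rule mult_pos_neg[rotated])
      then show ?thesis using d(1) mollified1_thin[OF True] by simp
    qed
    ultimately obtain c where c: "c > 0" "\<forall>h>0. 0 + h \<in> {0<..} \<longrightarrow> h < c \<longrightarrow> W (y + (0 + h) *\<^sub>R axis m 1) < W (y + 0 *\<^sub>R axis m 1)"
      using has_real_derivative_neg_dec_right by blast
    then have "W (y + (c / 2) *\<^sub>R axis m 1) < W y" by (auto dest!: spec[of _ "c / 2"])
    moreover have "W y \<le> W (y + (c / 2) *\<^sub>R axis m 1)" using True c(1) by (intro min) (simp add: axis_def)
    ultimately show False by simp
  next
    case False
    then have ym: "y $ m > 0" using y(1) by auto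
    define W1 where "W1 i x = partial i u x - mollified1 i x / gmass + \<delta> * barrier1 i x" for i x
    define W2 where "W2 i x = partial i (partial i u) x - mollified2 i x / gmass + \<delta> * barrier2 i x" for i x
    have dW: "((\<lambda>r. W (x + r *\<^sub>R axis i 1)) has_real_derivative W1 i x) (at 0)" if "x $ m \<noteq> 0" for x i
      unfolding W_def W1_def by (intro DERIV_add DERIV_diff DERIV_cmult u_deriv[OF that] ds barrier_deriv)
    have dW1: "((\<lambda>r. W1 i (x + r *\<^sub>R axis i 1)) has_real_derivative W2 i x) (at 0)" if "x $ m \<noteq> 0" for x i
      unfolding W1_def W2_def by (intro DERIV_add DERIV_diff DERIV_cmult u_deriv2[OF that] ds1 barrier1_deriv)
    have near: "(y + r *\<^sub>R axis i 1) $ m > 0" if "\<bar>r\<bar> < y $ m" for r i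
      using that ym by (auto simp: axis_def)
    have crit: "W1 i y = 0" "W2 i y \<ge> 0" for i
    proof -
      have d1: "((\<lambda>r. W (y + r *\<^sub>R axis i 1)) has_real_derivative W1 i (y + r *\<^sub>R axis i 1)) (at r)"
        if r: "\<bar>r\<bar> < y $ m" for r
        by (rule line_derivative_shift[OF dW]) (use near[OF r, of i] in simp)
      have m: "W (y + 0 *\<^sub>R axis i 1) \<le> W (y + r *\<^sub>R axis i 1)" if r: "\<bar>r\<bar> < y $ m" for r
        using min[OF less_imp_le[OF near[OF r, of i]]] by simp
      show "W1 i y = 0" "W2 i y \<ge> 0"
        using second_derivative_nonneg_at_min[OF ym d1 dW1[OF False] m] by auto
    qed
    have "0 \<le> (\<Sum>i\<in>UNIV. W2 i y)" using crit(2) by (rule sum_nonneg)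
    also have "\<dots> = (\<Sum>i\<in>UNIV. W2 i y) + (\<Sum>i\<in>UNIV. y $ i * W1 i y)" using crit(1) by simp
    also have "\<dots> = (\<Sum>i\<in>UNIV. partial i (partial i u) y) + (\<Sum>i\<in>UNIV. y $ i * partial i u y)
        - ((\<Sum>i\<in>UNIV. mollified2 i y) + (\<Sum>i\<in>UNIV. y $ i * mollified1 i y)) / gmass
        + \<delta> * ((\<Sum>i\<in>UNIV. barrier2 i y) + (\<Sum>i\<in>UNIV. y $ i * barrier1 i y))"
      unfolding W1_def W2_def
      by (simp add: sum.distrib sum_subtractf sum_distrib_left sum_divide_distrib algebra_simps add_divide_distrib)
    also have "\<dots> < 0 + l * u y - (l * mollified y) / gmass + \<delta> * (l * barrier y)"
      using barrier_supersolution[of y] ym \<delta>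
      unfolding u_harmonic[OF False] u_euler[OF False] mollified_equation by simp
    also have "\<dots> = l * W y" by (simp add: W_def gauss_average_def algebra_simps)
    also have "\<dots> < 0" using l_pos Wy by (rule mult_pos_neg)
    finally show False .
  qed
qed

lemma gauss_average_le_u: "gauss_average x \<le> u x"
proof -
  have half: "gauss_average x \<le> u x" if "x $ m \<ge> 0" for x
  proof (rule ccontr)
    assume "\<not> gauss_average x \<le> u x"
    then have pos: "gauss_average x - u x > 0" by simp
    have b: "barrier x > 0" unfolding barrier_def using bar0_pos[of x] by simp
    \<comment> \<open>Instead of letting \<open>\<delta>\<close> tend to 0, it is chosen so that the
      perturbation at \<open>x\<close> is half of the supposed gap.\<close>
    have "u x - gauss_average x + ((gauss_average x - u x) / (2 * barrier x)) * barrier x \<ge> 0"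
      using that pos b by (intro gauss_average_le_perturbed) auto
    moreover have "((gauss_average x - u x) / (2 * barrier x)) * barrier x = (gauss_average x - u x) / 2" using b by simp
    moreover have "(gauss_average x - u x) / 2 = gauss_average x / 2 - u x / 2" by (rule diff_divide_distrib)
    ultimately show False using pos by linarith
  qed
  show ?thesis
  proof (cases "x $ m \<ge> 0")
    case False
    then have "thin_reflection m x $ m \<ge> 0" by (simp add: thin_reflection_def)
    from half[OF this] show ?thesis by (simp add: u_reflect gauss_average_def mollified_reflect)
  qed (rule half)
qed

text \<open>Comparison at the origin: there \<open>u\<close> vanishes by homogeneity, and
  \<open>mollified 0\<close> is the Gaussian mean of \<open>u\<close>.\<close>

lemma integral_gauss_u_nonpos: "(\<integral>x. gauss x * u x \<partial>lborel) \<le> 0"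
proof -
  have "mollified 0 / gmass \<le> 0" using gauss_average_le_u[of 0] by (simp add: gauss_average_def u_zero)
  then have "mollified 0 \<le> 0" using gmass_pos by (simp add: divide_le_0_iff)
  then show ?thesis by (simp add: mollified_def)
qed

end

section \<open>Analyticity\<close>

text \<open>The lowest nonzero term would dominate as \<open>r\<close> tends to 0. Once the smaller
  coefficients are known to vanish, division by \<open>r ^ j\<close> leaves \<open>a j\<close> in
  the limit, against the bound \<open>B * r powr (l - j)\<close>. The hypothesis
  \<open>N < l + 1\<close> gives \<open>j < l\<close> for every \<open>j < N\<close>.\<close>

lemma coeffs_zero_of_small_polynomial:
  fixes a :: "nat \<Rightarrow> real"
  assumes b: "\<And>r. 0 < r \<Longrightarrow> r \<le> 1 \<Longrightarrow> \<bar>\<Sum>j<N. a j * r ^ j\<bar> \<le> B * r powr l"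
    and l: "real N < l + 1" and j: "j < N"
  shows "a j = 0"
  using j
proof (induction j rule: less_induct)
  case (less j)
  let ?g = "\<lambda>r. \<Sum>i\<in>{j..<N}. a i * r ^ (i - j)"
  have eq: "(\<Sum>i<N. a i * r ^ i) = r ^ j * ?g r" for r
  proof -
    have "(\<Sum>i<N. a i * r ^ i) = (\<Sum>i\<in>{j..<N}. a i * r ^ i)"
      using less by (intro sum.mono_neutral_right) auto
    also have "\<dots> = r ^ j * ?g r"
      unfolding sum_distrib_left by (intro sum.cong refl) (simp add: mult.left_commute flip: power_add)
    finally show ?thesis .
  qed
  have "isCont ?g 0" by (intro continuous_intros)
  then have "(?g \<longlongrightarrow> ?g 0) (at 0)" by (simp add: isCont_def)
  moreover have "?g 0 = a j"
  proof -
    have "?g 0 = (\<Sum>i\<in>{j..<N}. if i = j then a j else 0)"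
      by (intro sum.cong refl) (auto simp: power_0_left)
    then show ?thesis using less.prems by simp
  qed
  ultimately have "(?g \<longlongrightarrow> a j) (at_right 0)" by (simp add: filterlim_at_split)
  moreover have "(?g \<longlongrightarrow> 0) (at_right 0)"
  proof (rule Lim_null_comparison)
    show "((\<lambda>r. B * r powr (l - real j)) \<longlongrightarrow> 0) (at_right 0)"
    proof -
      have "l - real j > 0" using l less.prems by linarith
      then have "((\<lambda>r::real. r powr (l - real j)) \<longlongrightarrow> 0) (at_right 0)" by real_asymp
      then show ?thesis using tendsto_mult_right_zero by blast
    qed
    have "eventually (\<lambda>r::real. 0 < r \<and> r \<le> 1) (at_right 0)"
      by (rule eventually_at_rightI[of 0 1]) auto
    then show "eventually (\<lambda>r. norm (?g r) \<le> B * r powr (l - real j)) (at_right 0)"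
    proof (rule eventually_mono)
      fix r :: real assume r: "0 < r \<and> r \<le> 1"
      then have "r ^ j * \<bar>?g r\<bar> \<le> B * r powr l"
        using b[of r] unfolding eq by (simp add: abs_mult)
      moreover have "r powr l = r ^ j * r powr (l - real j)"
        using r by (simp add: powr_diff powr_realpow)
      ultimately have "r ^ j * \<bar>?g r\<bar> \<le> r ^ j * (B * r powr (l - real j))" by (simp add: mult_ac)
      then show "norm (?g r) \<le> B * r powr (l - real j)" using r by simp
    qed
  qed
  ultimately show "a j = 0" by (rule tendsto_unique[OF trivial_limit_at_right_real])
qed

lemma exp_taylor_remainder:
  fixes v :: real
  shows "\<bar>exp v - (\<Sum>j<N. v ^ j / fact j)\<bar> \<le> \<bar>v\<bar> ^ N * exp \<bar>v\<bar>"
proof -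
  obtain t where t: "\<bar>t\<bar> \<le> \<bar>v\<bar>" "exp v = (\<Sum>j<N. v ^ j / fact j) + exp t / fact N * v ^ N"
    using Maclaurin_exp_le[of v N] by blast
  have "exp t / fact N \<le> exp \<bar>v\<bar> / 1"
    using t(1) by (intro frac_le) (auto simp: fact_ge_1)
  then have "exp t / fact N * \<bar>v\<bar> ^ N \<le> exp \<bar>v\<bar> * \<bar>v\<bar> ^ N" by (intro mult_right_mono) auto
  then show ?thesis using t(2) by (simp add: abs_mult power_abs mult.commute)
qed

context homogeneous_thin_solution
begin

text \<open>By Fubini the mean of the convolution is the integral of \<open>u\<close> against the
  convolution of two Gaussians, a multiple of \<open>exp (- (norm z)^2 / 4)\<close>. Scaling by
  \<open>sqrt 2\<close> turns this weight back into \<open>gauss\<close>, and homogeneity turns the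
  integral into a multiple of the mean of \<open>u\<close>.\<close>

lemma integral_gauss_mollified:
  assumes zero: "(\<integral>x. gauss x * u x \<partial>lborel) = 0"
  shows "integrable lborel (\<lambda>x. gauss x * mollified x)" "(\<integral>x. gauss x * mollified x \<partial>lborel) = 0"
proof -
  obtain C where C: "C > 0" "\<And>x. \<bar>u x\<bar> \<le> C * (1 + norm x) ^ nat \<lceil>l\<rceil>" using u_bound by blast
  let ?f = "\<lambda>x z::real^'n. gauss x * (gauss (z - x) * u z)"
  have "integrable lborel (\<lambda>p::(real^'n) \<times> (real^'n). ?f (fst p) (snd p))"
  proof (rule integrable_gaussian_bound)
    fix p :: "(real^'n) \<times> (real^'n)"
    obtain x z where p: "p = (x, z)" by (meson surj_pair)
    have n: "(norm p)\<^sup>2 = (norm x)\<^sup>2 + (norm z)\<^sup>2" by (simp add: p norm_Pair)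
    have nz: "norm z \<le> norm p" by (simp add: p norm_snd_le)
    \<comment> \<open>Completing the square bounds the joint exponent by a multiple of
      \<open>(norm p)^2\<close>. The constant 1/3 is a convenient one below the smallest eigenvalue
      \<open>(3 - sqrt 5) / 2\<close> of the form
      \<open>(norm x)^2 + (norm (z - x))^2\<close>.\<close>
    have "0 \<le> 2/3 * (norm (z - (3/2) *\<^sub>R x))\<^sup>2 + 1/6 * (norm x)\<^sup>2" by simp
    also have "\<dots> = (norm (z - x))\<^sup>2 + (norm x)\<^sup>2 - 1/3 * (norm p)\<^sup>2"
      unfolding n by (simp add: power2_norm_eq_inner inner_diff_left inner_diff_right inner_commute field_simps)
    finally have "- (norm x)\<^sup>2 / 2 + - (norm (z - x))\<^sup>2 / 2 \<le> - (1/6) * (norm p)\<^sup>2" by simp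
    then have g: "gauss x * gauss (z - x) \<le> exp (- (1/6) * (norm p)\<^sup>2)" unfolding exp_add[symmetric] by simp
    have "(1 + norm z) ^ nat \<lceil>l\<rceil> \<le> (1 + norm p) ^ nat \<lceil>l\<rceil>" using nz by (intro power_mono) auto
    then have "C * (1 + norm z) ^ nat \<lceil>l\<rceil> \<le> C * (1 + norm p) ^ nat \<lceil>l\<rceil>" using C(1) by (intro mult_left_mono) auto
    then have "\<bar>u z\<bar> \<le> C * (1 + norm p) ^ nat \<lceil>l\<rceil>" by (rule order_trans[OF C(2)])
    then have "gauss x * gauss (z - x) * \<bar>u z\<bar> \<le> exp (- (1/6) * (norm p)\<^sup>2) * (C * (1 + norm p) ^ nat \<lceil>l\<rceil>)"
      using g by (intro mult_mono) auto
    then show "\<bar>?f (fst p) (snd p)\<bar> \<le> C * ((1 + norm p) ^ nat \<lceil>l\<rceil> * exp (- (1/6) * (norm p)\<^sup>2))"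
      by (simp add: p abs_mult mult_ac)
  next
    have "continuous_on UNIV (\<lambda>p::(real^'n) \<times> (real^'n). ?f (fst p) (snd p))"
      by (intro continuous_intros continuous_on_compose2[OF u_cont]) auto
    then show "(\<lambda>p::(real^'n) \<times> (real^'n). ?f (fst p) (snd p)) \<in> borel_measurable lborel"
      by (simp add: borel_measurable_continuous_onI)
  qed simp
  then have int: "integrable (lborel \<Otimes>\<^sub>M lborel) (\<lambda>(x, z). ?f x z)"
    by (simp only: lborel_prod case_prod_beta')
  have m: "gauss x * mollified x = (\<integral>z. ?f x z \<partial>lborel)" for x
    by (simp add: mollified_def)
  show "integrable lborel (\<lambda>x. gauss x * mollified x)"
    unfolding m using lborel_pair.integrable_fst[OF int] by simp
  have "(\<integral>x. gauss x * mollified x \<partial>lborel) = (\<integral>z. (\<integral>x. ?f x z \<partial>lborel) \<partial>lborel)"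
    unfolding m using lborel_pair.Fubini_integral[OF int] by simp
  also have "(\<lambda>z. \<integral>x. ?f x z \<partial>lborel) = (\<lambda>z. (\<integral>x. exp (- (norm (x :: real^'n))\<^sup>2) \<partial>lborel) * (exp (- (norm z)\<^sup>2 / 4) * u z))"
  proof
    fix z :: "real^'n"
    have e: "?f x z = exp (- (norm (- (1/2) *\<^sub>R z + x))\<^sup>2) * (exp (- (norm z)\<^sup>2 / 4) * u z)" for x
    proof -
      have "- (norm x)\<^sup>2 / 2 + - (norm (z - x))\<^sup>2 / 2 = - (norm (- (1/2) *\<^sub>R z + x))\<^sup>2 + - (norm z)\<^sup>2 / 4"
        by (simp add: power2_norm_eq_inner inner_diff_left inner_diff_right inner_add_left inner_add_right inner_commute field_simps)
      then show ?thesis unfolding mult.assoc[symmetric] exp_add[symmetric] by simp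
    qed
    have "(\<integral>x. ?f x z \<partial>lborel) = (\<integral>x. exp (- (norm (- (1/2) *\<^sub>R z + x))\<^sup>2) \<partial>lborel) * (exp (- (norm z)\<^sup>2 / 4) * u z)"
      unfolding e by (rule Bochner_Integration.integral_mult_left_zero)
    also have "(\<integral>x. exp (- (norm (- (1/2) *\<^sub>R z + x))\<^sup>2) \<partial>lborel) = (\<integral>x. exp (- (norm (x :: real^'n))\<^sup>2) \<partial>lborel)"
      by (rule integral_translate_lborel) auto
    finally show "(\<integral>x. ?f x z \<partial>lborel) = (\<integral>x. exp (- (norm (x :: real^'n))\<^sup>2) \<partial>lborel) * (exp (- (norm z)\<^sup>2 / 4) * u z)" .
  qed
  also have "(\<integral>z. (\<integral>x. exp (- (norm (x :: real^'n))\<^sup>2) \<partial>lborel) * (exp (- (norm z)\<^sup>2 / 4) * u z) \<partial>lborel)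
    = (\<integral>x. exp (- (norm (x :: real^'n))\<^sup>2) \<partial>lborel) * (\<integral>z. exp (- (norm z)\<^sup>2 / 4) * u z \<partial>lborel)"
    by simp
  also have "(\<integral>z. exp (- (norm z)\<^sup>2 / 4) * u z \<partial>lborel) = 0"
  proof -
    have "(\<integral>z. exp (- (norm z)\<^sup>2 / 4) * u z \<partial>lborel)
      = sqrt 2 ^ DIM(real^'n) * (\<integral>z. exp (- (norm (sqrt 2 *\<^sub>R z))\<^sup>2 / 4) * u (sqrt 2 *\<^sub>R z) \<partial>lborel)"
      by (rule integral_scaleR_lborel) auto
    also have "(\<integral>z. exp (- (norm (sqrt 2 *\<^sub>R z))\<^sup>2 / 4) * u (sqrt 2 *\<^sub>R z) \<partial>lborel) = (\<integral>z. sqrt 2 powr l * (gauss z * u z) \<partial>lborel)"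
      by (intro Bochner_Integration.integral_cong refl) (simp add: u_scale power_mult_distrib)
    also have "\<dots> = 0" using zero by simp
    finally show ?thesis by simp
  qed
  finally show "(\<integral>x. gauss x * mollified x \<partial>lborel) = 0" by simp
qed

text \<open>Both sides have Gaussian mean 0 and their difference has a sign, so they agree almost
  everywhere. The set of agreement is closed, hence everything.\<close>

lemma u_eq_gauss_average:
  assumes zero: "(\<integral>x. gauss x * u x \<partial>lborel) = 0"
  shows "u x = gauss_average x"
proof -
  have iu: "integrable lborel (\<lambda>x. gauss x * u x)"
    using gauss_weighted_integrable[of "\<lambda>_. 1" 1 0] by simp
  have ism: "integrable lborel (\<lambda>x. gauss x * gauss_average x)"
    using integral_gauss_mollified(1)[OF zero] by (simp add: gauss_average_def)
  have int: "integrable lborel (\<lambda>x. gauss x * u x - gauss x * gauss_average x)"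
    by (rule Bochner_Integration.integrable_diff[OF iu ism])
  have "(\<integral>x. gauss x * u x - gauss x * gauss_average x \<partial>lborel) = 0"
    using Bochner_Integration.integral_diff[OF iu ism] integral_gauss_mollified(2)[OF zero] zero
    by (simp add: gauss_average_def)
  moreover have nonneg: "0 \<le> gauss x * u x - gauss x * gauss_average x" for x
    using mult_left_mono[OF gauss_average_le_u, of "gauss x" x] by simp
  ultimately have "AE x in lborel. gauss x * u x - gauss x * gauss_average x = 0"
    using integral_nonneg_eq_0_iff_AE[OF int] by auto
  then have "AE x in lborel. x \<in> {x. u x = gauss_average x}" by (rule AE_mp) simp
  then have "AE x in lebesgue. x \<in> {x. u x = gauss_average x}" by (rule AE_completion)
  moreover have "closed {x. u x = gauss_average x}"
    unfolding gauss_average_def using gmass_pos by (intro closed_Collect_eq continuous_intros u_cont mollified_cont) auto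
  ultimately have "x \<in> {x. u x = gauss_average x}" by (rule mem_closed_if_AE_lebesgue[rotated])
  then show ?thesis by simp
qed

text \<open>Along rays \<open>u\<close> is a multiple of \<open>r powr l\<close>; if it equals its Gaussian average, it is also real analytic there.\<close>

lemma u_zero_of_gauss_mean_zero:
  assumes zero: "(\<integral>x. gauss x * u x \<partial>lborel) = 0" and N: "real N < l + 1" "l < real N"
  shows "u x = 0"
proof -
  obtain C where C: "C > 0" "\<And>x. \<bar>u x\<bar> \<le> C * (1 + norm x) ^ nat \<lceil>l\<rceil>" using u_bound by blast
  define A where "A j = (\<integral>z. gauss z * u z * ((z \<bullet> x) ^ j / fact j) \<partial>lborel)" for j
  \<comment> \<open>Expanding the square in \<open>gauss (z - r *\<^sub>R x)\<close> splits
    \<open>mollified (r *\<^sub>R x)\<close> into \<open>exp (- r^2 * (norm x)^2 / 2)\<close> times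
    \<open>E r\<close>. The \<open>A j\<close> are the Taylor coefficients of \<open>E\<close> at
    0.\<close>
  define E where "E r = (\<integral>z. gauss z * u z * exp (r * (z \<bullet> x)) \<partial>lborel)" for r
  have zx: "\<bar>z \<bullet> x\<bar> \<le> norm z * norm x" for z by (rule Cauchy_Schwarz_ineq2)
  have ev: "exp \<bar>r * (z \<bullet> x)\<bar> \<le> exp ((norm x)\<^sup>2) * exp ((norm z)\<^sup>2 / 4)" if "\<bar>r\<bar> \<le> 1" for r z
  proof -
    have "\<bar>r * (z \<bullet> x)\<bar> \<le> 1 * (norm z * norm x)" unfolding abs_mult using that zx by (intro mult_mono) auto
    \<comment> \<open>Split so that the growth in \<open>z\<close> uses up only half of the exponent
      of \<open>gauss z\<close>; the decay \<open>exp (- (1/4) * (norm z)^2)\<close> remains for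
      domination.\<close>
    also have "\<dots> \<le> (norm x)\<^sup>2 + (norm z)\<^sup>2 / 4"
      using zero_le_power2[of "norm x - norm z / 2"] by (simp add: power2_diff power2_eq_square algebra_simps)
    finally show ?thesis by (simp flip: exp_add)
  qed
  have dom: "\<bar>gauss z * u z * c\<bar> \<le> (C * K * exp ((norm x)\<^sup>2)) * ((1 + norm z) ^ (nat \<lceil>l\<rceil> + M) * exp (- (1/4) * (norm z)\<^sup>2))"
    if c: "\<bar>c\<bar> \<le> K * (1 + norm z) ^ M * (exp ((norm x)\<^sup>2) * exp ((norm z)\<^sup>2 / 4))" and K: "K \<ge> 0" for c z K M
  proof -
    have "gauss z * exp ((norm z)\<^sup>2 / 4) = exp (- (1/4) * (norm z)\<^sup>2)" by (simp flip: exp_add)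
    moreover have "gauss z * \<bar>u z\<bar> * \<bar>c\<bar> \<le> gauss z * (C * (1 + norm z) ^ nat \<lceil>l\<rceil>) * (K * (1 + norm z) ^ M * (exp ((norm x)\<^sup>2) * exp ((norm z)\<^sup>2 / 4)))"
      using c C K by (intro mult_mono) auto
    moreover have "gauss z * (C * (1 + norm z) ^ nat \<lceil>l\<rceil>) * (K * (1 + norm z) ^ M * (exp ((norm x)\<^sup>2) * exp ((norm z)\<^sup>2 / 4)))
      = (C * K * exp ((norm x)\<^sup>2)) * ((1 + norm z) ^ (nat \<lceil>l\<rceil> + M) * (gauss z * exp ((norm z)\<^sup>2 / 4)))"
      by (simp only: power_add mult_ac)
    ultimately show ?thesis by (simp only: abs_mult abs_exp_cancel)
  qed
  have one: "1 \<le> exp ((norm x)\<^sup>2) * exp ((norm z)\<^sup>2 / 4)" for z :: "real^'n" by (simp flip: exp_add)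
  have pb: "\<bar>(z \<bullet> x) ^ j\<bar> \<le> norm x ^ j * (1 + norm z) ^ j" for z j
  proof -
    have "\<bar>z \<bullet> x\<bar> \<le> norm x * (1 + norm z)" using zx[of z] by (simp add: algebra_simps add_increasing)
    then have "\<bar>z \<bullet> x\<bar> ^ j \<le> (norm x * (1 + norm z)) ^ j" by (intro power_mono) auto
    then show ?thesis by (simp add: power_abs power_mult_distrib)
  qed
  have iA: "integrable lborel (\<lambda>z. gauss z * u z * ((z \<bullet> x) ^ j / fact j))" for j
  proof (rule gauss_weighted_integrable[where C = "norm x ^ j" and N = j])
    fix z :: "real^'n"
    have "\<bar>(z \<bullet> x) ^ j / fact j\<bar> \<le> \<bar>(z \<bullet> x) ^ j\<bar> / 1"
      unfolding abs_divide by (intro frac_le) (auto simp: fact_ge_1)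
    then show "\<bar>(z \<bullet> x) ^ j / fact j\<bar> \<le> norm x ^ j * (1 + norm z) ^ j" using pb[of z j] by simp
  qed auto
  have iE: "integrable lborel (\<lambda>z. gauss z * u z * exp (r * (z \<bullet> x)))" if r: "\<bar>r\<bar> \<le> 1" for r
  proof (rule integrable_gaussian_bound)
    fix z :: "real^'n"
    have "exp (r * (z \<bullet> x)) \<le> exp \<bar>r * (z \<bullet> x)\<bar>" by simp
    from order_trans[OF this ev[OF r]]
    have "\<bar>exp (r * (z \<bullet> x))\<bar> \<le> 1 * (1 + norm z) ^ 0 * (exp ((norm x)\<^sup>2) * exp ((norm z)\<^sup>2 / 4))" by simp
    then show "\<bar>gauss z * u z * exp (r * (z \<bullet> x))\<bar> \<le> (C * 1 * exp ((norm x)\<^sup>2)) * ((1 + norm z) ^ (nat \<lceil>l\<rceil> + 0) * exp (- (1/4) * (norm z)\<^sup>2))"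
      by (rule dom) simp
  qed auto
  define w where "w z = (C * norm x ^ N * exp ((norm x)\<^sup>2)) * ((1 + norm z) ^ (nat \<lceil>l\<rceil> + N) * exp (- (1/4) * (norm z)\<^sup>2))" for z :: "real^'n"
  have iw: "integrable lborel w" unfolding w_def
    by (rule integrable_gaussian_bound[where c = "1/4" and C = "C * norm x ^ N * exp ((norm x)\<^sup>2)" and N = "nat \<lceil>l\<rceil> + N"])
      (use C in \<open>auto simp: abs_mult\<close>)
  define M where "M = (\<integral>z. w z \<partial>lborel)"
  have approx: "\<bar>E r - (\<Sum>j<N. A j * r ^ j)\<bar> \<le> r ^ N * M" if r: "0 < r" "r \<le> 1" for r
  proof -
    have r1: "\<bar>r\<bar> \<le> 1" using r by simp
    have "(\<Sum>j<N. A j * r ^ j) = (\<integral>z. (\<Sum>j<N. gauss z * u z * ((z \<bullet> x) ^ j / fact j) * r ^ j) \<partial>lborel)"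
      unfolding A_def using iA
      by (subst Bochner_Integration.integral_sum) (auto intro: integrable_mult_left simp del: times_divide_eq_right times_divide_eq_left)
    moreover have "(\<integral>z. gauss z * u z * exp (r * (z \<bullet> x)) - (\<Sum>j<N. gauss z * u z * ((z \<bullet> x) ^ j / fact j) * r ^ j) \<partial>lborel)
      = E r - (\<integral>z. (\<Sum>j<N. gauss z * u z * ((z \<bullet> x) ^ j / fact j) * r ^ j) \<partial>lborel)"
      unfolding E_def
      by (rule Bochner_Integration.integral_diff[OF iE[OF r1]])
        (intro Bochner_Integration.integrable_sum integrable_mult_left iA)
    ultimately have "E r - (\<Sum>j<N. A j * r ^ j)
      = (\<integral>z. gauss z * u z * exp (r * (z \<bullet> x)) - (\<Sum>j<N. gauss z * u z * ((z \<bullet> x) ^ j / fact j) * r ^ j) \<partial>lborel)"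
      by simp
    also have "\<bar>\<dots>\<bar> \<le> (\<integral>z. r ^ N * w z \<partial>lborel)"
    proof (rule order_trans[OF integral_abs_bound integral_mono])
      show "integrable lborel (\<lambda>z. \<bar>gauss z * u z * exp (r * (z \<bullet> x)) - (\<Sum>j<N. gauss z * u z * ((z \<bullet> x) ^ j / fact j) * r ^ j)\<bar>)"
        by (intro integrable_abs Bochner_Integration.integrable_diff iE[OF r1] Bochner_Integration.integrable_sum integrable_mult_left iA)
      show "integrable lborel (\<lambda>z. r ^ N * w z)" using iw by simp
      fix z :: "real^'n"
      let ?v = "r * (z \<bullet> x)"
      have eq: "gauss z * u z * exp ?v - (\<Sum>j<N. gauss z * u z * ((z \<bullet> x) ^ j / fact j) * r ^ j)
        = gauss z * u z * (exp ?v - (\<Sum>j<N. ?v ^ j / fact j))"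
        unfolding right_diff_distrib sum_distrib_left by (simp add: power_mult_distrib mult_ac)
      have "\<bar>exp ?v - (\<Sum>j<N. ?v ^ j / fact j)\<bar> \<le> \<bar>?v\<bar> ^ N * exp \<bar>?v\<bar>" by (rule exp_taylor_remainder)
      moreover have "\<bar>?v\<bar> ^ N \<le> r ^ N * (norm x ^ N * (1 + norm z) ^ N)"
      proof -
        have "\<bar>?v\<bar> ^ N = r ^ N * \<bar>(z \<bullet> x) ^ N\<bar>" using r by (simp add: abs_mult power_mult_distrib power_abs)
        then show ?thesis using pb[of z N] r by (simp add: mult_left_mono)
      qed
      then have "\<bar>?v\<bar> ^ N * exp \<bar>?v\<bar> \<le> r ^ N * (norm x ^ N * (1 + norm z) ^ N) * (exp ((norm x)\<^sup>2) * exp ((norm z)\<^sup>2 / 4))"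
        using r by (intro mult_mono ev[OF r1]) auto
      ultimately have "\<bar>exp ?v - (\<Sum>j<N. ?v ^ j / fact j)\<bar> \<le> r ^ N * (norm x ^ N * (1 + norm z) ^ N) * (exp ((norm x)\<^sup>2) * exp ((norm z)\<^sup>2 / 4))"
        by (rule order_trans)
      then have "\<bar>exp ?v - (\<Sum>j<N. ?v ^ j / fact j)\<bar> \<le> (r ^ N * norm x ^ N) * (1 + norm z) ^ N * (exp ((norm x)\<^sup>2) * exp ((norm z)\<^sup>2 / 4))"
        by (simp only: mult.assoc)
      then have "\<bar>gauss z * u z * (exp ?v - (\<Sum>j<N. ?v ^ j / fact j))\<bar>
        \<le> (C * (r ^ N * norm x ^ N) * exp ((norm x)\<^sup>2)) * ((1 + norm z) ^ (nat \<lceil>l\<rceil> + N) * exp (- (1/4) * (norm z)\<^sup>2))"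
        using r by (intro dom) auto
      then show "\<bar>gauss z * u z * exp ?v - (\<Sum>j<N. gauss z * u z * ((z \<bullet> x) ^ j / fact j) * r ^ j)\<bar> \<le> r ^ N * w z"
        unfolding eq w_def by (simp only: mult_ac)
    qed
    also have "\<dots> = r ^ N * M" by (simp add: M_def)
    finally show ?thesis .
  qed
  have E_eq: "E r = gmass * u x * r powr l * exp (r\<^sup>2 * (norm x)\<^sup>2 / 2)" if r: "0 < r" for r
  proof -
    have "r powr l * u x = mollified (r *\<^sub>R x) / gmass"
      using u_eq_gauss_average[OF zero, of "r *\<^sub>R x"] r by (simp add: u_scale gauss_average_def)
    then have "gmass * (r powr l * u x) = mollified (r *\<^sub>R x)" using gmass_pos by (simp add: field_simps)
    also have "\<dots> = (\<integral>z. exp (- r\<^sup>2 * (norm x)\<^sup>2 / 2) * (gauss z * u z * exp (r * (z \<bullet> x))) \<partial>lborel)"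
      unfolding mollified_def
    proof (rule Bochner_Integration.integral_cong[OF refl])
      fix z :: "real^'n"
      have "- (norm (z - r *\<^sub>R x))\<^sup>2 / 2 = - r\<^sup>2 * (norm x)\<^sup>2 / 2 + - (norm z)\<^sup>2 / 2 + r * (z \<bullet> x)"
        unfolding power2_norm_eq_inner
        by (simp add: inner_diff_left inner_diff_right inner_commute power2_eq_square field_simps)
      then show "gauss (z - r *\<^sub>R x) * u z = exp (- r\<^sup>2 * (norm x)\<^sup>2 / 2) * (gauss z * u z * exp (r * (z \<bullet> x)))"
        by (simp only: exp_add mult_ac)
    qed
    also have "\<dots> = exp (- r\<^sup>2 * (norm x)\<^sup>2 / 2) * E r" by (simp add: E_def)
    finally have "gmass * (r powr l * u x) * exp (r\<^sup>2 * (norm x)\<^sup>2 / 2) = (exp (- r\<^sup>2 * (norm x)\<^sup>2 / 2) * exp (r\<^sup>2 * (norm x)\<^sup>2 / 2)) * E r"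
      by (simp only: mult_ac)
    also have "exp (- r\<^sup>2 * (norm x)\<^sup>2 / 2) * exp (r\<^sup>2 * (norm x)\<^sup>2 / 2) = 1" by (simp flip: exp_add)
    finally show ?thesis by (simp add: mult_ac)
  qed
  have M: "M \<ge> 0" unfolding M_def w_def using C by (intro Bochner_Integration.integral_nonneg) auto
  have rN: "r ^ N \<le> r powr l" if "0 < r" "r \<le> 1" for r
  proof -
    have "r ^ N = r powr real N" using that by (simp add: powr_realpow)
    also have "\<dots> \<le> r powr l" using that N by (intro powr_mono') auto
    finally show ?thesis .
  qed
  have small: "\<bar>\<Sum>j<N. A j * r ^ j\<bar> \<le> (gmass * \<bar>u x\<bar> * exp ((norm x)\<^sup>2) + M) * r powr l" if r: "0 < r" "r \<le> 1" for r
  proof -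
    have "r\<^sup>2 * (norm x)\<^sup>2 / 2 \<le> 1 * (norm x)\<^sup>2 / 1"
      using r by (intro frac_le mult_right_mono power_le_one) auto
    then have "\<bar>E r\<bar> \<le> gmass * \<bar>u x\<bar> * r powr l * exp ((norm x)\<^sup>2)"
      unfolding E_eq[OF r(1)] using gmass_pos by (simp add: abs_mult mult_left_mono)
    moreover have "r ^ N * M \<le> r powr l * M" using rN[OF r] M by (rule mult_right_mono)
    moreover have "(gmass * \<bar>u x\<bar> * exp ((norm x)\<^sup>2) + M) * r powr l
      = gmass * \<bar>u x\<bar> * r powr l * exp ((norm x)\<^sup>2) + r powr l * M" by (simp add: algebra_simps)
    ultimately show ?thesis using approx[OF r] by linarith
  qed
  have A0: "A j = 0" if "j < N" for j
    by (rule coeffs_zero_of_small_polynomial[OF small N(1) that])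
  \<comment> \<open>With the first \<open>N\<close> coefficients gone, \<open>E r\<close> is of
    order \<open>r ^ N\<close>. It is also \<open>gmass * u x * r powr l\<close> times a factor of
    at least 1, and \<open>N > l\<close>, so letting \<open>r\<close> tend to 0 forces
    \<open>u x = 0\<close>.\<close>
  have "gmass * \<bar>u x\<bar> \<le> r powr (real N - l) * M" if r: "0 < r" "r \<le> 1" for r
  proof -
    have "gmass * \<bar>u x\<bar> * r powr l * 1 \<le> gmass * \<bar>u x\<bar> * r powr l * exp (r\<^sup>2 * (norm x)\<^sup>2 / 2)"
      using gmass_pos by (intro mult_left_mono) auto
    also have "\<dots> = \<bar>E r\<bar>" using E_eq[OF r(1)] gmass_pos by (simp add: abs_mult)
    also have "\<dots> \<le> r ^ N * M" using approx[OF r] A0 by simp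
    also have "r ^ N = r powr (real N - l) * r powr l" using r by (simp add: powr_realpow flip: powr_add)
    finally have "(gmass * \<bar>u x\<bar>) * r powr l \<le> (r powr (real N - l) * M) * r powr l" by (simp add: mult_ac)
    then show ?thesis using r by simp
  qed
  moreover have "((\<lambda>r. r powr (real N - l) * M) \<longlongrightarrow> 0) (at_right 0)"
  proof -
    have "real N - l > 0" using N by simp
    then have "((\<lambda>r::real. r powr (real N - l)) \<longlongrightarrow> 0) (at_right 0)" by real_asymp
    then show ?thesis using tendsto_mult_left_zero by blast
  qed
  moreover have "eventually (\<lambda>r::real. 0 < r \<and> r \<le> 1) (at_right 0)"
    by (rule eventually_at_rightI[of 0 1]) auto
  ultimately have "gmass * \<bar>u x\<bar> \<le> 0"
    by (intro tendsto_lowerbound[where f = "\<lambda>r. r powr (real N - l) * M" and F = "at_right 0"])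
      (auto elim: eventually_mono)
  then show ?thesis using gmass_pos by (simp add: mult_le_0_iff)
qed

end

theorem theorem1:
  fixes m :: "'n::finite" and l :: real and u :: "real ^ 'n \<Rightarrow> real"
  assumes "l > 0"
    and "thin_obstacle_solution m u"
    and "homogeneous l u"
    and "\<exists>x. u x \<noteq> 0"
  shows "l \<notin> (\<Union>k::nat. {2 * real k <..< 2 * real k + 1})"
proof
  assume "l \<in> (\<Union>k::nat. {2 * real k <..< 2 * real k + 1})"
  then obtain k where k: "2 * real k < l" "l < 2 * real k + 1" by auto
  interpret homogeneous_thin_solution m l u
    using assms by unfold_locales
  obtain h h' where "hermite_sol l h h'" "h 0 * h' 0 > 0"
    using hermite_sol_exists[OF k] by blast
  then have "half_mass \<ge> 0" by (rule half_mass_nonneg)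
  then have "(\<integral>x. exp (- (norm x)\<^sup>2 / 2) * u x \<partial>lborel) = 0"
    using integral_gauss_u integral_gauss_u_nonpos by linarith
  \<comment> \<open>Here \<open>N = 2 * k + 1\<close> is the least integer above \<open>l\<close>:
    the upper end of the interval gives \<open>l < N\<close>, the lower end gives
    \<open>N < l + 1\<close>.\<close>
  then have "u x = 0" for x
    using k by (intro u_zero_of_gauss_mean_zero[where N = "2 * k + 1"]) auto
  then show False using assms(4) by blast
qed

end
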